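(* Let $f:\mathbb{R}^d\times\mathbb{R}\to\mathbb{R}^d$ satisfy the Flux Assumption, and let $I=(0,\infty)$. Let $u,\tilde u\in L^\infty(\mathbb{R}^d\times I)$ be entropy solutions of the scalar conservation law with flux $f$, with initial data $u_0,\tilde u_0\in L^\infty(\mathbb{R}^d)$ respectively. For $x\in\mathbb{R}^d$ and $k_1,k_2\in\mathbb{R}$ set $$\eta(k_1,k_2)=|k_1-k_2|,\qquad q(x,k_1,k_2)=\operatorname{sign}(k_1-k_2)\,\big(f(x,k_1)-f(x,k_2)\big).$$ Then for every Lipschitz function $\psi:\mathbb{R}^d\times I\to[0,\infty)$ with compact support in $\mathbb{R}^d\times I$, $$\int_I\int_{\mathbb{R}^d}\Big[\partial_t\psi(x,t)\,\eta\big(u(x,t),\tilde u(x,t)\big)+\nabla_x\psi(x,t)\cdot q\big(x,u(x,t),\tilde u(x,t)\big)\Big]\,dx\,dt\ \ge\ 0 .$$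
   Context: Notation: $\mathcal{L}^m$ is $m$-dimensional Lebesgue measure; "almost every" refers to Lebesgue measure; $\operatorname{sign}(0)=0$; $B_R(0)=\{x\in\mathbb{R}^d:|x|<R\}$; $D_xf(x,k)$ is the differential of $f(\cdot,k)$ at $x$; $\operatorname{Lip}_c(\mathbb{R}^d\times I)$ is the set of Lipschitz functions of $(x,t)\in\mathbb{R}^d\times I$ with compact support in $\mathbb{R}^d\times I$. Flux Assumption on $f=f(x,k):\mathbb{R}^d\times\mathbb{R}\to\mathbb{R}^d$: (1) $f$ is locally Lipschitz on $\mathbb{R}^d\times\mathbb{R}$. (2a) There is a set $\Theta\subset\mathbb{R}^d$ with $\mathcal{L}^d(\Theta)=0$ such that for every $k\in\mathbb{R}$ the function $f(\cdot,k)$ is differentiable at every $x\in\mathbb{R}^d\setminus\Theta$; moreover, for every $x\in\mathbb{R}^d\setminus\Theta$ the function $k\mapsto D_xf(x,k)$ is continuous. (2b) For every $x\in\mathbb{R}^d\setminus\Theta$ and every compact $K\subset\mathbb{R}$, $\displaystyle\lim_{y\to x}\sup_{k\in K}\frac{|f(y,k)-f(x,k)-D_xf(x,k)(y-x)|}{|y-x|}=0$. Entropy pair: for a convex $\eta\in C^2(\mathbb{R})$ and $k_0\in\mathbb{R}$, put $q(x,k)=\int_{k_0}^k\eta'(\omega)\,\partial_\omega f(x,\omega)\,d\omega$; then $(\eta,q)$ is called an entropy pair. Entropy solution: consider the Cauchy problem $\partial_tu+\operatorname{div}f(x,u)=0$ in $\mathbb{R}^d\times I$, $u(\cdot,0)=u_0$,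 with $u_0\in L^\infty(\mathbb{R}^d)$. A function $u\in L^\infty(\mathbb{R}^d\times I)$ is an entropy solution with initial data $u_0$ if: (i) for every entropy pair $(\eta,q)$ and every $0\le\varphi\in\operatorname{Lip}_c(\mathbb{R}^d\times I)$, $$\int_I\int_{\mathbb{R}^d}\Big[\partial_t\varphi\,\eta(u)+\varphi\big(\operatorname{div}_xq(x,u)-\eta'(u)\operatorname{div}_xf(x,u)\big)+\nabla_x\varphi\cdot q(x,u)\Big]dx\,dt\ge0,$$ where $u=u(x,t)$ and $\operatorname{div}_xf(x,u(x,t))$ means the divergence of $f(\cdot,k)$ at $x$ evaluated at $k=u(x,t)$ (derivative only in the explicit $x$-variable), and likewise for $q$ (these are defined for almost every $(x,t)$ and locally bounded); (ii) there is a set $\Psi\subset I$ with $\mathcal{L}^1(\Psi)=0$ such that for every $R\in(0,\infty)$, $\displaystyle\lim_{t\to0^+,\ t\in I\setminus\Psi}\int_{B_R(0)}|u(x,t)-u_0(x)|\,dx=0$. *)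

theory Defs
  imports "HOL-Analysis.Analysis"
begin

text \<open>
  The space \<open>\<real>\<^sup>d\<close> is a type \<open>'a\<close> of class \<open>euclidean_space\<close>. Fluxes are curried,
  \<open>f x k\<close>, and functions of space and time take a pair \<open>(x, t)\<close>.

  All measure-theoretic notions refer to the completed measure \<^const>\<open>lebesgue\<close>. The classical
  derivatives below (\<^const>\<open>deriv\<close>, \<^const>\<open>frechet_derivative\<close>, \<^const>\<open>vector_derivative\<close>) are
  total functions with an arbitrary value where the derivative does not exist; wherever
  they occur under an integral this happens on a null set only, which completeness makes
  invisible.
\<close>

definition L_infinity :: "'b::euclidean_space set \<Rightarrow> ('b \<Rightarrow> real) \<Rightarrow> bool" where
  "L_infinity S g \<longleftrightarrow>
     g \<in> borel_measurable (lebesgue_on S) \<and> (\<exists>C. AE z in lebesgue_on S. \<bar>g z\<bar> \<le> C)"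

text \<open>The support is the closure of the nonvanishing set. Requiring the closure in the ambient
  space to be compact and contained in \<open>S\<close> is the same as compactness of the closure relative
  to \<open>S\<close>. Values of \<open>g\<close> outside \<open>S\<close> are irrelevant.\<close>

definition Lip_c :: "'b::euclidean_space set \<Rightarrow> ('b \<Rightarrow> real) \<Rightarrow> bool" where
  "Lip_c S g \<longleftrightarrow> (\<exists>L. L-lipschitz_on S g) \<and>
     compact (closure {z \<in> S. g z \<noteq> 0}) \<and> closure {z \<in> S. g z \<noteq> 0} \<subseteq> S"

definition divergence :: "('a::euclidean_space \<Rightarrow> 'a) \<Rightarrow> 'a \<Rightarrow> real" where
  "divergence F x = (\<Sum>b\<in>Basis. frechet_derivative F (at x) b \<bullet> b)"

definition gradient :: "('a::euclidean_space \<Rightarrow> real) \<Rightarrow> 'a \<Rightarrow> 'a" where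
  "gradient g x = (\<Sum>b\<in>Basis. frechet_derivative g (at x) b *\<^sub>R b)"

definition locally_lipschitz :: "('b::metric_space \<Rightarrow> 'c::metric_space) \<Rightarrow> bool" where
  "locally_lipschitz g \<longleftrightarrow> (\<forall>z. \<exists>e>0. \<exists>L. L-lipschitz_on (ball z e) g)"

text \<open>The differential \<open>D\<^sub>x f(x, k)\<close> as a bounded linear map, so that continuity in \<open>k\<close>
  refers to the operator norm.\<close>

definition Dx :: "('a::euclidean_space \<Rightarrow> real \<Rightarrow> 'a) \<Rightarrow> 'a \<Rightarrow> real \<Rightarrow> 'a \<Rightarrow>\<^sub>L 'a" where
  "Dx f x k = Blinfun (frechet_derivative (\<lambda>y. f y k) (at x))"

text \<open>In the last condition, the supremum is over a nonempty set (the supremum of the empty set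
  has no meaning in the reals) that is bounded because \<open>f\<close> and \<open>Dx f x\<close> are continuous in \<open>k\<close>.\<close>

definition flux_assumption :: "('a::euclidean_space \<Rightarrow> real \<Rightarrow> 'a) \<Rightarrow> bool" where
  "flux_assumption f \<longleftrightarrow>
     locally_lipschitz (\<lambda>(x, k). f x k) \<and>
     (\<exists>\<Theta> \<in> null_sets lebesgue.
        (\<forall>k. \<forall>x. x \<notin> \<Theta> \<longrightarrow> (\<lambda>y. f y k) differentiable (at x)) \<and>
        (\<forall>x. x \<notin> \<Theta> \<longrightarrow> continuous_on UNIV (Dx f x)) \<and>
        (\<forall>x. x \<notin> \<Theta> \<longrightarrow> (\<forall>K. compact K \<and> K \<noteq> {} \<longrightarrow>
           ((\<lambda>y. SUP k\<in>K. norm (f y k - f x k - Dx f x k (y - x)) / norm (y - x))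
              \<longlongrightarrow> 0) (at x))))"

definition C2 :: "(real \<Rightarrow> real) \<Rightarrow> bool" where
  "C2 \<eta> \<longleftrightarrow> (\<forall>k. \<eta> differentiable (at k)) \<and> (\<forall>k. deriv \<eta> differentiable (at k)) \<and>
     continuous_on UNIV (deriv (deriv \<eta>))"

definition entropy_pair ::
  "('a::euclidean_space \<Rightarrow> real \<Rightarrow> 'a) \<Rightarrow> (real \<Rightarrow> real) \<Rightarrow> ('a \<Rightarrow> real \<Rightarrow> 'a) \<Rightarrow> bool" where
  "entropy_pair f \<eta> q \<longleftrightarrow> convex_on UNIV \<eta> \<and> C2 \<eta> \<and>
     (\<exists>k0. \<forall>x k. q x k =
        (LINT \<omega>=ereal k0..ereal k|lebesgue. (deriv \<eta> \<omega> *\<^sub>R vector_derivative (f x) (at \<omega>))))"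

definition entropy_solution ::
  "('a::euclidean_space \<Rightarrow> real \<Rightarrow> 'a) \<Rightarrow> real set \<Rightarrow> ('a \<Rightarrow> real) \<Rightarrow> ('a \<times> real \<Rightarrow> real) \<Rightarrow> bool"
where
  "entropy_solution f I u0 u \<longleftrightarrow>
     L_infinity UNIV u0 \<and> L_infinity (UNIV \<times> I) u \<and>
     (\<forall>\<eta> q \<phi>. entropy_pair f \<eta> q \<and> Lip_c (UNIV \<times> I) \<phi> \<and> (\<forall>z \<in> UNIV \<times> I. 0 \<le> \<phi> z) \<longrightarrow>
        0 \<le> (LINT t:I|lebesgue. LINT x|lebesgue.
               deriv (\<lambda>s. \<phi> (x, s)) t * \<eta> (u (x, t))
               + \<phi> (x, t) * (divergence (\<lambda>y. q y (u (x, t))) x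
                              - deriv \<eta> (u (x, t)) * divergence (\<lambda>y. f y (u (x, t))) x)
               + gradient (\<lambda>y. \<phi> (y, t)) x \<bullet> q x (u (x, t)))) \<and>
     (\<exists>\<Psi> \<subseteq> I. \<Psi> \<in> null_sets lebesgue \<and>
        (\<forall>R>0. ((\<lambda>t. LINT x:ball 0 R|lebesgue. \<bar>u (x, t) - u0 x\<bar>) \<longlongrightarrow> 0)
                 (at 0 within {0<..} \<inter> (I - \<Psi>))))"

definition kruzkov_entropy :: "real \<Rightarrow> real \<Rightarrow> real" where
  "kruzkov_entropy k1 k2 = \<bar>k1 - k2\<bar>"

definition kruzkov_flux ::
  "('a::euclidean_space \<Rightarrow> real \<Rightarrow> 'a) \<Rightarrow> 'a \<Rightarrow> real \<Rightarrow> real \<Rightarrow> 'a" where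
  "kruzkov_flux f x k1 k2 = sgn (k1 - k2) *\<^sub>R (f x k1 - f x k2)"

end

theory Submission
  imports Defs
begin

text \<open>
  Kruzhkov's doubling of variables. Approximating \<open>\<bar>k - c\<bar>\<close> by \<open>sqrt ((k - c)\<^sup>2 + \<delta>\<^sup>2)\<close> gives, for
  an entropy solution \<open>u\<close> and every constant \<open>c\<close>, the inequality with entropy \<open>\<bar>u - c\<bar>\<close> and the source
  term \<open>- sgn (u - c) * div f(x, c)\<close>. Use it for \<open>u\<close> at \<open>X\<close> with \<open>c = u'(Y)\<close>, and for \<open>u'\<close> at
  \<open>Y\<close> with \<open>c = u(X)\<close>, testing with \<open>\<psi>(X) * moll ((X - Y) / \<epsilon>)\<close>; then add, integrate, and
  substitute \<open>Y = X - \<epsilon> w\<close>. As \<open>\<epsilon> \<rightarrow> 0\<close> along a suitable sequence, \<open>u'(X - \<epsilon> w) \<rightarrow> u'(X)\<close> almost everywhere,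
  and the uniform differentiability of \<open>f\<close> in \<open>x\<close> turns the terms carrying \<open>1 / \<epsilon>\<close> into
  \<open>\<nabla>moll(w) \<bullet> A w + moll(w) * tr A\<close> with a matrix \<open>A\<close> that depends on \<open>X\<close> only. This is the divergence of
  \<open>moll(w) A w\<close>, so its integral over \<open>w\<close> vanishes, and what remains is the claim.

  Lipschitz test functions require Rademacher's theorem. It is derived from the one-dimensional case (which
  also justifies the integration by parts in the entropy flux) along lines and from the continuity of
  translations in the mean.
\<close>

text \<open>The obstacle is the source term. Its coefficient \<open>div_f\<close> is continuous in
  the state but only bounded and measurable in space, so after doubling the value
  \<open>div_f (fst Y) (u X)\<close> need not converge pointwise as \<open>Y\<close> approaches
  \<open>X\<close>; it is split off as \<open>doubled_error\<close> and treated in the mean. The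
  flux terms, in contrast, carry 1 / \<epsilon> and must be expanded around \<open>X\<close> at a
  state that itself moves with \<epsilon>; this is why differentiability in space has to be uniform
  over bounded states. Placing \<open>\<psi>\<close> at \<open>X\<close> alone, and not at a
  midpoint, keeps its gradient out of the inequality in \<open>Y\<close>, so that this gradient is
  never translated. The sign jumps where the two solutions agree, but there every factor multiplying
  it vanishes in the limit. Throughout, the solutions are replaced by Borel representatives bounded
  everywhere, and integrals are taken over \<open>lborel\<close> on space-time; the iterated
  Lebesgue integrals of the definitions are met only on entry and exit.\<close>

section \<open>Null sets, completion and translations of Lebesgue measure\<close>

text \<open>A preimage under \<open>f\<close> is a Borel set outside the null set \<open>N\<close>
  plus a subset of \<open>N\<close>, and completeness makes the latter measurable. This brings
  classical derivatives, which are arbitrary on a null set, back to Borel functions.\<close>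

lemma AE_lborel_eq_imp_lebesgue:
  fixes f g :: "'b::euclidean_space \<Rightarrow> 'c::{banach, second_countable_topology}"
  assumes g [measurable]: "g \<in> borel_measurable borel" and ae: "AE x in lborel. f x = g x"
  shows "f \<in> borel_measurable lebesgue" and "integral\<^sup>L lebesgue f = integral\<^sup>L lborel g"
proof -
  from ae obtain N where N: "N \<in> null_sets lborel" "\<And>x. x \<notin> N \<Longrightarrow> f x = g x"
    by (auto elim: AE_E3)
  show f: "f \<in> borel_measurable lebesgue"
  proof (rule measurableI)
    fix A :: "'c set" assume A: "A \<in> sets borel"
    have eq: "f -` A \<inter> space lebesgue = (g -` A - N) \<union> (N \<inter> f -` A)"
      using N(2) by auto
    have "g -` A - N \<in> sets lborel"
      using A N(1) measurable_sets[OF g A] by auto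
    then have "g -` A - N \<in> sets lebesgue" by blast
    moreover have "N \<inter> f -` A \<in> sets lebesgue"
      using null_sets_completion_subset[of "N \<inter> f -` A" N lborel] N(1)
      by (auto intro: null_sets_completionI)
    ultimately show "f -` A \<inter> space lebesgue \<in> sets lebesgue"
      unfolding eq by blast
  qed simp
  have "integral\<^sup>L lebesgue f = integral\<^sup>L lebesgue g"
    using ae f by (intro integral_cong_AE) (auto simp: AE_completion_iff measurable_completion)
  also have "\<dots> = integral\<^sup>L lborel g"
    by (rule integral_completion) auto
  finally show "integral\<^sup>L lebesgue f = integral\<^sup>L lborel g" .
qed

lemma negligible_imp_AE_lborel:
  assumes "negligible N" shows "AE x in lborel. x \<notin> N"
  using assms unfolding negligible_iff_null_sets by (metis AE_completion_iff AE_not_in)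

text \<open>Derivatives enter as limits of difference quotients. Replacing both by 0 on
  \<open>N\<close> turns convergence off \<open>N\<close> into convergence everywhere, so the limit
  is Borel and not merely Lebesgue measurable.\<close>

lemma borel_measurable_limit_off_null:
  fixes q :: "nat \<Rightarrow> 'b::euclidean_space \<Rightarrow> 'c::euclidean_space"
  assumes N: "N \<in> null_sets lborel" and [measurable]: "\<And>n. q n \<in> borel_measurable borel"
    and lim: "\<And>x. x \<notin> N \<Longrightarrow> (\<lambda>n. q n x) \<longlonglongrightarrow> a x"
  shows "(\<lambda>x. if x \<in> N then 0 else a x) \<in> borel_measurable borel"
proof (rule borel_measurable_LIMSEQ_metric)
  have [measurable]: "N \<in> sets borel" using N by auto
  show "(\<lambda>x. if x \<in> N then 0 else q i x) \<in> borel_measurable borel" for i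
    by measurable
  show "(\<lambda>i. if x \<in> N then 0 else q i x) \<longlonglongrightarrow> (if x \<in> N then 0 else a x)" for x
    using lim by auto
qed

lemma lborel_translation:
  fixes h :: "'b::euclidean_space \<Rightarrow> 'c::{banach, second_countable_topology}"
  shows integral_lborel_translation: "(\<integral>x. h (x + c) \<partial>lborel) = (\<integral>x. h x \<partial>lborel)"
    and integrable_lborel_translation: "integrable lborel h \<Longrightarrow> integrable lborel (\<lambda>x. h (x + c))"
proof -
  have *: "integrable lborel (\<lambda>x. h (x + c)) \<longleftrightarrow> integrable lborel h"
    if "h \<in> borel_measurable borel" for h :: "'b \<Rightarrow> 'c" and c
    using that integrable_distr_eq[of "(+) c" lborel borel h]
    by (simp add: lborel_distr_plus add.commute)
  show int: "integrable lborel h \<Longrightarrow> integrable lborel (\<lambda>x. h (x + c))"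
    using *[of h c] borel_measurable_integrable[of lborel h] by auto
  show "(\<integral>x. h (x + c) \<partial>lborel) = (\<integral>x. h x \<partial>lborel)"
  proof (cases "integrable lborel h")
    case True
    then have "h \<in> borel_measurable borel" by auto
    then show ?thesis
      using integral_distr[of "(+) c" lborel borel h] by (simp add: lborel_distr_plus add.commute)
  next
    \<comment> \<open>The integral of a non-integrable function is 0 by convention, and translating
      back by \<open>- c\<close> shows that integrability fails on both sides.\<close>
    case False
    have "\<not> integrable lborel (\<lambda>x. h (x + c))"
    proof
      assume a: "integrable lborel (\<lambda>x. h (x + c))"
      then have "(\<lambda>x. h (x + c)) \<in> borel_measurable borel" by auto
      from *[OF this, of "- c"] a False show False by simp
    qed
    with False show ?thesis by (simp add: not_integrable_integral_eq)
  qed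
qed

lemma AE_lborel_translation:
  assumes "Measurable.pred borel P" and "AE x in lborel. P (x + c :: 'b::euclidean_space)"
  shows "AE x in lborel. P x"
proof -
  have [measurable]: "Measurable.pred borel P" by fact
  have "AE x in distr lborel borel ((+) c). P x"
    using assms(2) by (subst AE_distr_iff) (auto simp: add.commute)
  then show ?thesis unfolding lborel_distr_plus .
qed

subsection \<open>Continuity of translations in the mean\<close>

text \<open>The two-sided difference need not have a majorant independent of the shift, but the
  positive part of its negative is at most the indicator of \<open>U\<close>, and openness makes it
  vanish in the limit. Translation invariance gives both one-sided parts the same integral, hence
  the factor 2.\<close>

lemma L1_translation_indicator_open:
  fixes U :: "'b::euclidean_space set" and a :: "nat \<Rightarrow> 'b"
  assumes U: "open U" "emeasure lborel U < \<infinity>" and a: "a \<longlonglongrightarrow> 0"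
  shows "(\<lambda>n. \<integral>x. \<bar>indicator U (x + a n) - indicator U x :: real\<bar> \<partial>lborel) \<longlonglongrightarrow> 0"
proof -
  let ?i = "indicator U :: 'b \<Rightarrow> real"
  have [measurable]: "U \<in> sets borel" using U by auto
  have int: "integrable lborel ?i" using U by (intro integrable_real_indicator) auto
  note intT = integrable_lborel_translation[OF int]
  have "(\<lambda>n. \<integral>x. max 0 (?i x - ?i (x + a n)) \<partial>lborel) \<longlonglongrightarrow> integral\<^sup>L lborel (\<lambda>_::'b. 0::real)"
  proof (rule integral_dominated_convergence[where w = "?i"])
    show "AE x in lborel. (\<lambda>n. max 0 (?i x - ?i (x + a n))) \<longlonglongrightarrow> 0"
    proof (rule AE_I2)
      fix x :: 'b
      show "(\<lambda>n. max 0 (?i x - ?i (x + a n))) \<longlonglongrightarrow> 0"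
      proof (cases "x \<in> U")
        case True
        have "(\<lambda>n. x + a n) \<longlonglongrightarrow> x" using tendsto_add[OF tendsto_const a, of x] by simp
        then have "eventually (\<lambda>n. x + a n \<in> U) sequentially"
          using True U(1) by (auto simp: tendsto_def)
        then show ?thesis
          by (intro tendsto_eventually) (auto elim: eventually_mono)
      next
        case False
        then show ?thesis by (intro tendsto_eventually) (auto simp: max_def indicator_def)
      qed
    qed
    show "AE x in lborel. norm (max 0 (?i x - ?i (x + a n))) \<le> ?i x" for n
      by (rule AE_I2) (auto simp: indicator_def)
  qed (use int in auto)
  moreover have "(\<integral>x. \<bar>?i (x + a n) - ?i x\<bar> \<partial>lborel) = 2 * (\<integral>x. max 0 (?i x - ?i (x + a n)) \<partial>lborel)" for n
  proof -
    have i2: "integrable lborel (\<lambda>x. max 0 (?i x - ?i (x + a n)))"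
      by (intro integrable_max Bochner_Integration.integrable_diff intT int) auto
    have "(\<integral>x. \<bar>?i (x + a n) - ?i x\<bar> \<partial>lborel)
        = (\<integral>x. 2 * max 0 (?i x - ?i (x + a n)) + (?i (x + a n) - ?i x) \<partial>lborel)"
      by (rule Bochner_Integration.integral_cong) (auto simp: max_def)
    also have "\<dots> = (\<integral>x. 2 * max 0 (?i x - ?i (x + a n)) \<partial>lborel) + ((\<integral>x. ?i (x + a n) \<partial>lborel) - (\<integral>x. ?i x \<partial>lborel))"
      using i2 int intT by (simp add: Bochner_Integration.integral_add Bochner_Integration.integral_diff)
    finally show ?thesis using integral_lborel_translation[of ?i "a n"] by simp
  qed
  ultimately show ?thesis using tendsto_mult[OF tendsto_const, of _ 0 sequentially 2] by simp
qed

text \<open>A density argument: outer regularity reduces indicators of Borel sets to those of open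
  sets, and the majorant \<open>3 * norm (f x)\<close> transfers the claim from the simple functions
  \<open>s i\<close> to their limit.\<close>

lemma L1_translation:
  fixes h :: "'b::euclidean_space \<Rightarrow> 'c::euclidean_space" and a :: "nat \<Rightarrow> 'b"
  assumes h: "integrable lborel h" and a: "a \<longlonglongrightarrow> 0"
  shows "(\<lambda>n. \<integral>x. norm (h (x + a n) - h x) \<partial>lborel) \<longlonglongrightarrow> 0"
  using h
proof (induction rule: integrable_induct)
  case (base A c)
  have A[measurable]: "A \<in> sets borel" "emeasure lborel A < \<infinity>" using base by auto
  let ?i = "\<lambda>S. indicator S :: 'b \<Rightarrow> real"
  have key: "(\<lambda>n. \<integral>x. \<bar>?i A (x + a n) - ?i A x\<bar> \<partial>lborel) \<longlonglongrightarrow> 0"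
  proof (rule LIMSEQ_I)
    fix e :: real assume "e > 0"
    \<comment> \<open>The excess \<open>U - A\<close> is counted twice, once translated; e / 4
      leaves e / 2 for the open set.\<close>
    then have "e/4 > 0" by simp
    from outer_regular_lborel[OF A(1) this] obtain U
      where U: "open U" "A \<subseteq> U" "emeasure lborel (U - A) < ennreal (e/4)" by blast
    have [measurable]: "U \<in> sets borel" using U by auto
    have UA: "emeasure lborel (U - A) < \<infinity>" using U(3) by (metis ennreal_less_top infinity_ennreal_def order_less_trans)
    have "emeasure lborel U \<le> emeasure lborel A + emeasure lborel (U - A)"
      using emeasure_subadditive[of A lborel "U - A"] U(2) by (simp add: Un_absorb1)
    also have "\<dots> < \<infinity>" using A(2) UA by simp
    finally have Uf: "emeasure lborel U < \<infinity>" .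
    have iU: "integrable lborel (?i U)" and iA: "integrable lborel (?i A)" and iUA: "integrable lborel (?i (U - A))"
      using Uf A UA by (auto intro!: integrable_real_indicator)
    have mUA: "(\<integral>x. ?i (U - A) x \<partial>lborel) < e/4"
    proof -
      have "ennreal (measure lborel (U - A)) < ennreal (e/4)"
        using U(3) UA by (simp add: emeasure_eq_ennreal_measure less_top)
      then show ?thesis using \<open>e > 0\<close> by (simp add: ennreal_less_iff)
    qed
    from LIMSEQ_D[OF L1_translation_indicator_open[OF U(1) Uf a], of "e/2"] \<open>e > 0\<close>
    obtain no where no: "\<And>n. n \<ge> no \<Longrightarrow> (\<integral>x. \<bar>?i U (x + a n) - ?i U x\<bar> \<partial>lborel) < e/2" by auto
    have "norm ((\<integral>x. \<bar>?i A (x + a n) - ?i A x\<bar> \<partial>lborel) - 0) < e" if "n \<ge> no" for n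
    proof -
      have "(\<integral>x. \<bar>?i A (x + a n) - ?i A x\<bar> \<partial>lborel)
         \<le> (\<integral>x. \<bar>?i U (x + a n) - ?i U x\<bar> + (?i (U - A) (x + a n) + ?i (U - A) x) \<partial>lborel)"
        using U(2)
        by (intro integral_mono integrable_abs Bochner_Integration.integrable_add
            Bochner_Integration.integrable_diff integrable_lborel_translation iU iA iUA)
           (auto simp: indicator_def)
      also have "\<dots> = (\<integral>x. \<bar>?i U (x + a n) - ?i U x\<bar> \<partial>lborel)
           + ((\<integral>x. ?i (U - A) (x + a n) \<partial>lborel) + (\<integral>x. ?i (U - A) x \<partial>lborel))"
        by (subst Bochner_Integration.integral_add,
            (intro integrable_abs Bochner_Integration.integrable_add
            Bochner_Integration.integrable_diff integrable_lborel_translation iU iA iUA)+,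
            subst Bochner_Integration.integral_add,
            (intro integrable_lborel_translation iUA)+, rule refl)
      also have "\<dots> < e" using no[OF that] mUA integral_lborel_translation[of "?i (U - A)" "a n"] by simp
      finally show ?thesis by simp
    qed
    then show "\<exists>no. \<forall>n\<ge>no. norm ((\<integral>x. \<bar>?i A (x + a n) - ?i A x\<bar> \<partial>lborel) - 0) < e" by blast
  qed
  have "norm (?i A (x + a n) *\<^sub>R c - ?i A x *\<^sub>R c) = \<bar>?i A (x + a n) - ?i A x\<bar> * norm c" for x n
    by (simp flip: scaleR_left_diff_distrib)
  then show ?case using tendsto_mult_left_zero[OF key, of "norm c"] by simp
next
  case (add f g)
  have iT: "integrable lborel (\<lambda>x. norm (f (x + b) - f x))" "integrable lborel (\<lambda>x. norm (g (x + b) - g x))"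
    "integrable lborel (\<lambda>x. norm (f (x + b) + g (x + b) - (f x + g x)))" for b
    by (intro integrable_norm Bochner_Integration.integrable_diff Bochner_Integration.integrable_add
        integrable_lborel_translation add)+
  show ?case
  proof (rule tendsto_sandwich[OF _ _ tendsto_const])
    show "(\<lambda>n. (\<integral>x. norm (f (x + a n) - f x) \<partial>lborel) + (\<integral>x. norm (g (x + a n) - g x) \<partial>lborel)) \<longlonglongrightarrow> 0"
      using tendsto_add[OF add(3,4)] by simp
    show "\<forall>\<^sub>F n in sequentially. (\<integral>x. norm (f (x + a n) + g (x + a n) - (f x + g x)) \<partial>lborel)
      \<le> (\<integral>x. norm (f (x + a n) - f x) \<partial>lborel) + (\<integral>x. norm (g (x + a n) - g x) \<partial>lborel)"
      by (rule always_eventually, rule allI, subst Bochner_Integration.integral_add[symmetric], (rule iT)+,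
          intro integral_mono Bochner_Integration.integrable_add iT) (metis norm_diff_triangle_ineq)
  qed auto
next
  case (lim f s)
  have conv: "(\<lambda>i. \<integral>x. norm (s i x - f x) \<partial>lborel) \<longlonglongrightarrow> integral\<^sup>L lborel (\<lambda>_::'b. 0::real)"
  proof (rule integral_dominated_convergence[where w = "\<lambda>x. 3 * norm (f x)"])
    show "AE x in lborel. norm (norm (s i x - f x)) \<le> 3 * norm (f x)" for i
    proof (rule AE_I2)
      fix x
      have "norm (s i x - f x) \<le> norm (s i x) + norm (f x)" by (rule norm_triangle_ineq4)
      then show "norm (norm (s i x - f x)) \<le> 3 * norm (f x)" using lim(3)[of x i] by simp
    qed
    show "AE x in lborel. (\<lambda>i. norm (s i x - f x)) \<longlonglongrightarrow> 0"
      using lim(2) by (auto intro!: AE_I2 tendsto_norm_zero simp: LIM_zero)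
  qed (use lim in auto)
  show ?case
  proof (rule LIMSEQ_I)
    fix e :: real assume "e > 0"
    with LIMSEQ_D[OF conv, of "e/4"] obtain i where i: "(\<integral>x. norm (s i x - f x) \<partial>lborel) < e/4" by force
    from LIMSEQ_D[OF lim(5)[of i], of "e/4"] \<open>e > 0\<close>
    obtain no where no: "\<And>n. n \<ge> no \<Longrightarrow> (\<integral>x. norm (s i (x + a n) - s i x) \<partial>lborel) < e/4" by auto
    have isf: "integrable lborel (\<lambda>x. norm (s i x - f x))"
      using lim by auto
    have "norm ((\<integral>x. norm (f (x + a n) - f x) \<partial>lborel) - 0) < e" if "n \<ge> no" for n
    proof -
      have "(\<integral>x. norm (f (x + a n) - f x) \<partial>lborel)
         \<le> (\<integral>x. norm (s i (x + a n) - s i x) + (norm (s i (x + a n) - f (x + a n)) + norm (s i x - f x)) \<partial>lborel)"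
      proof (intro integral_mono Bochner_Integration.integrable_add integrable_norm
            Bochner_Integration.integrable_diff integrable_lborel_translation lim)
        fix x
        have "f (x + a n) - f x = (s i (x + a n) - s i x) - (s i (x + a n) - f (x + a n)) + (s i x - f x)"
          by simp
        also have "norm \<dots> \<le> norm (s i (x + a n) - s i x) + norm (s i (x + a n) - f (x + a n)) + norm (s i x - f x)"
          by (meson norm_triangle_le norm_triangle_le_diff order_refl add_mono)
        finally show "norm (f (x + a n) - f x) \<le> norm (s i (x + a n) - s i x) + (norm (s i (x + a n) - f (x + a n)) + norm (s i x - f x))"
          by (simp add: add.assoc)
      qed
      also have "\<dots> = (\<integral>x. norm (s i (x + a n) - s i x) \<partial>lborel)
          + ((\<integral>x. norm (s i (x + a n) - f (x + a n)) \<partial>lborel) + (\<integral>x. norm (s i x - f x) \<partial>lborel))"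
      proof -
        have "integrable lborel (\<lambda>x. norm (s i (x + a n) - s i x))"
          by (intro integrable_norm Bochner_Integration.integrable_diff integrable_lborel_translation lim)
        moreover have "integrable lborel (\<lambda>x. norm (s i (x + a n) - f (x + a n)))"
          by (intro integrable_norm Bochner_Integration.integrable_diff integrable_lborel_translation lim)
        ultimately show ?thesis using isf by simp
      qed
      also have "\<dots> < e"
        using no[OF that] i integral_lborel_translation[of "\<lambda>x. norm (s i x - f x)" "a n"] \<open>e > 0\<close> by simp
      finally show ?thesis by simp
    qed
    then show "\<exists>no. \<forall>n\<ge>no. norm ((\<integral>x. norm (f (x + a n) - f x) \<partial>lborel) - 0) < e" by blast
  qed
qed

subsection \<open>Rademacher's theorem\<close>

text \<open>The Stieltjes measures of \<open>F\<close> and \<open>x - F x\<close> add up to Lebesgue measure, so \<open>F\<close> has a density.\<close>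

lemma emeasure_interval_measure_le_lborel:
  fixes F :: "real \<Rightarrow> real"
  assumes mono: "\<And>x y. x \<le> y \<Longrightarrow> F x \<le> F y" "\<And>x y. x \<le> y \<Longrightarrow> x - F x \<le> y - F y"
    and cont: "continuous_on UNIV F" and A: "A \<in> sets borel"
  shows "emeasure (interval_measure F) A \<le> emeasure lborel A"
proof -
  let ?G = "\<lambda>x. x - F x"
  let ?m1 = "interval_measure F" and ?m2 = "interval_measure ?G"
  have contG: "continuous_on UNIV ?G" by (intro continuous_intros cont)
  define m where "m = measure_of UNIV (sets (borel :: real measure)) (\<lambda>A. emeasure ?m1 A + emeasure ?m2 A)"
  have sets_m: "sets m = sets borel"
    unfolding m_def using sets.sigma_sets_eq[of "borel :: real measure"] by simp
  have em: "emeasure m A = emeasure ?m1 A + emeasure ?m2 A" if "A \<in> sets borel" for A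
    unfolding m_def
  proof (rule emeasure_measure_of_sigma)
    show "sigma_algebra UNIV (sets (borel :: real measure))"
      using sets.sigma_algebra_axioms[of "borel :: real measure"] by simp
    show "positive (sets borel) (\<lambda>A. emeasure ?m1 A + emeasure ?m2 A)"
      by (simp add: positive_def)
    show "countably_additive (sets borel) (\<lambda>A. emeasure ?m1 A + emeasure ?m2 A)"
    proof (rule countably_additiveI)
      fix A :: "nat \<Rightarrow> real set" assume "range A \<subseteq> sets borel" "disjoint_family A"
      then show "(\<Sum>i. emeasure ?m1 (A i) + emeasure ?m2 (A i)) = emeasure ?m1 (\<Union>i. A i) + emeasure ?m2 (\<Union>i. A i)"
        by (subst suminf_add[symmetric]) (simp_all add: suminf_emeasure)
    qed
  qed fact
  have Ioo: "emeasure (interval_measure H) {l<..<u} = ennreal (H u - H l)"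
    if "l \<le> u" "\<And>x y. x \<le> y \<Longrightarrow> H x \<le> H y" "continuous_on UNIV H" for H l u
  proof (cases "l < u")
    case True
    have "{l<..<u} = {l..u} - ({l..l} \<union> {u..u})" using True by auto
    moreover have "emeasure (interval_measure H) ({l..l} \<union> {u..u}) = 0"
    proof -
      have "emeasure (interval_measure H) ({l..l} \<union> {u..u}) \<le> emeasure (interval_measure H) {l..l} + emeasure (interval_measure H) {u..u}"
        by (intro emeasure_subadditive) auto
      also have "\<dots> = 0"
        using emeasure_interval_measure_Icc[of l l H] emeasure_interval_measure_Icc[of u u H] that by auto
      finally show ?thesis by simp
    qed
    ultimately have "emeasure (interval_measure H) {l<..<u} = emeasure (interval_measure H) {l..u}"
      by (simp add: emeasure_Diff_null_set null_setsI)
    then show ?thesis using emeasure_interval_measure_Icc[of l u H] that by auto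
  qed (use that in auto)
  \<comment> \<open>Lebesgue measure is determined by the volume of boxes. Here the increments of
    \<open>F\<close> and of \<open>x - F x\<close> add up to \<open>u - l\<close>, and continuity of
    both rules out mass at the endpoints.\<close>
  have "lborel = m"
  proof (rule lborel_eqI)
    fix l u :: real assume "\<And>b. b \<in> Basis \<Longrightarrow> l \<bullet> b \<le> u \<bullet> b"
    then have lu: "l \<le> u" by simp
    have "emeasure m (box l u) = ennreal (F u - F l) + ennreal (?G u - ?G l)"
      using em[of "{l<..<u}"] Ioo[OF lu mono(1) cont] Ioo[OF lu mono(2) contG] by (simp add: box_real)
    also have "\<dots> = ennreal (u - l)"
      using mono(1)[OF lu] mono(2)[OF lu] by (subst ennreal_plus[symmetric]) auto
    finally show "emeasure m (box l u) = ennreal (\<Prod>b\<in>Basis. (u - l) \<bullet> b)" by simp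
  qed (rule sets_m)
  then show ?thesis using em[OF A] by (metis add_increasing2 order_refl zero_le)
qed

text \<open>Domination by Lebesgue measure gives absolute continuity, hence a Radon-Nikodym density.
  Its integrals over bounded intervals are finite, so it is finite almost everywhere and
  \<open>enn2real\<close> loses nothing.\<close>

lemma mono_lipschitz_density:
  fixes F :: "real \<Rightarrow> real"
  assumes mono: "\<And>x y. x \<le> y \<Longrightarrow> F x \<le> F y" "\<And>x y. x \<le> y \<Longrightarrow> x - F x \<le> y - F y"
    and cont: "continuous_on UNIV F"
  shows "\<exists>h. \<forall>a b. a \<le> b \<longrightarrow> (h has_integral (F b - F a)) {a..b}"
proof -
  let ?m = "interval_measure F"
  have Ioc: "emeasure ?m {a<..b} = ennreal (F b - F a)" if "a \<le> b" for a b
    using that mono(1) cont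
    by (intro emeasure_interval_measure_Ioc) (auto simp: continuous_on_eq_continuous_within intro: continuous_within_subset)
  have "absolutely_continuous lborel ?m"
    unfolding absolutely_continuous_def
  proof
    fix A :: "real set" assume "A \<in> null_sets lborel"
    then show "A \<in> null_sets ?m"
      using emeasure_interval_measure_le_lborel[OF mono cont, of A] by (auto simp: null_sets_def)
  qed
  from sigma_finite_measure.Radon_Nikodym[OF sigma_finite_lborel this] obtain h
    where h [measurable]: "h \<in> borel_measurable borel" and hd: "density lborel h = ?m" by auto
  have hi: "(\<integral>\<^sup>+x. h x * indicator {a<..b} x \<partial>lborel) = ennreal (F b - F a)" if "a \<le> b" for a b
    using Ioc[OF that] by (simp flip: hd add: emeasure_density)
  have "AE x in lborel. \<forall>n::nat. h x * indicator {- real n<..real n} x \<noteq> \<infinity>"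
  proof (subst AE_all_countable, rule allI)
    fix n :: nat
    show "AE x in lborel. h x * indicator {- real n<..real n} x \<noteq> \<infinity>"
      using hi[of "- real n" "real n"] by (intro nn_integral_noteq_infinite) auto
  qed
  then have fin: "AE x in lborel. h x \<noteq> \<infinity>"
  proof eventually_elim
    case (elim x)
    obtain n :: nat where "\<bar>x\<bar> < real n" using reals_Archimedean2 by blast
    then show ?case using elim[rule_format, of n] by (auto simp: indicator_def abs_less_iff)
  qed
  have "((\<lambda>x. enn2real (h x)) has_integral (F b - F a)) {a..b}" if "a \<le> b" for a b
  proof -
    have "((\<lambda>x. enn2real (h x) * indicator {a<..b} x) has_integral (F b - F a)) UNIV"
    proof (rule nn_integral_has_integral)
      have "(\<integral>\<^sup>+ x. ennreal (enn2real (h x) * indicator {a<..b} x) \<partial>lborel) = (\<integral>\<^sup>+x. h x * indicator {a<..b} x \<partial>lborel)"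
        using fin by (intro nn_integral_cong_AE) (auto elim!: eventually_mono simp: indicator_def less_top)
      then show "(\<integral>\<^sup>+ x. ennreal (enn2real (h x) * indicator {a<..b} x) \<partial>lborel) = ennreal (F b - F a)"
        using hi[OF that] by simp
    qed (use mono(1)[OF that] in auto)
    moreover have "(\<lambda>x. enn2real (h x) * indicator {a<..b} x) = (\<lambda>x. if x \<in> {a<..b} then enn2real (h x) else 0)"
      by (auto simp: indicator_def)
    ultimately have "((\<lambda>x. enn2real (h x)) has_integral (F b - F a)) {a<..b}"
      using has_integral_restrict_UNIV[of "{a<..b}" "\<lambda>x. enn2real (h x)"] by simp
    moreover have "negligible ({a..b} - {a<..b} \<union> ({a<..b} - {a..b}))"
      by (rule negligible_subset[of "{a}"]) auto
    ultimately show ?thesis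
      by (subst has_integral_spike_set_eq[of _ "{a<..b}"])
        (auto intro: negligible_subset[of "{a}"])
  qed
  then show ?thesis by blast
qed

text \<open>Lebesgue's differentiation theorem is applied to cubes with \<open>x\<close> as lower
  corner, so only right-hand quotients come out.\<close>

lemma integral_difference_quotients:
  fixes h F :: "real \<Rightarrow> real"
  assumes hF: "\<And>a b. a \<le> b \<Longrightarrow> (h has_integral (F b - F a)) {a..b}"
  shows "\<exists>N. negligible N \<and> (\<forall>x e. x \<notin> N \<and> e > 0 \<longrightarrow> (\<exists>d>0. \<forall>s. 0 < s \<and> s < d \<longrightarrow> \<bar>(F (x + s) - F x) / s - h x\<bar> < e))"
proof -
  have "h integrable_on cbox a b" for a b
    using hF[of a b] by (cases "a \<le> b") (auto simp: integrable_on_def)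
  from integrable_ccontinuous_explicit[of h, OF this] obtain N where N: "negligible N"
    "\<And>x e. \<lbrakk>x \<notin> N; 0 < e\<rbrakk> \<Longrightarrow> \<exists>d>0. \<forall>s. 0 < s \<and> s < d \<longrightarrow>
       norm (integral (cbox x (x + s *\<^sub>R One)) h /\<^sub>R s ^ DIM(real) - h x) < e" by blast
  have "integral (cbox x (x + s *\<^sub>R One)) h /\<^sub>R s ^ DIM(real) = (F (x + s) - F x) / s" if "s > 0" for x s
    using integral_unique[OF hF[of x "x + s"]] that by (simp add: field_simps)
  then show ?thesis using N by (intro exI[of _ N]) (fastforce simp: abs_minus_commute)
qed

lemma mono_lipschitz_AE_derivative:
  fixes F :: "real \<Rightarrow> real"
  assumes mono: "\<And>x y. x \<le> y \<Longrightarrow> F x \<le> F y" "\<And>x y. x \<le> y \<Longrightarrow> x - F x \<le> y - F y"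
    and cont: "continuous_on UNIV F"
  obtains h where "\<forall>a b. a \<le> b \<longrightarrow> (h has_integral (F b - F a)) {a..b}"
    "AE x in lborel. (F has_real_derivative h x) (at x)"
proof -
  obtain h where h: "\<And>a b. a \<le> b \<Longrightarrow> (h has_integral (F b - F a)) {a..b}"
    using mono_lipschitz_density[OF assms] by blast
  \<comment> \<open>Reflection exchanges left and right: \<open>- F (- x)\<close> has density
    \<open>h (- x)\<close>, and its right-hand quotients at \<open>- x\<close> are the left-hand
    quotients of \<open>F\<close> at \<open>x\<close>.\<close>
  have h': "((\<lambda>x. h (- x)) has_integral ((- F (- b)) - (- F (- a)))) {a..b}" if "a \<le> b" for a b
    using has_integral_reflect_real[where f = h and i = "F (- a) - F (- b)" and a = "- b" and b = "- a"] h[of "- b" "- a"] that by simp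
  from integral_difference_quotients[OF h] obtain N where N: "negligible N"
    "\<And>x e. x \<notin> N \<Longrightarrow> e > 0 \<Longrightarrow> \<exists>d>0. \<forall>s. 0 < s \<and> s < d \<longrightarrow> \<bar>(F (x + s) - F x) / s - h x\<bar> < e" by blast
  from integral_difference_quotients[of "\<lambda>x. h (- x)" "\<lambda>x. - F (- x)", OF h'] obtain N' where N': "negligible N'"
    "\<And>x e. x \<notin> N' \<Longrightarrow> e > 0 \<Longrightarrow> \<exists>d>0. \<forall>s. 0 < s \<and> s < d \<longrightarrow> \<bar>(- F (- (x + s)) - - F (- x)) / s - h (- x)\<bar> < e" by blast
  have "negligible (uminus ` N')"
    by (rule negligible_differentiable_image_negligible[OF _ N'(1)])
      (auto intro!: derivative_intros simp: differentiable_on_def)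
  then have "negligible (N \<union> uminus ` N')" using N(1) by (intro negligible_Un)
  from negligible_imp_AE_lborel[OF this] have "AE x in lborel. (F has_real_derivative h x) (at x)"
  proof eventually_elim
    case (elim x)
    then have x: "x \<notin> N" "- x \<notin> N'" by (auto simp: image_iff)
    have "(\<lambda>s. (F (x + s) - F x) / s) \<midarrow>0\<rightarrow> h x"
    proof (rule LIM_I)
      fix e :: real assume e: "e > 0"
      obtain d1 where d1: "d1 > 0" "\<And>s. 0 < s \<Longrightarrow> s < d1 \<Longrightarrow> \<bar>(F (x + s) - F x) / s - h x\<bar> < e"
        using N(2)[OF x(1) e] by blast
      obtain d2 where d2: "d2 > 0" "\<And>s. 0 < s \<Longrightarrow> s < d2 \<Longrightarrow> \<bar>(- F (- (- x + s)) - (- F (- (- x)))) / s - h (- (- x))\<bar> < e"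
        using N'(2)[OF x(2) e] by blast
      have "norm ((F (x + s) - F x) / s - h x) < e" if "s \<noteq> 0" "\<bar>s\<bar> < min d1 d2" for s
      proof (cases "s > 0")
        case True with d1(2)[of s] that show ?thesis by simp
      next
        case False
        then have "0 < - s" "- s < d2" using that by auto
        from d2(2)[OF this] have "\<bar>(F x - F (x + s)) / (- s) - h x\<bar> < e" by (simp add: add.commute)
        moreover have "(F x - F (x + s)) / (- s) = (F (x + s) - F x) / s"
          using that by (simp add: field_simps)
        ultimately show ?thesis by simp
      qed
      then show "\<exists>r>0. \<forall>s. s \<noteq> 0 \<and> norm (s - 0) < r \<longrightarrow> norm ((F (x + s) - F x) / s - h x) < e"
        using d1(1) d2(1) by (intro exI[of _ "min d1 d2"]) auto
    qed
    then show ?case by (simp add: DERIV_def)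
  qed
  with h show thesis by (intro that) auto
qed

lemma lipschitz_real_AE_derivative:
  fixes g :: "real \<Rightarrow> real"
  assumes "L-lipschitz_on UNIV g"
  obtains h where "\<forall>a b. a \<le> b \<longrightarrow> (h has_integral (g b - g a)) {a..b}"
    "AE x in lborel. (g has_real_derivative h x) (at x)"
proof -
  \<comment> \<open>Adding 1 keeps the divisor positive when \<open>L = 0\<close>.\<close>
  define M where "M = L + 1"
  have M: "M > 0" using lipschitz_on_nonneg[OF assms] by (simp add: M_def)
  have lip: "\<bar>g y - g x\<bar> \<le> M * (y - x)" if "x \<le> y" for x y
  proof -
    have "\<bar>g y - g x\<bar> \<le> L * (y - x)" using lipschitz_onD[OF assms, of y x] that by (simp add: dist_real_def)
    also have "\<dots> \<le> M * (y - x)" using that by (intro mult_right_mono) (auto simp: M_def)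
    finally show ?thesis .
  qed
  \<comment> \<open>Increments of \<open>g / M\<close> have modulus at most \<open>y - x\<close>;
    adding \<open>x\<close> and halving puts those of \<open>F\<close> between 0 and
    \<open>y - x\<close>, which is what the two monotonicity conditions ask.\<close>
  define F where "F x = (x + g x / M) / 2" for x
  have mono: "F x \<le> F y" "x - F x \<le> y - F y" if "x \<le> y" for x y
  proof -
    have "\<bar>(g y - g x) / M\<bar> \<le> y - x" using lip[OF that] M by (simp add: abs_divide pos_divide_le_eq mult.commute)
    then have "g x / M - g y / M \<le> y - x" "g y / M - g x / M \<le> y - x" by (auto simp: diff_divide_distrib)
    then have "(x + g x / M) / 2 \<le> (y + g y / M) / 2" "x - (x + g x / M) / 2 \<le> y - (y + g y / M) / 2"
      by (simp_all add: diff_le_eq add.commute add_divide_distrib)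
    then show "F x \<le> F y" "x - F x \<le> y - F y" by (simp_all add: F_def)
  qed
  have cont: "continuous_on UNIV F"
    unfolding F_def using lipschitz_on_continuous_on[OF assms] M by (intro continuous_intros) auto
  from mono_lipschitz_AE_derivative[OF mono cont] obtain h where h:
    "\<forall>a b. a \<le> b \<longrightarrow> (h has_integral (F b - F a)) {a..b}"
    "AE x in lborel. (F has_real_derivative h x) (at x)" by blast
  have g_eq: "g = (\<lambda>x. M * (2 * F x - x))" using M by (auto simp: F_def field_simps)
  show thesis
  proof (rule that[of "\<lambda>x. M * (2 * h x - 1)"])
    show "\<forall>a b. a \<le> b \<longrightarrow> ((\<lambda>x. M * (2 * h x - 1)) has_integral (g b - g a)) {a..b}"
    proof (intro allI impI)
      fix a b :: real assume ab: "a \<le> b"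
      have "((\<lambda>x. M * (2 * h x - 1)) has_integral M * (2 * (F b - F a) - (b - a))) {a..b}"
        using has_integral_const_real[of "1::real" a b] ab h(1)
        by (intro has_integral_mult_right has_integral_diff) simp_all
      then show "((\<lambda>x. M * (2 * h x - 1)) has_integral (g b - g a)) {a..b}"
        by (simp add: g_eq algebra_simps)
    qed
    show "AE x in lborel. (g has_real_derivative M * (2 * h x - 1)) (at x)"
      using h(2) unfolding g_eq by eventually_elim (auto intro!: derivative_eq_intros)
  qed
qed

lemma lipschitz_real_AE_differentiable:
  fixes g :: "real \<Rightarrow> real"
  assumes "L-lipschitz_on UNIV g"
  shows "AE x in lborel. g differentiable (at x)"
proof -
  obtain h where "AE x in lborel. (g has_real_derivative h x) (at x)"
    using lipschitz_real_AE_derivative[OF assms] by metis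
  then show ?thesis by eventually_elim (auto simp: real_differentiable_def)
qed

section \<open>Measurability of differentiability along lines\<close>

text \<open>The Cauchy criterion for a limit at 0, with all quantifiers over countable types, so
  that the set of points of differentiability is a countable combination of Borel sets.\<close>

definition rat_Cauchy_at_0 :: "(real \<Rightarrow> real) \<Rightarrow> bool" where
  "rat_Cauchy_at_0 Q \<longleftrightarrow> (\<forall>k::nat. \<exists>m::nat. \<forall>p q::rat. p \<noteq> 0 \<and> q \<noteq> 0 \<and>
     \<bar>real_of_rat p\<bar> < 1 / Suc m \<and> \<bar>real_of_rat q\<bar> < 1 / Suc m \<longrightarrow>
     \<bar>Q (of_rat p) - Q (of_rat q)\<bar> \<le> 1 / Suc k)"

lemma rat_Cauchy_at_0D:
  assumes "rat_Cauchy_at_0 Q" "e > 0"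
  obtains r where "r > 0" "\<And>p q. p \<noteq> 0 \<Longrightarrow> q \<noteq> 0 \<Longrightarrow> \<bar>real_of_rat p\<bar> < r \<Longrightarrow> \<bar>real_of_rat q\<bar> < r \<Longrightarrow>
    \<bar>Q (of_rat p) - Q (of_rat q)\<bar> \<le> e"
proof -
  from nat_approx_posE[OF assms(2)] obtain k :: nat where k: "1 / Suc k < e" .
  from assms(1) obtain m where m: "\<And>p q::rat. p \<noteq> 0 \<and> q \<noteq> 0 \<and>
     \<bar>real_of_rat p\<bar> < 1 / Suc m \<and> \<bar>real_of_rat q\<bar> < 1 / Suc m \<Longrightarrow>
     \<bar>Q (of_rat p) - Q (of_rat q)\<bar> \<le> 1 / Suc k"
    unfolding rat_Cauchy_at_0_def by metis
  show ?thesis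
  proof (rule that)
    fix p q :: rat assume "p \<noteq> 0" "q \<noteq> 0" "\<bar>real_of_rat p\<bar> < 1 / Suc m" "\<bar>real_of_rat q\<bar> < 1 / Suc m"
    from m[OF conjI[OF this(1) conjI[OF this(2) conjI[OF this(3,4)]]]] k
    show "\<bar>Q (of_rat p) - Q (of_rat q)\<bar> \<le> e" by (rule order_trans[OF _ less_imp_le])
  qed simp
qed

lemma rat_Cauchy_at_0I:
  assumes "Q \<midarrow>0\<rightarrow> d"
  shows "rat_Cauchy_at_0 Q"
  unfolding rat_Cauchy_at_0_def
proof
  fix k :: nat
  define e where "e = 1 / Suc k"
  have "e / 2 > 0" by (simp add: e_def)
  from LIM_D[OF assms this] obtain r where r: "r > 0"
    "\<And>s. s \<noteq> 0 \<Longrightarrow> \<bar>s\<bar> < r \<Longrightarrow> \<bar>Q s - d\<bar> < e / 2" by auto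
  from nat_approx_posE[OF r(1)] obtain m :: nat where m: "1 / Suc m < r" .
  show "\<exists>m::nat. \<forall>p q::rat. p \<noteq> 0 \<and> q \<noteq> 0 \<and>
     \<bar>real_of_rat p\<bar> < 1 / Suc m \<and> \<bar>real_of_rat q\<bar> < 1 / Suc m \<longrightarrow>
     \<bar>Q (of_rat p) - Q (of_rat q)\<bar> \<le> 1 / Suc k"
  proof (rule exI[of _ m], intro allI impI, elim conjE)
    fix p q :: rat assume *: "p \<noteq> 0" "q \<noteq> 0" "\<bar>real_of_rat p\<bar> < 1 / Suc m" "\<bar>real_of_rat q\<bar> < 1 / Suc m"
    have "real_of_rat p \<noteq> 0" "real_of_rat q \<noteq> 0" using * by simp_all
    from r(2)[OF this(1) less_trans[OF *(3) m]] r(2)[OF this(2) less_trans[OF *(4) m]]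
    show "\<bar>Q (of_rat p) - Q (of_rat q)\<bar> \<le> 1 / Suc k" unfolding e_def[symmetric] by linarith
  qed
qed

text \<open>The sequence 1 / (n + 1) produces a candidate limit, the criterion extends the estimate
  to small nonzero rationals, and continuity away from 0 extends it to small nonzero reals.\<close>

lemma rat_Cauchy_at_0_imp_LIM:
  assumes R: "rat_Cauchy_at_0 Q" and cont: "\<And>s. s \<noteq> 0 \<Longrightarrow> isCont Q s"
  shows "\<exists>d. Q \<midarrow>0\<rightarrow> d"
proof -
  define rn :: "nat \<Rightarrow> rat" where "rn n = inverse (of_nat (Suc n))" for n
  have rn0: "rn n \<noteq> 0" for n unfolding rn_def by (simp del: of_nat_Suc)
  have "real_of_rat (rn n) = inverse (real (Suc n))" for n
    unfolding rn_def of_rat_inverse of_rat_of_nat_eq ..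
  then have rnlim: "(\<lambda>n. real_of_rat (rn n)) \<longlonglongrightarrow> 0"
    using LIMSEQ_inverse_real_of_nat by presburger
  have small: "\<forall>\<^sub>F n in sequentially. \<bar>real_of_rat (rn n)\<bar> < r" if "r > 0" for r
    using tendstoD[OF rnlim that] unfolding dist_real_def diff_0_right .
  have "Cauchy (\<lambda>n. Q (of_rat (rn n)))"
  proof (rule metric_CauchyI)
    fix e :: real assume "e > 0"
    then have "e / 2 > 0" by simp
    from rat_Cauchy_at_0D[OF R this] obtain r where r: "r > 0" "\<And>p q. p \<noteq> 0 \<Longrightarrow> q \<noteq> 0 \<Longrightarrow>
      \<bar>real_of_rat p\<bar> < r \<Longrightarrow> \<bar>real_of_rat q\<bar> < r \<Longrightarrow> \<bar>Q (of_rat p) - Q (of_rat q)\<bar> \<le> e / 2" by blast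
    from small[OF r(1)] obtain M where M: "\<And>n. n \<ge> M \<Longrightarrow> \<bar>real_of_rat (rn n)\<bar> < r"
      unfolding eventually_sequentially by blast
    have "dist (Q (of_rat (rn i))) (Q (of_rat (rn n))) < e" if "i \<ge> M" "n \<ge> M" for i n
      using r(2)[OF rn0 rn0 M[OF that(1)] M[OF that(2)]] \<open>e > 0\<close> unfolding dist_real_def by linarith
    then show "\<exists>M. \<forall>i\<ge>M. \<forall>n\<ge>M. dist (Q (of_rat (rn i))) (Q (of_rat (rn n))) < e" by blast
  qed
  then obtain d where d: "(\<lambda>n. Q (of_rat (rn n))) \<longlonglongrightarrow> d"
    using Cauchy_convergent convergent_def by blast
  have "Q \<midarrow>0\<rightarrow> d"
  proof (rule LIM_I)
    fix e :: real assume "e > 0"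
    then have e2: "e / 2 > 0" "e / 3 > 0" by simp_all
    from rat_Cauchy_at_0D[OF R e2(2)] obtain r where r: "r > 0" "\<And>p q. p \<noteq> 0 \<Longrightarrow> q \<noteq> 0 \<Longrightarrow>
      \<bar>real_of_rat p\<bar> < r \<Longrightarrow> \<bar>real_of_rat q\<bar> < r \<Longrightarrow> \<bar>Q (of_rat p) - Q (of_rat q)\<bar> \<le> e / 3" by blast
    have lim_rat: "\<bar>Q (of_rat p) - d\<bar> \<le> e / 3" if "p \<noteq> 0" "\<bar>real_of_rat p\<bar> < r" for p
    proof (rule tendsto_upperbound)
      show "(\<lambda>n. \<bar>Q (of_rat p) - Q (of_rat (rn n))\<bar>) \<longlonglongrightarrow> \<bar>Q (of_rat p) - d\<bar>"
        by (rule tendsto_rabs[OF tendsto_diff[OF tendsto_const d]])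
      show "\<forall>\<^sub>F n in sequentially. \<bar>Q (of_rat p) - Q (of_rat (rn n))\<bar> \<le> e / 3"
        using small[OF r(1)] by eventually_elim (rule r(2)[OF that(1) rn0 that(2)])
    qed simp
    have "norm (Q s - d) < e" if s: "s \<noteq> 0" "\<bar>s\<bar> < r" for s
    proof -
      have "Q \<midarrow>s\<rightarrow> Q s" using cont[OF s(1)] unfolding isCont_def .
      from LIM_D[OF this e2(1)] obtain t where t: "t > 0"
        "\<And>p. p \<noteq> s \<Longrightarrow> \<bar>p - s\<bar> < t \<Longrightarrow> \<bar>Q p - Q s\<bar> < e / 2" by auto
      \<comment> \<open>Keeps the rational \<open>p\<close> close to \<open>s\<close>, of modulus
        below \<open>r\<close>, and different from 0.\<close>
      define t' where "t' = min t (min \<bar>s\<bar> (r - \<bar>s\<bar>))"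
      have "s < s + t'" using t s by (simp add: t'_def)
      from of_rat_dense[OF this] obtain p where p: "s < real_of_rat p" "real_of_rat p < s + t'" by blast
      then have rp: "\<bar>real_of_rat p\<bar> < r" "real_of_rat p \<noteq> 0" "\<bar>real_of_rat p - s\<bar> < t" "real_of_rat p \<noteq> s"
        unfolding t'_def by linarith+
      have "p \<noteq> 0" using rp(2) by (metis of_rat_0)
      have "\<bar>Q (of_rat p) - Q s\<bar> < e / 2" by (rule t(2)[OF rp(4,3)])
      moreover have "\<bar>Q (of_rat p) - d\<bar> \<le> e / 3" by (rule lim_rat[OF \<open>p \<noteq> 0\<close> rp(1)])
      ultimately show ?thesis using \<open>e > 0\<close> unfolding real_norm_def by linarith
    qed
    then show "\<exists>r>0. \<forall>s. s \<noteq> 0 \<and> norm (s - 0) < r \<longrightarrow> norm (Q s - d) < e"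
      using r(1) by (intro exI[of _ r]) auto
  qed
  then show ?thesis ..
qed

lemma differentiable_at_0_iff_rat_Cauchy:
  fixes G :: "real \<Rightarrow> real"
  assumes cont: "continuous_on UNIV G"
  shows "G differentiable (at 0) \<longleftrightarrow> rat_Cauchy_at_0 (\<lambda>s. (G s - G 0) / s)"
proof -
  have "G differentiable (at 0) \<longleftrightarrow> (\<exists>d. (\<lambda>s. (G s - G 0) / s) \<midarrow>0\<rightarrow> d)"
    by (simp add: real_differentiable_def DERIV_def)
  moreover have "isCont (\<lambda>s. (G s - G 0) / s) s" if "s \<noteq> 0" for s
    using cont that by (intro continuous_intros) (auto simp: continuous_on_eq_continuous_at)
  ultimately show ?thesis
    using rat_Cauchy_at_0I rat_Cauchy_at_0_imp_LIM by blast
qed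

text \<open>Fubini's theorem in \<open>AE_along_lines\<close> asks for a measurable set of
  differentiability points.\<close>

lemma borel_differentiable_along:
  fixes F :: "'b::euclidean_space \<Rightarrow> real"
  assumes cont: "continuous_on UNIV F"
  shows "Measurable.pred borel (\<lambda>x. (\<lambda>s. F (x + s *\<^sub>R v)) differentiable (at 0))"
proof -
  have [measurable]: "F \<in> borel_measurable borel" using cont by (rule borel_measurable_continuous_onI)
  have "continuous_on UNIV (\<lambda>s. F (x + s *\<^sub>R v))" for x
    by (rule continuous_on_compose2[OF cont]) (auto intro!: continuous_intros)
  note eq = differentiable_at_0_iff_rat_Cauchy[OF this]
  show ?thesis unfolding eq rat_Cauchy_at_0_def by measurable
qed

text \<open>Fubini on pairs \<open>(x, s)\<close>: for almost every \<open>s\<close>, hence for at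
  least one, the property holds at \<open>x + s *\<^sub>R v\<close> for almost every
  \<open>x\<close>, and translation invariance removes the shift. This avoids coordinates adapted to
  \<open>v\<close>.\<close>

lemma AE_along_lines:
  fixes v :: "'b::euclidean_space"
  assumes P: "Measurable.pred borel P" and line: "\<And>x. AE s in lborel. P (x + s *\<^sub>R v)"
  shows "AE x in lborel. P x"
proof -
  have "Measurable.pred (lborel \<Otimes>\<^sub>M lborel) (\<lambda>z. P (fst z + snd z *\<^sub>R v))"
    by (rule measurable_compose[OF _ P]) measurable
  then have meas: "{x \<in> space (lborel \<Otimes>\<^sub>M lborel). P (fst x + snd x *\<^sub>R v)} \<in> sets (lborel \<Otimes>\<^sub>M lborel)"
    by (simp add: pred_def)
  have "AE x in lborel. AE s in lborel. P (x + s *\<^sub>R v)"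
    by (rule AE_I2) (rule line)
  then have "AE s in lborel. AE x in lborel. P (x + s *\<^sub>R v)"
    by (subst lborel_pair.AE_commute[symmetric, OF meas])
  moreover have "ae_filter (lborel :: real measure) \<noteq> bot"
    by (simp add: ae_filter_eq_bot_iff)
  ultimately obtain s where "AE x in lborel. P (x + s *\<^sub>R v)"
    using eventually_happens[of _ "ae_filter (lborel :: real measure)"] by metis
  then show ?thesis by (rule AE_lborel_translation[OF P])
qed

lemma lipschitz_AE_differentiable_along:
  fixes F :: "'b::euclidean_space \<Rightarrow> real"
  assumes "L-lipschitz_on UNIV F"
  shows "AE x in lborel. (\<lambda>s. F (x + s *\<^sub>R v)) differentiable (at 0)"
proof (rule AE_along_lines[where v = v])
  fix x
  have "(L * norm v)-lipschitz_on UNIV (\<lambda>s. F (x + s *\<^sub>R v))"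
  proof (rule lipschitz_onI)
    fix s t :: real
    have "dist (F (x + s *\<^sub>R v)) (F (x + t *\<^sub>R v)) \<le> L * dist (x + s *\<^sub>R v) (x + t *\<^sub>R v)"
      using lipschitz_onD[OF assms] by blast
    also have "dist (x + s *\<^sub>R v) (x + t *\<^sub>R v) = norm v * dist s t"
      by (simp add: dist_norm mult.commute flip: scaleR_left_diff_distrib)
    finally show "dist (F (x + s *\<^sub>R v)) (F (x + t *\<^sub>R v)) \<le> L * norm v * dist s t" by simp
  qed (use lipschitz_on_nonneg[OF assms] in simp)
  from lipschitz_real_AE_differentiable[OF this]
  show "AE s in lborel. (\<lambda>t. F (x + s *\<^sub>R v + t *\<^sub>R v)) differentiable (at 0)"
  proof eventually_elim
    case (elim s)
    then have "(\<lambda>t. F (x + t *\<^sub>R v)) differentiable (at (s + 0))" by simp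
    moreover have "(\<lambda>t. s + t) differentiable (at (0 :: real))" by simp
    ultimately have "((\<lambda>t. F (x + t *\<^sub>R v)) \<circ> (\<lambda>t. s + t)) differentiable (at 0)"
      using differentiable_chain_at by blast
    then show ?case by (simp add: o_def scaleR_left_distrib add.assoc)
  qed
qed (rule borel_differentiable_along[OF lipschitz_on_continuous_on[OF assms]])

lemma AE_lborelE:
  assumes "AE x in lborel. P x"
  obtains N where "N \<in> null_sets lborel" "\<forall>x. x \<notin> N \<longrightarrow> P x"
proof -
  from assms obtain N where "N \<in> null_sets lborel" "{x \<in> space lborel. \<not> P x} \<subseteq> N"
    unfolding eventually_ae_filter by blast
  then show thesis by (intro that[of N]) auto
qed

lemma integrable_lborel_bounded_support:
  fixes f :: "'b::euclidean_space \<Rightarrow> 'c::{banach, second_countable_topology}"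
  assumes "f \<in> borel_measurable borel" "\<And>x. norm (f x) \<le> C * indicator (cball 0 R) x"
  shows "integrable lborel f"
proof (rule Bochner_Integration.integrable_bound)
  show "integrable lborel (\<lambda>x::'b. C * indicator (cball 0 R) x :: real)"
    by (intro integrable_mult_right integrable_real_indicator) (use emeasure_bounded_finite[OF bounded_cball] in auto)
  show "AE x in lborel. norm (f x) \<le> norm (C * indicator (cball 0 R) x :: real)"
    using assms(2) by (intro AE_I2) (metis abs_ge_self order_trans real_norm_def)
qed (use assms in auto)

section \<open>Directional derivatives of Lipschitz functions and their linearity\<close>

definition dir_deriv :: "('b::euclidean_space \<Rightarrow> real) \<Rightarrow> 'b \<Rightarrow> 'b \<Rightarrow> real" where
  "dir_deriv F v x = deriv (\<lambda>s. F (x + s *\<^sub>R v)) 0"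

text \<open>A fixed sequence of steps of length at most 1 gives countably many Borel functions, fit
  for dominated convergence.\<close>

definition dir_quot :: "('b::euclidean_space \<Rightarrow> real) \<Rightarrow> 'b \<Rightarrow> nat \<Rightarrow> 'b \<Rightarrow> real" where
  "dir_quot F v n x = (F (x + inverse (real (Suc n)) *\<^sub>R v) - F x) / inverse (real (Suc n))"

lemma dir_quot_tendsto:
  assumes "(\<lambda>s. F (x + s *\<^sub>R v)) differentiable (at 0)"
  shows "(\<lambda>n. dir_quot F v n x) \<longlonglongrightarrow> dir_deriv F v x"
proof -
  have "((\<lambda>s. F (x + s *\<^sub>R v)) has_real_derivative dir_deriv F v x) (at 0)"
    using assms unfolding dir_deriv_def by (simp add: DERIV_deriv_iff_real_differentiable)
  then have "(\<lambda>s. (F (x + s *\<^sub>R v) - F x) / s) \<midarrow>0\<rightarrow> dir_deriv F v x"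
    by (simp add: DERIV_def)
  from this[unfolded tendsto_at_iff_sequentially, rule_format, of "\<lambda>n. inverse (real (Suc n))"]
  show ?thesis using LIMSEQ_inverse_real_of_nat by (simp add: o_def dir_quot_def del: of_nat_Suc)
qed

lemma dir_quot_bound:
  assumes "L-lipschitz_on UNIV F"
  shows "\<bar>dir_quot F v n x\<bar> \<le> L * norm v"
proof -
  have "\<bar>F (x + inverse (real (Suc n)) *\<^sub>R v) - F x\<bar> \<le> L * norm (inverse (real (Suc n)) *\<^sub>R v)"
    using lipschitz_onD[OF assms, of "x + inverse (real (Suc n)) *\<^sub>R v" x] by (simp add: dist_norm del: of_nat_Suc)
  also have "\<dots> = L * norm v * inverse (real (Suc n))" by (simp del: of_nat_Suc)
  finally show ?thesis unfolding dir_quot_def abs_divide by (simp add: pos_divide_le_eq del: of_nat_Suc)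
qed

lemma dir_quot_add:
  "dir_quot F (v + w) n x = dir_quot F v n (x + inverse (real (Suc n)) *\<^sub>R w) + dir_quot F w n x"
  unfolding dir_quot_def by (simp add: scaleR_right_distrib add.commute add.left_commute flip: add_divide_distrib del: of_nat_Suc)

text \<open>The quotient in direction \<open>v + w\<close> is a quotient in direction \<open>w\<close> plus a translated quotient in direction \<open>v\<close>;
  the translation disappears in the limit because translations are continuous in the mean.\<close>

lemma dir_deriv_add:
  fixes F :: "'b::euclidean_space \<Rightarrow> real"
  assumes lip: "L-lipschitz_on UNIV F"
  shows "AE x in lborel. dir_deriv F (v + w) x = dir_deriv F v x + dir_deriv F w x"
proof -
  have L0: "L \<ge> 0" using lipschitz_on_nonneg[OF lip] .
  have contF: "continuous_on UNIV F" by (rule lipschitz_on_continuous_on[OF lip])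
  have [measurable]: "F \<in> borel_measurable borel" using contF by (rule borel_measurable_continuous_onI)
  have qm [measurable]: "dir_quot F v n \<in> borel_measurable borel" for v n
    unfolding dir_quot_def[abs_def] by measurable
  let ?d = "\<lambda>v x. (\<lambda>s. F (x + s *\<^sub>R v)) differentiable (at 0)"
  have "AE x in lborel. ?d v x \<and> ?d w x \<and> ?d (v + w) x"
    using lipschitz_AE_differentiable_along[OF lip] by (auto intro: eventually_conj)
  from AE_lborelE[OF this] obtain N where N: "N \<in> null_sets lborel" "\<forall>x. x \<notin> N \<longrightarrow> ?d v x \<and> ?d w x \<and> ?d (v + w) x" .
  define a where "a u x = (if x \<in> N then 0 else dir_deriv F u x)" for u x
  have qa: "(\<lambda>n. dir_quot F u n x) \<longlonglongrightarrow> a u x" if "u \<in> {v, w, v + w}" "x \<notin> N" for u x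
    using that N(2)[THEN spec, of x] by (auto simp: a_def intro!: dir_quot_tendsto)
  have am: "a u \<in> borel_measurable borel" if "u \<in> {v, w, v + w}" for u
    unfolding a_def[abs_def] using qa[OF that]
    by (intro borel_measurable_limit_off_null[OF N(1), where q = "dir_quot F u"]) (auto simp: a_def)
  have ab: "\<bar>a u x\<bar> \<le> L * norm u" if "u \<in> {v, w, v + w}" for u x
  proof (cases "x \<in> N")
    case False
    show ?thesis
      by (rule tendsto_upperbound[OF tendsto_rabs[OF qa[OF that False]]])
        (auto intro: always_eventually dir_quot_bound[OF lip])
  qed (use L0 in \<open>auto simp: a_def\<close>)
  have m3 [measurable]: "a v \<in> borel_measurable borel" "a w \<in> borel_measurable borel" "a (v + w) \<in> borel_measurable borel"
    by (auto intro: am)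
  have notN: "AE x in lborel. x \<notin> N" using N(1) by (rule AE_not_in)
  let ?s = "\<lambda>n. inverse (real (Suc n))"
  have s0: "(\<lambda>n. ?s n *\<^sub>R w) \<longlonglongrightarrow> 0"
    using tendsto_scaleR[OF LIMSEQ_inverse_real_of_nat tendsto_const[of w]] by simp
  have "AE x in lborel. indicator (cball 0 (real R)) x * \<bar>a (v + w) x - a v x - a w x\<bar> = 0" for R :: nat
  proof -
    let ?B = "indicator (cball 0 (real R)) :: 'b \<Rightarrow> real"
    \<comment> \<open>Enlarged by \<open>norm w\<close>, so that the shifts x + w / (n + 1) of
      points of the smaller ball stay inside.\<close>
    let ?B' = "indicator (cball 0 (real R + norm w)) :: 'b \<Rightarrow> real"
    have [measurable]: "cball (0::'b) r \<in> sets borel" for r by simp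
    define e where "e n x = ?B' x * \<bar>dir_quot F v n x - a v x\<bar>" for n x
    define J where "J x = ?B' x * a v x" for x
    have [measurable]: "e n \<in> borel_measurable borel" "J \<in> borel_measurable borel" for n
      unfolding e_def[abs_def] J_def[abs_def] by measurable
    have eb: "norm (e n x) \<le> 2 * (L * norm v) * indicator (cball 0 (real R + norm w)) x" for n x
      using ab[of v x] dir_quot_bound[OF lip, of v n x] unfolding e_def by (auto simp: indicator_def)
    have ei: "integrable lborel (e n)" for n
      by (rule integrable_lborel_bounded_support[OF _ eb]) measurable
    have Ji: "integrable lborel J"
      by (rule integrable_lborel_bounded_support[where C = "L * norm v" and R = "real R + norm w"])
        (use ab[of v] L0 in \<open>auto simp: J_def indicator_def\<close>)
    have e0: "(\<lambda>n. \<integral>x. e n x \<partial>lborel) \<longlonglongrightarrow> integral\<^sup>L lborel (\<lambda>_::'b. 0::real)"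
    proof (rule integral_dominated_convergence[where w = "\<lambda>x. 2 * (L * norm v) * indicator (cball 0 (real R + norm w)) x"])
      show "integrable lborel (\<lambda>x::'b. 2 * (L * norm v) * indicator (cball 0 (real R + norm w)) x :: real)"
        by (rule integrable_lborel_bounded_support[where C = "2 * (L * norm v)" and R = "real R + norm w"])
          (use L0 in auto)
      show "AE x in lborel. (\<lambda>n. e n x) \<longlonglongrightarrow> 0"
        using notN
      proof eventually_elim
        case (elim x)
        have "(\<lambda>n. ?B' x * \<bar>dir_quot F v n x - a v x\<bar>) \<longlonglongrightarrow> ?B' x * \<bar>a v x - a v x\<bar>"
          by (intro tendsto_intros qa) (use elim in auto)
        then show ?case by (simp add: e_def)
      qed
    qed (use eb in \<open>auto intro: AE_I2\<close>)
    define h where "h n x = ?B x * \<bar>dir_quot F v n (x + ?s n *\<^sub>R w) - a v x\<bar>" for n x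
    \<comment> \<open>Insert the value of \<open>a v\<close> at the shifted point: one part is the
      error \<open>e n\<close> there, the other a translation of the fixed integrable function
      \<open>J\<close>.\<close>
    have h_le: "h n x \<le> e n (x + ?s n *\<^sub>R w) + \<bar>J (x + ?s n *\<^sub>R w) - J x\<bar>" for n x
    proof (cases "norm x \<le> R")
      case True
      have "norm (?s n *\<^sub>R w) \<le> norm w"
        by (simp add: mult_left_le_one_le inverse_le_1_iff)
      then have "norm (x + ?s n *\<^sub>R w) \<le> R + norm w" using True norm_triangle_ineq[of x "?s n *\<^sub>R w"] by linarith
      moreover have "norm x \<le> R + norm w" using True by (simp add: add_increasing2)
      ultimately show ?thesis unfolding h_def e_def J_def using True by (simp del: of_nat_Suc)
    qed (auto simp: h_def e_def simp del: of_nat_Suc)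
    have hi: "integrable lborel (h n)" for n
    proof (rule integrable_lborel_bounded_support[where C = "2 * (L * norm v)" and R = "real R"])
      show "h n \<in> borel_measurable borel" unfolding h_def[abs_def] by measurable
      show "norm (h n x) \<le> 2 * (L * norm v) * indicator (cball 0 (real R)) x" for x
        using ab[of v x] dir_quot_bound[OF lip, of v n "x + ?s n *\<^sub>R w"] unfolding h_def by (auto simp: indicator_def)
    qed
    have h0: "(\<lambda>n. \<integral>x. h n x \<partial>lborel) \<longlonglongrightarrow> 0"
    proof (rule tendsto_sandwich[OF _ _ tendsto_const])
      have "(\<lambda>n. (\<integral>x. e n x \<partial>lborel) + (\<integral>x. norm (J (x + ?s n *\<^sub>R w) - J x) \<partial>lborel)) \<longlonglongrightarrow> 0 + 0"
        using e0 by (intro tendsto_add L1_translation[OF Ji s0]) simp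
      then show "(\<lambda>n. (\<integral>x. e n x \<partial>lborel) + (\<integral>x. norm (J (x + ?s n *\<^sub>R w) - J x) \<partial>lborel)) \<longlonglongrightarrow> 0" by simp
      have "(\<integral>x. h n x \<partial>lborel) \<le> (\<integral>x. e n x \<partial>lborel) + (\<integral>x. norm (J (x + ?s n *\<^sub>R w) - J x) \<partial>lborel)" for n
      proof -
        have i1: "integrable lborel (\<lambda>x. e n (x + ?s n *\<^sub>R w))"
          by (rule integrable_lborel_translation[OF ei])
        have i2: "integrable lborel (\<lambda>x. norm (J (x + ?s n *\<^sub>R w) - J x))"
          by (intro integrable_norm Bochner_Integration.integrable_diff integrable_lborel_translation Ji)
        have "(\<integral>x. h n x \<partial>lborel) \<le> (\<integral>x. e n (x + ?s n *\<^sub>R w) + norm (J (x + ?s n *\<^sub>R w) - J x) \<partial>lborel)"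
          by (intro integral_mono hi Bochner_Integration.integrable_add i1 i2) (simp add: h_le del: of_nat_Suc)
        also have "\<dots> = (\<integral>x. e n x \<partial>lborel) + (\<integral>x. norm (J (x + ?s n *\<^sub>R w) - J x) \<partial>lborel)"
          using integral_lborel_translation[of "e n" "?s n *\<^sub>R w"] by (subst Bochner_Integration.integral_add[OF i1 i2]) simp
        finally show ?thesis .
      qed
      then show "\<forall>\<^sub>F n in sequentially. (\<integral>x. h n x \<partial>lborel) \<le> (\<integral>x. e n x \<partial>lborel) + (\<integral>x. norm (J (x + ?s n *\<^sub>R w) - J x) \<partial>lborel)"
        by simp
      show "\<forall>\<^sub>F n in sequentially. 0 \<le> (\<integral>x. h n x \<partial>lborel)"
        by (intro always_eventually allI integral_nonneg_AE AE_I2) (simp add: h_def)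
    qed
    define G where "G x = ?B x * \<bar>a (v + w) x - a v x - a w x\<bar>" for x
    have [measurable]: "G \<in> borel_measurable borel" unfolding G_def[abs_def] by measurable
    \<comment> \<open>By \<open>dir_quot_add\<close> the same function has a second form, with
      pointwise limit \<open>G\<close>. Comparing the two limits of its integral shows that
      \<open>G\<close> has integral 0.\<close>
    have h_eq: "h n x = ?B x * \<bar>dir_quot F (v + w) n x - a v x - dir_quot F w n x\<bar>" for n x
      unfolding h_def dir_quot_add by simp
    have "(\<lambda>n. \<integral>x. h n x \<partial>lborel) \<longlonglongrightarrow> (\<integral>x. G x \<partial>lborel)"
    proof (rule integral_dominated_convergence[where w = "\<lambda>x. 2 * (L * norm v) * ?B x"])
      show "integrable lborel (\<lambda>x::'b. 2 * (L * norm v) * ?B x)"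
        by (rule integrable_lborel_bounded_support[where C = "2 * (L * norm v)" and R = "real R"])
          (use L0 in auto)
      show "AE x in lborel. (\<lambda>n. h n x) \<longlonglongrightarrow> G x"
        using notN
      proof eventually_elim
        case (elim x)
        show ?case unfolding h_eq G_def
          by (intro tendsto_intros qa) (use elim in auto)
      qed
      show "AE x in lborel. norm (h n x) \<le> 2 * (L * norm v) * ?B x" for n
      proof (rule AE_I2)
        fix x show "norm (h n x) \<le> 2 * (L * norm v) * ?B x"
        using ab[of v x] dir_quot_bound[OF lip, of v n "x + ?s n *\<^sub>R w"] unfolding h_def by (auto simp: indicator_def)
      qed
    qed (use hi in auto)
    with h0 have "(\<integral>x. G x \<partial>lborel) = 0" by (rule LIMSEQ_unique[symmetric])
    moreover have "integrable lborel G"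
    proof (rule integrable_lborel_bounded_support[where C = "L * norm (v + w) + L * norm v + L * norm w" and R = "real R"])
      show "norm (G x) \<le> (L * norm (v + w) + L * norm v + L * norm w) * indicator (cball 0 (real R)) x" for x
        using ab[of v x] ab[of w x] ab[of "v + w" x] by (auto simp: indicator_def G_def)
    qed measurable
    moreover have "AE x in lborel. 0 \<le> G x" by (simp add: G_def)
    ultimately have "AE x in lborel. G x = 0"
      using integral_nonneg_eq_0_iff_AE[of lborel G] by blast
    then show ?thesis by (simp only: G_def)
  qed
  then have "AE x in lborel. \<forall>R::nat. indicator (cball 0 (real R)) x * \<bar>a (v + w) x - a v x - a w x\<bar> = 0"
    unfolding AE_all_countable by blast
  then show ?thesis using notN
  proof eventually_elim
    case (elim x)
    obtain R :: nat where "norm x \<le> R" using real_arch_simple by blast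
    with elim(1)[rule_format, of R] elim(2) show ?case by (auto simp: a_def)
  qed
qed

lemma dir_deriv_scale:
  assumes "(\<lambda>s. F (x + s *\<^sub>R v)) differentiable (at 0)"
  shows "dir_deriv F (c *\<^sub>R v) x = c * dir_deriv F v x"
proof -
  have "((\<lambda>s. F (x + s *\<^sub>R v)) has_real_derivative dir_deriv F v x) (at (c * 0))"
    using assms unfolding dir_deriv_def by (simp add: DERIV_deriv_iff_real_differentiable)
  from DERIV_chain'[OF DERIV_cmult_Id[of c "0::real" UNIV] this]
  have "((\<lambda>s. F (x + s *\<^sub>R (c *\<^sub>R v))) has_real_derivative c * dir_deriv F v x) (at 0)"
    by (simp add: mult.commute)
  then show ?thesis unfolding dir_deriv_def[of F "c *\<^sub>R v"] by (rule DERIV_imp_deriv)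
qed

lemma dir_deriv_linear:
  fixes F :: "'b::euclidean_space \<Rightarrow> real"
  assumes lip: "L-lipschitz_on UNIV F"
  shows "AE x in lborel. dir_deriv F v x = (\<Sum>b\<in>Basis. (v \<bullet> b) * dir_deriv F b x)"
proof -
  have "AE x in lborel. dir_deriv F (\<Sum>b\<in>S. (v \<bullet> b) *\<^sub>R b) x = (\<Sum>b\<in>S. (v \<bullet> b) * dir_deriv F b x)"
    if "finite S" for S
    using that
  proof induction
    case empty
    show ?case by (simp add: dir_deriv_def)
  next
    case (insert c S)
    from insert.IH dir_deriv_add[OF lip, of "(v \<bullet> c) *\<^sub>R c" "\<Sum>b\<in>S. (v \<bullet> b) *\<^sub>R b"]
      lipschitz_AE_differentiable_along[OF lip, of c]
    show ?case
      by eventually_elim (simp add: insert.hyps dir_deriv_scale)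
  qed
  from this[OF finite_Basis] show ?thesis by (simp add: euclidean_representation)
qed

text \<open>Directional differentiability carries no uniformity in the direction. Compactness of the
  unit sphere leaves finitely many directions of \<open>V\<close> up to an error \<open>e\<close>,
  and the Lipschitz bound transfers the estimate to all others.\<close>

lemma lipschitz_differentiable_if_dense_directions:
  fixes F :: "'b::euclidean_space \<Rightarrow> real"
  assumes lip: "L-lipschitz_on UNIV F"
    and dense: "\<And>U. open U \<Longrightarrow> U \<noteq> {} \<Longrightarrow> \<exists>v\<in>V. v \<in> (U :: 'b set)"
    and diff: "\<And>v. v \<in> V \<Longrightarrow> (\<lambda>s. F (x + s *\<^sub>R v)) differentiable (at 0)"
    and lin: "\<And>v. v \<in> V \<Longrightarrow> dir_deriv F v x = (\<Sum>b\<in>Basis. (v \<bullet> b) * dir_deriv F b x)"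
  shows "F differentiable (at x)"
proof -
  define g where "g = (\<Sum>b\<in>Basis. dir_deriv F b x *\<^sub>R b)"
  have A: "dir_deriv F v x = v \<bullet> g" if "v \<in> V" for v
    using lin[OF that] by (simp add: g_def inner_sum_right mult.commute)
  have L0: "L \<ge> 0" using lipschitz_on_nonneg[OF lip] .
  have "(F has_derivative (\<lambda>v. v \<bullet> g)) (at x)"
    unfolding has_derivative_at_alt
  proof (intro conjI allI impI)
    show "bounded_linear (\<lambda>v. v \<bullet> g)" by (rule bounded_linear_inner_left)
    fix \<epsilon> :: real assume "\<epsilon> > 0"
    \<comment> \<open>Three errors proportional to \<open>e * s\<close> are added below: with factor
      1 from the derivative along \<open>v\<close>, with \<open>L\<close> from moving the argument
      of \<open>F\<close>, with \<open>norm g\<close> from moving the direction in the linear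
      term.\<close>
    define e where "e = \<epsilon> / (L + norm g + 1)"
    have M: "L + norm g + 1 > 0" using L0 by (smt (verit) norm_ge_zero)
    have e: "e > 0" using \<open>\<epsilon> > 0\<close> M by (simp add: e_def)
    have "sphere 0 1 \<subseteq> (\<Union>v\<in>V. ball v e)"
    proof
      fix \<theta> :: 'b
      obtain v where "v \<in> V" "v \<in> ball \<theta> e" using dense[of "ball \<theta> e"] e by auto
      then show "\<theta> \<in> (\<Union>v\<in>V. ball v e)" by (auto simp: dist_commute)
    qed
    from compactE_image[OF compact_sphere _ this] obtain V' where V': "V' \<subseteq> V" "finite V'" "sphere 0 1 \<subseteq> (\<Union>v\<in>V'. ball v e)"
      by auto
    have "\<exists>r>0. \<forall>s. \<bar>s\<bar> < r \<longrightarrow> \<bar>F (x + s *\<^sub>R v) - F x - s * (v \<bullet> g)\<bar> \<le> e * \<bar>s\<bar>" if "v \<in> V'" for v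
    proof -
      have "v \<in> V" using that V' by auto
      have "((\<lambda>s. F (x + s *\<^sub>R v)) has_real_derivative v \<bullet> g) (at 0)"
        using diff[OF \<open>v \<in> V\<close>] A[OF \<open>v \<in> V\<close>] unfolding dir_deriv_def by (metis DERIV_deriv_iff_real_differentiable)
      then have "((\<lambda>s. F (x + s *\<^sub>R v)) has_derivative (\<lambda>s. (v \<bullet> g) * s)) (at 0)"
        by (simp add: has_field_derivative_def)
      from this[unfolded has_derivative_at_alt] e obtain r where "r > 0"
        "\<And>s. norm (s - 0) < r \<Longrightarrow> norm (F (x + s *\<^sub>R v) - F (x + 0 *\<^sub>R v) - (v \<bullet> g) * (s - 0)) \<le> e * norm (s - 0)"
        by blast
      then show ?thesis by (intro exI[of _ r]) (simp add: mult.commute)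
    qed
    then obtain r where r: "\<And>v. v \<in> V' \<Longrightarrow> r v > 0"
      "\<And>v s. v \<in> V' \<Longrightarrow> \<bar>s\<bar> < r v \<Longrightarrow> \<bar>F (x + s *\<^sub>R v) - F x - s * (v \<bullet> g)\<bar> \<le> e * \<bar>s\<bar>" by metis
    define d where "d = Min (insert 1 (r ` V'))"
    have d: "d > 0" using V'(2) r(1) by (auto simp: d_def)
    have dr: "d \<le> r v" if "v \<in> V'" for v using V'(2) that by (auto simp: d_def)
    have "norm (F y - F x - (y - x) \<bullet> g) \<le> \<epsilon> * norm (y - x)" if y: "norm (y - x) < d" for y
    proof (cases "y = x")
      case False
      define s where "s = norm (y - x)"
      have s: "s > 0" using False by (simp add: s_def)
      define \<theta> where "\<theta> = (y - x) /\<^sub>R s"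
      have y_eq: "y = x + s *\<^sub>R \<theta>" using s by (simp add: \<theta>_def)
      have "\<theta> \<in> sphere 0 1" using s by (simp add: \<theta>_def s_def)
      then obtain v where v: "v \<in> V'" "norm (v - \<theta>) < e" using V'(3) by (auto simp: dist_norm)
      have 1: "\<bar>F (x + s *\<^sub>R v) - F x - s * (v \<bullet> g)\<bar> \<le> e * s"
        using r(2)[OF v(1), of s] dr[OF v(1)] y s by (simp add: s_def)
      have "\<bar>F y - F (x + s *\<^sub>R v)\<bar> \<le> L * norm (s *\<^sub>R (v - \<theta>))"
        using lipschitz_onD[OF lip, of y "x + s *\<^sub>R v"] unfolding y_eq
        by (simp add: dist_norm norm_minus_commute algebra_simps)
      also have "\<dots> \<le> L * (s * e)" using v(2) s L0 by (intro mult_left_mono) (simp_all add: mult_left_mono)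
      finally have 2: "\<bar>F y - F (x + s *\<^sub>R v)\<bar> \<le> L * (s * e)" .
      have "\<bar>s * (v \<bullet> g) - s * (\<theta> \<bullet> g)\<bar> = s * \<bar>(v - \<theta>) \<bullet> g\<bar>"
        using s by (simp add: abs_mult inner_diff_left flip: right_diff_distrib)
      also have "\<dots> \<le> s * (norm (v - \<theta>) * norm g)" using s by (intro mult_left_mono Cauchy_Schwarz_ineq2) auto
      also have "\<dots> \<le> s * (e * norm g)" using s v(2) by (intro mult_left_mono mult_right_mono) auto
      finally have 3: "\<bar>s * (v \<bullet> g) - s * (\<theta> \<bullet> g)\<bar> \<le> s * (e * norm g)" .
      have "(y - x) \<bullet> g = s * (\<theta> \<bullet> g)" by (simp add: y_eq)
      then have "norm (F y - F x - (y - x) \<bullet> g) \<le> e * s + L * (s * e) + s * (e * norm g)"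
        using 1 2 3 by simp
      also have "\<dots> = e * (L + norm g + 1) * s" by (simp add: algebra_simps)
      also have "\<dots> = \<epsilon> * s" using M by (simp add: e_def)
      finally show ?thesis by (simp add: s_def)
    qed simp
    with d show "\<exists>d>0. \<forall>y. norm (y - x) < d \<longrightarrow> norm (F y - F x - (y - x) \<bullet> g) \<le> \<epsilon> * norm (y - x)" by blast
  qed
  then show ?thesis by (rule differentiableI)
qed

text \<open>A countable dense set of directions permits uniting the exceptional null sets.\<close>

theorem rademacher:
  fixes F :: "'b::euclidean_space \<Rightarrow> real"
  assumes lip: "L-lipschitz_on UNIV F"
  shows "AE x in lborel. F differentiable (at x)"
proof -
  obtain V :: "'b set" where V: "countable V" "\<And>U. open U \<Longrightarrow> U \<noteq> {} \<Longrightarrow> \<exists>v\<in>V. v \<in> U"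
    using countable_dense_exists by blast
  have "AE x in lborel. \<forall>v\<in>V. (\<lambda>s. F (x + s *\<^sub>R v)) differentiable (at 0) \<and>
      dir_deriv F v x = (\<Sum>b\<in>Basis. (v \<bullet> b) * dir_deriv F b x)"
    unfolding AE_ball_countable[OF V(1)]
    using lipschitz_AE_differentiable_along[OF lip] dir_deriv_linear[OF lip] by (auto intro: eventually_conj)
  then show ?thesis
    by eventually_elim (rule lipschitz_differentiable_if_dense_directions[OF lip V(2)], auto)
qed

subsection \<open>Integration by parts for Lipschitz curves\<close>

lemma DERIV_imp_quotient_tendsto:
  assumes "(g has_real_derivative d) (at t)"
  shows "(\<lambda>n. (g (t + inverse (real (Suc n))) - g t) / inverse (real (Suc n))) \<longlonglongrightarrow> d"
proof -
  have "(\<lambda>s. (g (t + s) - g t) / s) \<midarrow>0\<rightarrow> d" using assms by (simp add: DERIV_def)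
  from this[unfolded tendsto_at_iff_sequentially, rule_format, of "\<lambda>n. inverse (real (Suc n))"]
  show ?thesis using LIMSEQ_inverse_real_of_nat by (simp add: o_def del: of_nat_Suc)
qed

text \<open>The density found earlier is replaced by one that is Borel and bounded by
  \<open>L\<close> at every point: 0 on the exceptional set and a limit of difference quotients
  elsewhere.\<close>

lemma lipschitz_FTC_UNIV:
  fixes g :: "real \<Rightarrow> real"
  assumes lip: "L-lipschitz_on UNIV g" and ab: "a \<le> b"
  obtains h where "h \<in> borel_measurable borel" "\<forall>t. \<bar>h t\<bar> \<le> L"
    "(\<integral>t. indicator {a<..<b} t * h t \<partial>lborel) = g b - g a"
    "AE t in lborel. (g has_real_derivative h t) (at t)"
proof -
  have L0: "L \<ge> 0" using lipschitz_on_nonneg[OF lip] .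
  from lipschitz_real_AE_derivative[OF lip] obtain H where H:
    "\<forall>a b. a \<le> b \<longrightarrow> (H has_integral (g b - g a)) {a..b}"
    "AE x in lborel. (g has_real_derivative H x) (at x)" .
  from AE_lborelE[OF H(2)] obtain N where N: "N \<in> null_sets lborel"
    "\<forall>x. x \<notin> N \<longrightarrow> (g has_real_derivative H x) (at x)" .
  define h where "h t = (if t \<in> N then 0 else H t)" for t
  define q where "q n t = (g (t + inverse (real (Suc n))) - g t) / inverse (real (Suc n))" for n t
  have [measurable]: "g \<in> borel_measurable borel"
    using lipschitz_on_continuous_on[OF lip] by (rule borel_measurable_continuous_onI)
  have qm: "q n \<in> borel_measurable borel" for n unfolding q_def[abs_def] by measurable
  have qlim: "(\<lambda>n. q n t) \<longlonglongrightarrow> H t" if "t \<notin> N" for t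
    unfolding q_def using N(2) that by (intro DERIV_imp_quotient_tendsto) blast
  have hm [measurable]: "h \<in> borel_measurable borel"
    unfolding h_def[abs_def] by (rule borel_measurable_limit_off_null[OF N(1) qm qlim])
  have qb: "\<bar>q n t\<bar> \<le> L" for n t
  proof -
    have "\<bar>g (t + inverse (real (Suc n))) - g t\<bar> \<le> L * inverse (real (Suc n))"
      using lipschitz_onD[OF lip, of "t + inverse (real (Suc n))" t] by (simp add: dist_real_def del: of_nat_Suc)
    then show ?thesis unfolding q_def abs_divide by (simp add: pos_divide_le_eq del: of_nat_Suc)
  qed
  have hb: "\<bar>h t\<bar> \<le> L" for t
  proof (cases "t \<in> N")
    case False
    have "\<bar>H t\<bar> \<le> L" by (rule tendsto_upperbound[OF tendsto_rabs[OF qlim[OF False]]]) (use qb in auto)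
    then show ?thesis using False by (simp add: h_def)
  qed (simp add: h_def L0)
  have AEh: "AE t in lborel. (g has_real_derivative h t) (at t)"
    using AE_not_in[OF N(1)] by eventually_elim (simp add: h_def N(2))
  have int: "integrable lborel (\<lambda>t. indicator {a<..<b} t * h t)"
  proof (rule integrable_lborel_bounded_support[where C = L and R = "max \<bar>a\<bar> \<bar>b\<bar>"])
    show "norm (indicator {a<..<b} t * h t) \<le> L * indicator (cball 0 (max \<bar>a\<bar> \<bar>b\<bar>)) t" for t
      using hb[of t] L0 by (auto simp: indicator_def)
  qed measurable
  have "(h has_integral (g b - g a)) {a..b}"
  proof (rule has_integral_spike[of N _ _ H])
    show "negligible N" using N(1) by (simp add: negligible_iff_null_sets null_sets_completionI)
    show "(H has_integral g b - g a) {a..b}" using H(1) ab by blast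
  qed (simp add: h_def)
  then have "(h has_integral (g b - g a)) {a<..<b}" by (simp add: has_integral_Icc_iff_Ioo)
  then have "((\<lambda>t. if t \<in> {a<..<b} then h t else 0) has_integral (g b - g a)) UNIV"
    using has_integral_restrict_UNIV[of "{a<..<b}" h] by blast
  moreover have "(\<lambda>t. if t \<in> {a<..<b} then h t else 0) = (\<lambda>t. indicator {a<..<b} t * h t)"
    by (auto simp: indicator_def)
  ultimately have "((\<lambda>t. indicator {a<..<b} t * h t) has_integral (g b - g a)) UNIV" by simp
  from has_integral_unique[OF has_integral_integral_lborel[OF int] this]
  have "(\<integral>t. indicator {a<..<b} t * h t \<partial>lborel) = g b - g a" .
  with hm hb AEh show thesis by (intro that) auto
qed

lemma lipschitz_FTC:
  fixes G :: "real \<Rightarrow> 'c::euclidean_space"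
  assumes lip: "L-lipschitz_on {a..b} G" and ab: "a \<le> b"
  obtains h where "h \<in> borel_measurable borel" "integrable lborel (\<lambda>t. indicator {a<..<b} t *\<^sub>R h t)"
    "(\<integral>t. indicator {a<..<b} t *\<^sub>R h t \<partial>lborel) = G b - G a"
    "AE t in lborel. t \<in> {a<..<b} \<longrightarrow> (G has_vector_derivative h t) (at t)"
proof -
  \<comment> \<open>Clamping the argument to the interval extends \<open>G\<close> to the line with
    the same Lipschitz constant and changes nothing inside.\<close>
  define Ge where "Ge t = G (max a (min b t))" for t
  have Ge_lip: "L-lipschitz_on UNIV (\<lambda>t. Ge t \<bullet> i)" if "i \<in> Basis" for i
  proof (rule lipschitz_onI)
    fix s t :: real
    have "\<bar>Ge s \<bullet> i - Ge t \<bullet> i\<bar> \<le> norm (Ge s - Ge t)"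
      using Basis_le_norm[OF that, of "Ge s - Ge t"] by (simp add: inner_diff_left)
    also have "\<dots> \<le> L * dist (max a (min b s)) (max a (min b t))"
      unfolding Ge_def using lipschitz_onD[OF lip, of "max a (min b s)" "max a (min b t)"] ab
      by (simp add: dist_norm)
    also have "\<dots> \<le> L * dist s t"
      using lipschitz_on_nonneg[OF lip] by (intro mult_left_mono) (auto simp: dist_real_def)
    finally show "dist (Ge s \<bullet> i) (Ge t \<bullet> i) \<le> L * dist s t" by (simp add: dist_real_def)
  qed (rule lipschitz_on_nonneg[OF lip])
  have "\<forall>i\<in>Basis. \<exists>h. h \<in> borel_measurable borel \<and> (\<forall>t. \<bar>h t\<bar> \<le> L) \<and>
     (\<integral>t. indicator {a<..<b} t * h t \<partial>lborel) = Ge b \<bullet> i - Ge a \<bullet> i \<and>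
     (AE t in lborel. ((\<lambda>t. Ge t \<bullet> i) has_real_derivative h t) (at t))"
  proof
    fix i :: 'c assume "i \<in> Basis"
    from lipschitz_FTC_UNIV[OF Ge_lip[OF this] ab] obtain h where
      "h \<in> borel_measurable borel" "\<forall>t. \<bar>h t\<bar> \<le> L"
      "(\<integral>t. indicator {a<..<b} t * h t \<partial>lborel) = Ge b \<bullet> i - Ge a \<bullet> i"
      "AE t in lborel. ((\<lambda>t. Ge t \<bullet> i) has_real_derivative h t) (at t)" .
    then show "\<exists>h. h \<in> borel_measurable borel \<and> (\<forall>t. \<bar>h t\<bar> \<le> L) \<and>
     (\<integral>t. indicator {a<..<b} t * h t \<partial>lborel) = Ge b \<bullet> i - Ge a \<bullet> i \<and>
     (AE t in lborel. ((\<lambda>t. Ge t \<bullet> i) has_real_derivative h t) (at t))" by (intro exI[of _ h] conjI)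
  qed
  from bchoice[OF this] obtain H where H: "\<forall>i\<in>Basis. H i \<in> borel_measurable borel \<and> (\<forall>t. \<bar>H i t\<bar> \<le> L) \<and>
     (\<integral>t. indicator {a<..<b} t * H i t \<partial>lborel) = Ge b \<bullet> i - Ge a \<bullet> i \<and>
     (AE t in lborel. ((\<lambda>t. Ge t \<bullet> i) has_real_derivative H i t) (at t))" by blast
  define h where "h t = (\<Sum>i\<in>Basis. H i t *\<^sub>R i)" for t
  have Hm: "H i \<in> borel_measurable borel" if "i \<in> Basis" for i using H that by blast
  have Hint: "integrable lborel (\<lambda>t. indicator {a<..<b} t * H i t)" if "i \<in> Basis" for i
  proof (rule integrable_lborel_bounded_support[where C = L and R = "max \<bar>a\<bar> \<bar>b\<bar>"])
    have "\<bar>H i t\<bar> \<le> L" for t using H that by blast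
    then show "norm (indicator {a<..<b} t * H i t) \<le> L * indicator (cball 0 (max \<bar>a\<bar> \<bar>b\<bar>)) t" for t
      using lipschitz_on_nonneg[OF lip] by (auto simp: indicator_def)
    have [measurable]: "H i \<in> borel_measurable borel" by (rule Hm[OF that])
    show "(\<lambda>t. indicator {a<..<b} t * H i t) \<in> borel_measurable borel" by measurable
  qed
  have hm: "h \<in> borel_measurable borel"
    unfolding h_def[abs_def] by (intro borel_measurable_sum borel_measurable_scaleR Hm) auto
  have ind_h: "(\<lambda>t. indicator {a<..<b} t *\<^sub>R h t) = (\<lambda>t. \<Sum>i\<in>Basis. (indicator {a<..<b} t * H i t) *\<^sub>R i)"
    by (simp add: h_def scaleR_sum_right)
  have hint: "integrable lborel (\<lambda>t. indicator {a<..<b} t *\<^sub>R h t)"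
    unfolding ind_h by (intro Bochner_Integration.integrable_sum integrable_scaleR_left Hint) auto
  have "(\<integral>t. indicator {a<..<b} t *\<^sub>R h t \<partial>lborel) = (\<Sum>i\<in>Basis. (\<integral>t. indicator {a<..<b} t * H i t \<partial>lborel) *\<^sub>R i)"
    unfolding ind_h
    by (subst Bochner_Integration.integral_sum) (auto intro!: integrable_scaleR_left Hint sum.cong integral_scaleR_left)
  also have "\<dots> = (\<Sum>i\<in>Basis. ((Ge b - Ge a) \<bullet> i) *\<^sub>R i)"
    using H by (intro sum.cong) (auto simp: inner_diff_left)
  also have "\<dots> = G b - G a" using ab by (simp add: euclidean_representation Ge_def)
  finally have I: "(\<integral>t. indicator {a<..<b} t *\<^sub>R h t \<partial>lborel) = G b - G a" .
  have "AE t in lborel. \<forall>i\<in>Basis. ((\<lambda>t. Ge t \<bullet> i) has_real_derivative H i t) (at t)"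
    unfolding AE_ball_countable[OF countable_finite[OF finite_Basis]] using H by blast
  then have "AE t in lborel. t \<in> {a<..<b} \<longrightarrow> (G has_vector_derivative h t) (at t)"
  proof eventually_elim
    case (elim t)
    show ?case
    proof
      assume t: "t \<in> {a<..<b}"
      have "((\<lambda>t. \<Sum>i\<in>Basis. (Ge t \<bullet> i) *\<^sub>R i) has_vector_derivative h t) (at t)"
        unfolding h_def using elim
        by (intro has_vector_derivative_sum bounded_linear.has_vector_derivative[OF bounded_linear_scaleR_left])
          (simp add: has_real_derivative_iff_has_vector_derivative)
      then have "(Ge has_vector_derivative h t) (at t)" by (simp add: euclidean_representation)
      then show "(G has_vector_derivative h t) (at t)"
        by (rule has_vector_derivative_transform_within_open[where S = "{a<..<b}"]) (use t in \<open>auto simp: Ge_def\<close>)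
    qed
  qed
  with hm hint I show thesis by (rule that)
qed

text \<open>The product \<open>e1 w *\<^sub>R G w\<close> is Lipschitz on the interval, so it is the
  integral of its derivative, which the product rule identifies almost everywhere. The left integral
  is over \<open>lebesgue\<close> because \<open>vector_derivative\<close> is arbitrary on a null
  set.\<close>

lemma integral_by_parts_Ioo:
  fixes G :: "real \<Rightarrow> 'c::euclidean_space" and e1 e2 :: "real \<Rightarrow> real"
  assumes lip: "L-lipschitz_on {a..b} G" and ab: "a \<le> b" and contG: "continuous_on UNIV G"
    and e1: "\<And>w. (e1 has_real_derivative e2 w) (at w)" and e2: "continuous_on UNIV e2"
  shows "(\<integral>w. indicator {a<..<b} w *\<^sub>R (e1 w *\<^sub>R vector_derivative G (at w)) \<partial>lebesgue)
    = e1 b *\<^sub>R G b - e1 a *\<^sub>R G a - (\<integral>w. indicator {a<..<b} w *\<^sub>R (e2 w *\<^sub>R G w) \<partial>lborel)"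
proof -
  have conte1: "continuous_on UNIV e1"
    using e1 by (auto simp: continuous_on_eq_continuous_at intro: DERIV_isCont)
  have [measurable]: "e1 \<in> borel_measurable borel" "e2 \<in> borel_measurable borel" "G \<in> borel_measurable borel"
    using conte1 e2 contG by (auto intro: borel_measurable_continuous_onI)
  have "bounded (e1 ` {a..b})" "bounded (e2 ` {a..b})" "bounded (G ` {a..b})"
    using conte1 e2 contG by (auto intro!: compact_imp_bounded compact_continuous_image intro: continuous_on_subset)
  then obtain B where B: "\<forall>w\<in>{a..b}. \<bar>e1 w\<bar> \<le> B" and E: "\<exists>E. \<forall>w\<in>{a..b}. \<bar>e2 w\<bar> \<le> E" and M: "\<exists>M. \<forall>w\<in>{a..b}. norm (G w) \<le> M"
    unfolding bounded_iff by auto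
  from E obtain E where E: "\<forall>w\<in>{a..b}. \<bar>e2 w\<bar> \<le> E" by blast
  from M obtain M where M: "\<forall>w\<in>{a..b}. norm (G w) \<le> M" by blast
  have nn: "B \<ge> 0" "E \<ge> 0" "M \<ge> 0" using B E M ab by (fastforce intro: order_trans[OF abs_ge_zero] order_trans[OF norm_ge_zero])+
  have e1_lip: "\<bar>e1 s - e1 t\<bar> \<le> E * \<bar>s - t\<bar>" if "s \<in> {a..b}" "t \<in> {a..b}" for s t
    using field_differentiable_bound[of "{a..b}" e1 e2 E s t] that E e1
    by (auto intro: DERIV_subset has_field_derivative_at_within)
  let ?P = "\<lambda>w. e1 w *\<^sub>R G w"
  have "(B * L + E * M)-lipschitz_on {a..b} ?P"
  proof (rule lipschitz_onI)
    fix s t assume st: "s \<in> {a..b}" "t \<in> {a..b}"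
    have "?P s - ?P t = e1 s *\<^sub>R (G s - G t) + (e1 s - e1 t) *\<^sub>R G t"
      by (simp add: algebra_simps)
    then have "norm (?P s - ?P t) \<le> \<bar>e1 s\<bar> * norm (G s - G t) + \<bar>e1 s - e1 t\<bar> * norm (G t)"
      by (metis norm_triangle_ineq norm_scaleR)
    also have "\<dots> \<le> B * (L * \<bar>s - t\<bar>) + (E * \<bar>s - t\<bar>) * M"
      using st B M nn lipschitz_onD[OF lip st] e1_lip[OF st] unfolding dist_norm dist_real_def
      by (intro add_mono mult_mono) auto
    finally show "dist (?P s) (?P t) \<le> (B * L + E * M) * dist s t"
      by (simp add: dist_norm dist_real_def algebra_simps)
  qed (use nn lipschitz_on_nonneg[OF lip] in simp)
  from lipschitz_FTC[OF this ab] obtain h where h: "h \<in> borel_measurable borel"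
    "integrable lborel (\<lambda>t. indicator {a<..<b} t *\<^sub>R h t)"
    "(\<integral>t. indicator {a<..<b} t *\<^sub>R h t \<partial>lborel) = ?P b - ?P a"
    "AE t in lborel. t \<in> {a<..<b} \<longrightarrow> (?P has_vector_derivative h t) (at t)" .
  from lipschitz_FTC[OF lip ab] obtain g where g:
    "AE t in lborel. t \<in> {a<..<b} \<longrightarrow> (G has_vector_derivative g t) (at t)" by blast
  have i2: "integrable lborel (\<lambda>w. indicator {a<..<b} w *\<^sub>R (e2 w *\<^sub>R G w))"
  proof (rule integrable_lborel_bounded_support[where C = "E * M" and R = "max \<bar>a\<bar> \<bar>b\<bar>"])
    have "\<bar>e2 w\<bar> * norm (G w) \<le> E * M" if "w \<in> {a..b}" for w
      using that E M nn by (intro mult_mono) auto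
    then show "norm (indicator {a<..<b} w *\<^sub>R (e2 w *\<^sub>R G w)) \<le> (E * M) * indicator (cball 0 (max \<bar>a\<bar> \<bar>b\<bar>)) w" for w
      using nn by (auto simp: indicator_def)
  qed measurable
  have "AE w in lborel. indicator {a<..<b} w *\<^sub>R (e1 w *\<^sub>R vector_derivative G (at w))
      = indicator {a<..<b} w *\<^sub>R h w - indicator {a<..<b} w *\<^sub>R (e2 w *\<^sub>R G w)"
    using h(4) g
  proof eventually_elim
    case (elim w)
    show ?case
    proof (cases "w \<in> {a<..<b}")
      case True
      then have dG: "(G has_vector_derivative g w) (at w)" and dP: "(?P has_vector_derivative h w) (at w)"
        using elim by auto
      have "(?P has_vector_derivative (e1 w *\<^sub>R g w + e2 w *\<^sub>R G w)) (at w)"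
        by (rule has_vector_derivative_scaleR[OF e1 dG])
      with dP have "h w = e1 w *\<^sub>R g w + e2 w *\<^sub>R G w" by (rule vector_derivative_unique_at)
      with True vector_derivative_at[OF dG] show ?thesis by simp
    qed simp
  qed
  from AE_lborel_eq_imp_lebesgue(2)[OF _ this] h(1)
  have "(\<integral>w. indicator {a<..<b} w *\<^sub>R (e1 w *\<^sub>R vector_derivative G (at w)) \<partial>lebesgue)
    = (\<integral>w. indicator {a<..<b} w *\<^sub>R h w - indicator {a<..<b} w *\<^sub>R (e2 w *\<^sub>R G w) \<partial>lborel)"
    by measurable
  also have "\<dots> = ?P b - ?P a - (\<integral>w. indicator {a<..<b} w *\<^sub>R (e2 w *\<^sub>R G w) \<partial>lborel)"
    using h(2,3) i2 by simp
  finally show ?thesis .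
qed

text \<open>The oriented interval from \<open>c\<close> to \<open>k\<close>: weighting an integrand with it gives the signed integral for
  both orders of the endpoints, and it is jointly measurable in its arguments.\<close>

definition sgn_ind :: "real \<Rightarrow> real \<Rightarrow> real \<Rightarrow> real" where
  "sgn_ind c k w = indicator {c<..<k} w - indicator {k<..<c} w"

lemma interval_integral_sgn_ind:
  fixes h :: "real \<Rightarrow> 'c::{banach, second_countable_topology}"
  shows "interval_lebesgue_integral M (ereal c) (ereal k) h = (\<integral>w. sgn_ind c k w *\<^sub>R h w \<partial>M)"
  by (auto simp: interval_lebesgue_integral_def set_lebesgue_integral_def sgn_ind_def simp flip: integral_minus)

lemma sgn_ind_borel [measurable]: "sgn_ind c k \<in> borel_measurable borel"
  unfolding sgn_ind_def[abs_def] by measurable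

lemma abs_sgn_ind: "\<bar>sgn_ind c k w\<bar> = indicator {min c k<..<max c k} w"
  by (auto simp: sgn_ind_def indicator_def)

lemma integrable_sgn_ind:
  fixes h :: "real \<Rightarrow> 'c::euclidean_space"
  assumes "continuous_on UNIV h"
  shows "integrable lborel (\<lambda>w. sgn_ind c k w *\<^sub>R h w)"
proof -
  have [measurable]: "h \<in> borel_measurable borel" using assms by (rule borel_measurable_continuous_onI)
  let ?R = "max \<bar>c\<bar> \<bar>k\<bar>"
  have "bounded (h ` cball 0 ?R)"
    by (intro compact_imp_bounded compact_continuous_image continuous_on_subset[OF assms]) auto
  then obtain M where M: "\<forall>w\<in>cball 0 ?R. norm (h w) \<le> M" unfolding bounded_iff by auto
  then have "M \<ge> 0" by (metis centre_in_cball norm_ge_zero order_trans abs_ge_zero max.coboundedI1)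
  show ?thesis
  proof (rule integrable_lborel_bounded_support[where C = M and R = ?R])
    show "norm (sgn_ind c k w *\<^sub>R h w) \<le> M * indicator (cball 0 ?R) w" for w
      using M \<open>M \<ge> 0\<close> by (auto simp: sgn_ind_def indicator_def)
  qed measurable
qed

lemma integral_by_parts_sgn_ind:
  fixes G :: "real \<Rightarrow> 'c::euclidean_space" and e1 e2 :: "real \<Rightarrow> real"
  assumes lip: "\<And>a b. \<exists>L. L-lipschitz_on {a..b} G"
    and e1: "\<And>w. (e1 has_real_derivative e2 w) (at w)" and e2: "continuous_on UNIV e2"
  shows "(\<integral>w. sgn_ind c k w *\<^sub>R (e1 w *\<^sub>R vector_derivative G (at w)) \<partial>lebesgue)
    = e1 k *\<^sub>R G k - e1 c *\<^sub>R G c - (\<integral>w. sgn_ind c k w *\<^sub>R (e2 w *\<^sub>R G w) \<partial>lborel)"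
proof -
  have "isCont G x" for x
  proof -
    obtain L where "L-lipschitz_on {x - 1..x + 1} G" using lip by blast
    then have "continuous_on {x - 1..x + 1} G" by (rule lipschitz_on_continuous_on)
    then show ?thesis by (rule continuous_on_interior) simp
  qed
  then have contG: "continuous_on UNIV G" by (simp add: continuous_on_eq_continuous_at)
  show ?thesis
  proof (cases "c \<le> k")
    case True
    then have s: "sgn_ind c k = indicator {c<..<k}" by (auto simp: sgn_ind_def)
    from lip[of c k] obtain L where L: "L-lipschitz_on {c..k} G" ..
    show ?thesis unfolding s by (rule integral_by_parts_Ioo[OF L True contG e1 e2])
  next
    case False
    then have s: "sgn_ind c k w = - indicator {k<..<c} w" for w by (auto simp: sgn_ind_def)
    from False have kc: "k \<le> c" by simp
    from lip[of k c] obtain L where L: "L-lipschitz_on {k..c} G" ..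
    show ?thesis
      unfolding s scaleR_minus_left Bochner_Integration.integral_minus
        integral_by_parts_Ioo[OF L kc contG e1 e2] by simp
  qed
qed

subsection \<open>Smooth approximations of the Kruzhkov entropies\<close>

text \<open>\<open>smooth_abs1\<close> and \<open>smooth_abs2\<close> are the first and second
  derivatives in \<open>k\<close>. As \<delta> tends to 0, \<open>smooth_abs2\<close> concentrates
  to a point mass 2 at \<open>c\<close>, one unit from each side.\<close>

definition smooth_abs :: "real \<Rightarrow> real \<Rightarrow> real \<Rightarrow> real" where "smooth_abs \<delta> c k = sqrt ((k - c)\<^sup>2 + \<delta>\<^sup>2)"
definition smooth_abs1 :: "real \<Rightarrow> real \<Rightarrow> real \<Rightarrow> real" where "smooth_abs1 \<delta> c k = (k - c) / smooth_abs \<delta> c k"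
definition smooth_abs2 :: "real \<Rightarrow> real \<Rightarrow> real \<Rightarrow> real" where "smooth_abs2 \<delta> c k = \<delta>\<^sup>2 / smooth_abs \<delta> c k ^ 3"

context
  fixes \<delta> :: real assumes \<delta>: "\<delta> > 0"
begin

lemma smooth_abs_pos: "smooth_abs \<delta> c k > 0"
  using \<delta> by (simp add: smooth_abs_def add_nonneg_pos)

lemma smooth_abs_sq: "(smooth_abs \<delta> c k)\<^sup>2 = (k - c)\<^sup>2 + \<delta>\<^sup>2"
  by (simp add: smooth_abs_def)

lemma smooth_abs_ge: "\<bar>k - c\<bar> \<le> smooth_abs \<delta> c k" "\<delta> \<le> smooth_abs \<delta> c k" "smooth_abs \<delta> c k \<le> \<bar>k - c\<bar> + \<delta>"
proof -
  show "\<bar>k - c\<bar> \<le> smooth_abs \<delta> c k" unfolding smooth_abs_def by (rule real_le_rsqrt) simp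
  show "\<delta> \<le> smooth_abs \<delta> c k" unfolding smooth_abs_def by (rule real_le_rsqrt) simp
  show "smooth_abs \<delta> c k \<le> \<bar>k - c\<bar> + \<delta>"
    unfolding smooth_abs_def using \<delta> by (intro real_le_lsqrt) (auto simp: power2_eq_square algebra_simps)
qed

lemma DERIV_smooth_abs: "(smooth_abs \<delta> c has_real_derivative smooth_abs1 \<delta> c k) (at k)"
proof -
  have "(k - c)\<^sup>2 + \<delta>\<^sup>2 > 0" using \<delta> by (simp add: add_nonneg_pos)
  moreover have aux: "(k * 2 - c * 2) / (2 * s) = (k - c) / s" for s :: real by (simp add: diff_divide_distrib)
  ultimately show ?thesis unfolding smooth_abs_def[abs_def] smooth_abs1_def
    by (auto intro!: derivative_eq_intros simp: field_simps; simp only: aux)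
qed

lemma DERIV_smooth_abs1: "(smooth_abs1 \<delta> c has_real_derivative smooth_abs2 \<delta> c k) (at k)"
proof -
  have p: "smooth_abs \<delta> c k \<noteq> 0" using smooth_abs_pos[of c k] by simp
  have "((\<lambda>k. (k - c) / smooth_abs \<delta> c k) has_real_derivative (1 * smooth_abs \<delta> c k - (k - c) * smooth_abs1 \<delta> c k) / (smooth_abs \<delta> c k * smooth_abs \<delta> c k)) (at k)"
    by (rule DERIV_divide[OF _ DERIV_smooth_abs p]) (auto intro!: derivative_eq_intros)
  moreover have "(1 * smooth_abs \<delta> c k - (k - c) * smooth_abs1 \<delta> c k) / (smooth_abs \<delta> c k * smooth_abs \<delta> c k) = ((smooth_abs \<delta> c k)\<^sup>2 - (k - c)\<^sup>2) / smooth_abs \<delta> c k ^ 3"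
    using p by (simp add: smooth_abs1_def field_simps power2_eq_square power3_eq_cube)
  ultimately show ?thesis by (simp add: smooth_abs1_def[abs_def] smooth_abs2_def smooth_abs_sq)
qed

lemma smooth_abs2_nonneg: "0 \<le> smooth_abs2 \<delta> c k"
  using smooth_abs_pos[of c k] by (simp add: smooth_abs2_def)

lemma continuous_smooth_abs2: "continuous_on UNIV (smooth_abs2 \<delta> c)"
proof -
  have "smooth_abs \<delta> c k \<noteq> 0" for k using smooth_abs_pos[of c k] by simp
  then show ?thesis unfolding smooth_abs2_def[abs_def]
    by (intro continuous_intros) (auto simp: smooth_abs_def[abs_def] intro!: continuous_intros)
qed

lemma abs_smooth_abs1_le: "\<bar>smooth_abs1 \<delta> c k\<bar> \<le> 1"
  using smooth_abs_ge(1)[of k c] smooth_abs_pos[of c k] by (simp add: smooth_abs1_def abs_divide)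

lemma smooth_abs1_center [simp]: "smooth_abs1 \<delta> c c = 0"
  by (simp add: smooth_abs1_def)

text \<open>Quantifies the concentration at \<open>c\<close>: under a quadratic weight, states away
  from \<open>c\<close> contribute at most a multiple of \<delta>.\<close>

lemma smooth_abs2_sq_le: "smooth_abs2 \<delta> c k * (k - c)\<^sup>2 \<le> \<delta>"
proof -
  have "\<delta>\<^sup>2 * (k - c)\<^sup>2 \<le> (\<delta> * smooth_abs \<delta> c k) * (smooth_abs \<delta> c k)\<^sup>2"
    using \<delta> smooth_abs_ge(2)[of c k] by (intro mult_mono) (auto simp: smooth_abs_sq power2_eq_square[of \<delta>])
  then show ?thesis using \<delta> smooth_abs_pos[of c k]
    by (simp add: smooth_abs2_def field_simps power2_eq_square power3_eq_cube)
qed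

lemma convex_smooth_abs: "convex_on UNIV (smooth_abs \<delta> c)"
  by (rule f''_ge0_imp_convex[where f' = "smooth_abs1 \<delta> c" and f'' = "smooth_abs2 \<delta> c"])
    (auto intro: DERIV_smooth_abs DERIV_smooth_abs1 smooth_abs2_nonneg)

lemma deriv_smooth_abs: "deriv (smooth_abs \<delta> c) = smooth_abs1 \<delta> c" "deriv (smooth_abs1 \<delta> c) = smooth_abs2 \<delta> c"
  using DERIV_smooth_abs DERIV_smooth_abs1 by (auto intro!: ext DERIV_imp_deriv)

lemma C2_smooth_abs: "C2 (smooth_abs \<delta> c)"
  unfolding C2_def deriv_smooth_abs
  using DERIV_smooth_abs DERIV_smooth_abs1 continuous_smooth_abs2 real_differentiable_def by blast

lemma integral_sgn_ind_smooth_abs2: "(\<integral>w. sgn_ind c k w * smooth_abs2 \<delta> c w \<partial>lborel) = smooth_abs1 \<delta> c k"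
proof -
  have "\<exists>L. L-lipschitz_on {a..b} (\<lambda>w::real. 1::real)" for a b
    by (intro exI[of _ 0] lipschitz_on_constant)
  from integral_by_parts_sgn_ind[OF this DERIV_smooth_abs1 continuous_smooth_abs2, of c k c]
  show ?thesis by simp
qed

text \<open>The interval between \<open>c\<close> and \<open>k\<close> lies on one side of
  \<open>c\<close> and sees at most half of the total mass 2.\<close>

lemma integral_abs_sgn_ind_smooth_abs2: "(\<integral>w. \<bar>sgn_ind c k w\<bar> * smooth_abs2 \<delta> c w \<partial>lborel) \<le> 1"
proof (cases "c \<le> k")
  case True
  then have "\<bar>sgn_ind c k w\<bar> = sgn_ind c k w" for w by (auto simp: sgn_ind_def indicator_def)
  then show ?thesis using integral_sgn_ind_smooth_abs2[of c k] abs_smooth_abs1_le[of c k] by simp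
next
  case False
  then have "\<bar>sgn_ind c k w\<bar> = - sgn_ind c k w" for w by (auto simp: sgn_ind_def indicator_def)
  then show ?thesis using integral_sgn_ind_smooth_abs2[of c k] abs_smooth_abs1_le[of c k] by simp
qed

text \<open>The signed integral of \<open>smooth_abs2 \<delta> c\<close> times \<open>h\<close> from
  \<open>c\<close> to \<open>k\<close>. Integration by parts of the entropy flux produces it, with
  \<open>h\<close> the flux, its differential or its divergence at a fixed point.\<close>

definition smear :: "real \<Rightarrow> real \<Rightarrow> (real \<Rightarrow> 'c::euclidean_space) \<Rightarrow> 'c" where
  "smear c k h = (\<integral>w. sgn_ind c k w *\<^sub>R (smooth_abs2 \<delta> c w *\<^sub>R h w) \<partial>lborel)"

lemma integrable_smear:
  "continuous_on UNIV (h :: real \<Rightarrow> 'c::euclidean_space) \<Longrightarrow> integrable lborel (\<lambda>w. sgn_ind c k w *\<^sub>R (smooth_abs2 \<delta> c w *\<^sub>R h w))"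
  by (intro integrable_sgn_ind continuous_intros continuous_smooth_abs2)

text \<open>The constant \<open>A\<close> is multiplied by a mass of at most 1, the quadratic part
  by \<delta> and the interval length. With \<open>K = 0\<close> this is a plain sup bound; the
  quadratic part serves the limit \<delta> \<rightarrow> 0.\<close>

lemma norm_smear_le:
  fixes h :: "real \<Rightarrow> 'c::euclidean_space"
  assumes h: "continuous_on UNIV h" and b: "\<And>w. min c k < w \<Longrightarrow> w < max c k \<Longrightarrow> norm (h w) \<le> A + K * (w - c)\<^sup>2"
    and A: "A \<ge> 0" "K \<ge> 0"
  shows "norm (smear c k h) \<le> A + K * \<delta> * \<bar>k - c\<bar>"
proof -
  have i1: "integrable lborel (\<lambda>w. sgn_ind c k w * smooth_abs2 \<delta> c w)" "integrable lborel (\<lambda>w. sgn_ind c k w * 1)"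
    using integrable_sgn_ind[OF continuous_smooth_abs2] integrable_sgn_ind[of "\<lambda>_. 1 :: real"] by simp_all
  have i2: "integrable lborel (\<lambda>w. \<bar>sgn_ind c k w\<bar> * smooth_abs2 \<delta> c w)" "integrable lborel (\<lambda>w. \<bar>sgn_ind c k w\<bar>)"
    using integrable_abs[OF i1(1)] integrable_abs[OF i1(2)] smooth_abs2_nonneg by (simp_all add: abs_mult)
  have "norm (smear c k h) \<le> (\<integral>w. norm (sgn_ind c k w *\<^sub>R (smooth_abs2 \<delta> c w *\<^sub>R h w)) \<partial>lborel)"
    unfolding smear_def by (rule integral_norm_bound)
  also have "\<dots> \<le> (\<integral>w. A * (\<bar>sgn_ind c k w\<bar> * smooth_abs2 \<delta> c w) + K * \<delta> * \<bar>sgn_ind c k w\<bar> \<partial>lborel)"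
  proof (intro integral_mono integrable_norm integrable_smear h Bochner_Integration.integrable_add integrable_mult_right i2)
    fix w
    show "norm (sgn_ind c k w *\<^sub>R (smooth_abs2 \<delta> c w *\<^sub>R h w)) \<le> A * (\<bar>sgn_ind c k w\<bar> * smooth_abs2 \<delta> c w) + K * \<delta> * \<bar>sgn_ind c k w\<bar>"
    proof (cases "min c k < w \<and> w < max c k")
      case True
      then have s: "\<bar>sgn_ind c k w\<bar> = 1" by (simp add: abs_sgn_ind)
      have "smooth_abs2 \<delta> c w * norm (h w) \<le> smooth_abs2 \<delta> c w * (A + K * (w - c)\<^sup>2)"
        using b True by (intro mult_left_mono smooth_abs2_nonneg) auto
      also have "\<dots> = A * smooth_abs2 \<delta> c w + K * (smooth_abs2 \<delta> c w * (w - c)\<^sup>2)" by (simp add: algebra_simps)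
      also have "\<dots> \<le> A * smooth_abs2 \<delta> c w + K * \<delta>" using A by (intro add_left_mono mult_left_mono smooth_abs2_sq_le)
      finally show ?thesis using s smooth_abs2_nonneg[of c w] by (simp add: abs_mult)
    next
      case False
      then have "sgn_ind c k w = 0" using abs_sgn_ind[of c k w] by (auto simp: indicator_def)
      then show ?thesis by simp
    qed
  qed
  also have "\<dots> = A * (\<integral>w. \<bar>sgn_ind c k w\<bar> * smooth_abs2 \<delta> c w \<partial>lborel) + K * \<delta> * (\<integral>w. \<bar>sgn_ind c k w\<bar> \<partial>lborel)"
    using i2 by simp
  also have "\<dots> \<le> A * 1 + K * \<delta> * \<bar>k - c\<bar>"
  proof (intro add_mono mult_left_mono integral_abs_sgn_ind_smooth_abs2)
    show "(\<integral>w. \<bar>sgn_ind c k w\<bar> \<partial>lborel) \<le> \<bar>k - c\<bar>" by (simp add: abs_sgn_ind)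
  qed (use A \<delta> in auto)
  finally show ?thesis by simp
qed

end

lemma smooth_abs1_tendsto: "(\<lambda>n. smooth_abs1 (inverse (real (Suc n))) c k) \<longlonglongrightarrow> sgn (k - c)"
proof (cases "k = c")
  case False
  have "(\<lambda>n. (k - c) / sqrt ((k - c)\<^sup>2 + (inverse (real (Suc n)))\<^sup>2)) \<longlonglongrightarrow> (k - c) / sqrt ((k - c)\<^sup>2 + 0\<^sup>2)"
    by (intro tendsto_intros LIMSEQ_inverse_real_of_nat) (use False in auto)
  moreover have "(k - c) / sqrt ((k - c)\<^sup>2 + 0\<^sup>2) = sgn (k - c)" by (simp add: real_sgn_eq)
  ultimately show ?thesis by (simp only: smooth_abs1_def smooth_abs_def)
qed (simp add: smooth_abs1_def)

lemma smooth_abs_tendsto: "(\<lambda>n. smooth_abs (inverse (real (Suc n))) c k) \<longlonglongrightarrow> \<bar>k - c\<bar>"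
proof -
  have "(\<lambda>n. sqrt ((k - c)\<^sup>2 + (inverse (real (Suc n)))\<^sup>2)) \<longlonglongrightarrow> sqrt ((k - c)\<^sup>2 + 0\<^sup>2)"
    by (intro tendsto_intros LIMSEQ_inverse_real_of_nat)
  then show ?thesis by (simp add: smooth_abs_def)
qed

lemma smear_tendsto:
  fixes h :: "real \<Rightarrow> 'c::euclidean_space"
  assumes h: "continuous_on UNIV h"
  shows "(\<lambda>n. smear (inverse (real (Suc n))) c k h) \<longlonglongrightarrow> sgn (k - c) *\<^sub>R h c"
proof -
  let ?d = "\<lambda>n. inverse (real (Suc n))"
  have dpos: "?d n > 0" for n by simp
  \<comment> \<open>Subtracting \<open>h c\<close> leaves an integrand that is small where the mass
    concentrates; the coefficient of \<open>h c\<close> is \<open>smooth_abs1\<close>, which tends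
    to the sign.\<close>
  have split: "smear (?d n) c k h = smooth_abs1 (?d n) c k *\<^sub>R h c + smear (?d n) c k (\<lambda>w. h w - h c)" for n
  proof -
    have hd: "continuous_on UNIV (\<lambda>w. h w - h c)" by (intro continuous_intros h)
    have "smear (?d n) c k h = (\<integral>w. (sgn_ind c k w * smooth_abs2 (?d n) c w) *\<^sub>R h c + sgn_ind c k w *\<^sub>R (smooth_abs2 (?d n) c w *\<^sub>R (h w - h c)) \<partial>lborel)"
      unfolding smear_def[OF dpos] by (rule Bochner_Integration.integral_cong) (simp_all add: algebra_simps)
    also have "\<dots> = (\<integral>w. (sgn_ind c k w * smooth_abs2 (?d n) c w) *\<^sub>R h c \<partial>lborel) + smear (?d n) c k (\<lambda>w. h w - h c)"
      unfolding smear_def[OF dpos]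
    proof (rule Bochner_Integration.integral_add)
      show "integrable lborel (\<lambda>w. (sgn_ind c k w * smooth_abs2 (?d n) c w) *\<^sub>R h c)"
        using integrable_sgn_ind[OF continuous_smooth_abs2[OF dpos], of c k n c] by (intro integrable_scaleR_left) simp
    qed (rule integrable_smear[OF dpos hd])
    also have "(\<integral>w. (sgn_ind c k w * smooth_abs2 (?d n) c w) *\<^sub>R h c \<partial>lborel) = smooth_abs1 (?d n) c k *\<^sub>R h c"
      using integrable_sgn_ind[OF continuous_smooth_abs2[OF dpos], of c k n c]
      by (subst integral_scaleR_left) (simp_all add: integral_sgn_ind_smooth_abs2[OF dpos] del: of_nat_Suc)
    finally show ?thesis .
  qed
  have "(\<lambda>n. smear (?d n) c k (\<lambda>w. h w - h c)) \<longlonglongrightarrow> 0"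
  proof (rule LIMSEQ_I)
    fix e :: real assume e: "e > 0"
    have "isCont h c" using h by (simp add: continuous_on_eq_continuous_at)
    then obtain r where r: "r > 0" "\<And>w. \<bar>w - c\<bar> < r \<Longrightarrow> norm (h w - h c) < e / 2"
      unfolding continuous_at_eps_delta dist_real_def dist_norm by (meson half_gt_zero e)
    let ?S = "cball c \<bar>k - c\<bar>"
    have "bounded ((\<lambda>w. h w - h c) ` ?S)"
      by (intro compact_imp_bounded compact_continuous_image continuous_intros continuous_on_subset[OF h]) auto
    then obtain M where M: "\<forall>w\<in>?S. norm (h w - h c) \<le> M" unfolding bounded_iff by auto
    have M0: "M \<ge> 0" using M by (metis abs_ge_zero centre_in_cball norm_ge_zero order_trans)
    \<comment> \<open>Within distance \<open>r\<close> continuity gives e / 2; beyond it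
      \<open>M / r\<^sup>2 * (w - c)\<^sup>2\<close> is at least the bound \<open>M\<close>.\<close>
    have est: "norm (h w - h c) \<le> e / 2 + M / r\<^sup>2 * (w - c)\<^sup>2" if "min c k < w" "w < max c k" for w
    proof (cases "\<bar>w - c\<bar> < r")
      case True
      then show ?thesis using r(2)[OF True] M0 by (simp add: add_increasing2 less_imp_le)
    next
      case False
      then have "r\<^sup>2 \<le> (w - c)\<^sup>2" using r(1) by (simp add: abs_le_square_iff[symmetric])
      then have "M \<le> M / r\<^sup>2 * (w - c)\<^sup>2" using r(1) M0 by (simp add: pos_le_divide_eq mult_left_mono)
      moreover have "norm (h w - h c) \<le> M" using that M by (auto simp: dist_real_def min_def max_def split: if_splits)
      ultimately show ?thesis using e by simp
    qed
    let ?C = "M / r\<^sup>2 * \<bar>k - c\<bar>"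
    have C0: "?C \<ge> 0" using M0 by simp
    have bound: "norm (smear (?d n) c k (\<lambda>w. h w - h c)) \<le> e / 2 + ?C * ?d n" for n
    proof -
      have "norm (smear (?d n) c k (\<lambda>w. h w - h c)) \<le> e / 2 + M / r\<^sup>2 * ?d n * \<bar>k - c\<bar>"
        by (rule norm_smear_le[OF dpos _ est]) (use e M0 in \<open>auto intro!: continuous_intros h\<close>)
      then show ?thesis by (simp add: mult_ac)
    qed
    have "(\<lambda>n. ?C * ?d n) \<longlonglongrightarrow> ?C * 0" by (intro tendsto_intros LIMSEQ_inverse_real_of_nat)
    from LIMSEQ_D[OF this, of "e / 2"] e obtain no where no: "\<And>n. n \<ge> no \<Longrightarrow> norm (?C * ?d n - ?C * 0) < e / 2" by auto
    have "norm (smear (?d n) c k (\<lambda>w. h w - h c) - 0) < e" if "n \<ge> no" for n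
    proof -
      have "?C * ?d n \<le> norm (?C * ?d n - ?C * 0)" unfolding real_norm_def mult_zero_right diff_zero by (rule abs_ge_self)
      then show ?thesis using no[OF that] bound[of n] unfolding diff_zero by linarith
    qed
    then show "\<exists>no. \<forall>n\<ge>no. norm (smear (?d n) c k (\<lambda>w. h w - h c) - 0) < e" by blast
  qed
  then have "(\<lambda>n. smooth_abs1 (?d n) c k *\<^sub>R h c + smear (?d n) c k (\<lambda>w. h w - h c)) \<longlonglongrightarrow> sgn (k - c) *\<^sub>R h c + 0"
    by (intro tendsto_intros smooth_abs1_tendsto)
  then show ?thesis unfolding split by simp
qed

subsection \<open>Fluxes\<close>

lemma borel_measurable_fst_snd [measurable (raw)]:
  fixes h :: "'b \<Rightarrow> 'c::euclidean_space \<times> 'd::euclidean_space"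
  assumes "h \<in> borel_measurable M"
  shows "(\<lambda>x. fst (h x)) \<in> borel_measurable M" "(\<lambda>x. snd (h x)) \<in> borel_measurable M"
  by (rule measurable_compose[OF assms borel_measurable_continuous_onI]; intro continuous_intros)+

text \<open>The flux assumption in epsilon-delta form. \<open>N\<close> will be a Borel null set
  containing the bad points, and \<open>D\<close> is 0 there so that it is linear, continuous in the
  state and Borel without exceptions. One \<open>d\<close> in \<open>D_approx\<close> serves all
  bounded states, so the state may later vary along the limit.\<close>

locale flux =
  fixes f :: "'a::euclidean_space \<Rightarrow> real \<Rightarrow> 'a" and D :: "'a \<Rightarrow> real \<Rightarrow> 'a \<Rightarrow> 'a" and N :: "'a set"
  assumes f_lip: "\<exists>L\<ge>0. \<forall>x y k l. norm x \<le> R \<and> norm y \<le> R \<and> \<bar>k\<bar> \<le> R \<and> \<bar>l\<bar> \<le> R \<longrightarrow>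
      norm (f x k - f y l) \<le> L * (norm (x - y) + \<bar>k - l\<bar>)"
    and N_null: "N \<in> null_sets lborel"
    and D_N: "x \<in> N \<Longrightarrow> D x k v = 0"
    and D_linear: "linear (D x k)"
    and D_cont: "continuous_on UNIV (\<lambda>k. D x k v)"
    and D_approx: "x \<notin> N \<Longrightarrow> e > 0 \<Longrightarrow> \<exists>d>0. \<forall>y k. \<bar>k\<bar> \<le> R \<and> norm (y - x) < d \<longrightarrow>
      norm (f y k - f x k - D x k (y - x)) \<le> e * norm (y - x)"
begin

definition div_f :: "'a \<Rightarrow> real \<Rightarrow> real" where
  "div_f x k = (\<Sum>b\<in>Basis. D x k b \<bullet> b)"

lemma f_continuous: "continuous_on UNIV (\<lambda>z. f (fst z) (snd z))"
proof -
  have "isCont (\<lambda>z. f (fst z) (snd z)) (x, k)" for x k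
  proof -
    let ?R = "norm x + \<bar>k\<bar> + 1"
    obtain L where L: "L \<ge> 0" "\<forall>y z l m. norm y \<le> ?R \<and> norm z \<le> ?R \<and> \<bar>l\<bar> \<le> ?R \<and> \<bar>m\<bar> \<le> ?R \<longrightarrow>
      norm (f y l - f z m) \<le> L * (norm (y - z) + \<bar>l - m\<bar>)" using f_lip by blast
    have "((\<lambda>z. f (fst z) (snd z) - f x k) \<longlongrightarrow> 0) (at (x, k))"
    proof (rule Lim_null_comparison)
      have "\<forall>\<^sub>F z in at (x, k). dist z (x, k) < 1" by (rule eventually_at_ball'[THEN eventually_mono]) (auto simp: dist_commute)
      then show "\<forall>\<^sub>F z in at (x, k). norm (f (fst z) (snd z) - f x k) \<le> L * (norm (fst z - x) + \<bar>snd z - k\<bar>)"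
      proof eventually_elim
        case (elim z)
        have "dist (fst z) x \<le> dist z (x, k)" "dist (snd z) k \<le> dist z (x, k)"
          using dist_fst_le[of z "(x, k)"] dist_snd_le[of z "(x, k)"] by simp_all
        with elim have "dist (fst z) x < 1" "dist (snd z) k < 1" by linarith+
        moreover have "norm (fst z) \<le> norm x + dist (fst z) x" by (simp add: dist_norm norm_triangle_sub)
        ultimately have "norm (fst z) \<le> ?R" "\<bar>snd z\<bar> \<le> ?R" "norm x \<le> ?R" "\<bar>k\<bar> \<le> ?R"
          using norm_ge_zero[of x] unfolding dist_real_def by linarith+
        with L(2) show ?case by blast
      qed
      have "((\<lambda>z. L * (norm (fst z - x) + \<bar>snd z - k\<bar>)) \<longlongrightarrow> L * (norm (fst (x, k) - x) + \<bar>snd (x, k) - k\<bar>)) (at (x, k))"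
        by (intro tendsto_intros tendsto_ident_at)
      then show "((\<lambda>z. L * (norm (fst z - x) + \<bar>snd z - k\<bar>)) \<longlongrightarrow> 0) (at (x, k))" by simp
    qed
    then show ?thesis unfolding isCont_def by (simp add: LIM_zero_iff)
  qed
  then show ?thesis by (auto simp: continuous_on_eq_continuous_at)
qed

lemma f_continuous_right: "continuous_on UNIV (f x)"
  using continuous_on_compose2[OF f_continuous, of UNIV "\<lambda>k. (x, k)"] by (simp add: continuous_intros)

lemma f_borel [measurable (raw)]:
  assumes [measurable]: "a \<in> borel_measurable M" "b \<in> borel_measurable M"
  shows "(\<lambda>z. f (a z) (b z)) \<in> borel_measurable M"
  by (rule borel_measurable_continuous_Pair[OF assms f_continuous])

lemma f_has_derivative:
  assumes "x \<notin> N" shows "((\<lambda>y. f y k) has_derivative D x k) (at x)"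
  unfolding has_derivative_at_alt
proof (intro conjI allI impI)
  show "bounded_linear (D x k)" using D_linear by (simp add: linear_conv_bounded_linear)
  fix e :: real assume "e > 0"
  from D_approx[OF assms this, of "\<bar>k\<bar>"]
  show "\<exists>d>0. \<forall>y. norm (y - x) < d \<longrightarrow> norm (f y k - f x k - D x k (y - x)) \<le> e * norm (y - x)" by blast
qed

lemma f_quotient_tendsto:
  assumes "x \<notin> N"
  shows "(\<lambda>n. (f (x + inverse (real (Suc n)) *\<^sub>R v) k - f x k) /\<^sub>R inverse (real (Suc n))) \<longlonglongrightarrow> D x k v"
proof -
  have "((\<lambda>s. f (x + s *\<^sub>R v) k) has_derivative (\<lambda>s. D x k (s *\<^sub>R v))) (at 0)"
    by (rule has_derivative_compose[where g = "\<lambda>y. f y k" and f = "\<lambda>s. x + s *\<^sub>R v" and f' = "\<lambda>s. s *\<^sub>R v"])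
      (auto intro!: derivative_eq_intros f_has_derivative assms)
  then have "((\<lambda>s. norm (f (x + s *\<^sub>R v) k - f x k - s *\<^sub>R D x k v) / norm s) \<longlongrightarrow> 0) (at 0)"
    by (simp add: has_derivative_at linear_scale[OF D_linear])
  then have "((\<lambda>s. norm ((f (x + s *\<^sub>R v) k - f x k) /\<^sub>R s - D x k v)) \<longlongrightarrow> 0) (at 0)"
  proof (rule Lim_transform_eventually)
    show "\<forall>\<^sub>F s in at 0. norm (f (x + s *\<^sub>R v) k - f x k - s *\<^sub>R D x k v) / norm s
        = norm ((f (x + s *\<^sub>R v) k - f x k) /\<^sub>R s - D x k v)"
    proof (rule eventually_mono[OF eventually_neq_at_within])
      fix s :: real assume s: "s \<noteq> 0"
      have "(f (x + s *\<^sub>R v) k - f x k) /\<^sub>R s - D x k v = (f (x + s *\<^sub>R v) k - f x k - s *\<^sub>R D x k v) /\<^sub>R s"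
        using s by (simp add: scaleR_diff_right)
      then show "norm (f (x + s *\<^sub>R v) k - f x k - s *\<^sub>R D x k v) / norm s
        = norm ((f (x + s *\<^sub>R v) k - f x k) /\<^sub>R s - D x k v)" by (simp add: divide_inverse mult.commute)
    qed
  qed
  then have "((\<lambda>s. (f (x + s *\<^sub>R v) k - f x k) /\<^sub>R s) \<longlongrightarrow> D x k v) (at 0)"
    by (rule LIM_zero_cancel[OF tendsto_norm_zero_cancel])
  from this[unfolded tendsto_at_iff_sequentially, rule_format, of "\<lambda>n. inverse (real (Suc n))"]
  show ?thesis using LIMSEQ_inverse_real_of_nat by (simp add: o_def del: of_nat_Suc)
qed

lemma NxUNIV_null: "N \<times> (UNIV :: real set) \<in> null_sets lborel"
proof -
  have "N \<in> sets lborel" using N_null by auto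
  then have "emeasure (lborel \<Otimes>\<^sub>M lborel) (N \<times> (UNIV :: real set)) = emeasure lborel N * emeasure lborel (UNIV :: real set)"
    by (intro lborel.emeasure_pair_measure_Times) auto
  also have "\<dots> = 0" using N_null by auto
  finally show ?thesis using \<open>N \<in> sets lborel\<close> unfolding lborel_prod
    by (intro null_setsI) (auto simp: borel_Times)
qed

text \<open>Off the null cylinder over \<open>N\<close> it is a limit of continuous quotients, on
  the cylinder it vanishes. Joint measurability matters because the state will be a measurable
  function of the point.\<close>

lemma D_borel_pair: "(\<lambda>z. D (fst z) (snd z) v) \<in> borel_measurable borel"
proof -
  let ?q = "\<lambda>n z. (f (fst z + inverse (real (Suc n)) *\<^sub>R v) (snd z) - f (fst z) (snd z)) /\<^sub>R inverse (real (Suc n))"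
  have "(\<lambda>z. if z \<in> N \<times> UNIV then 0 else D (fst z) (snd z) v) \<in> borel_measurable borel"
  proof (rule borel_measurable_limit_off_null[OF NxUNIV_null])
    show "?q n \<in> borel_measurable borel" for n by measurable
    show "(\<lambda>n. ?q n z) \<longlonglongrightarrow> D (fst z) (snd z) v" if "z \<notin> N \<times> UNIV" for z
      using that by (intro f_quotient_tendsto) (auto simp: mem_Times_iff)
  qed
  moreover have "(\<lambda>z. if z \<in> N \<times> UNIV then 0 else D (fst z) (snd z) v) = (\<lambda>z. D (fst z) (snd z) v)"
    by (auto simp: D_N mem_Times_iff)
  ultimately show ?thesis by simp
qed

lemma D_borel_Basis [measurable (raw)]:
  assumes [measurable]: "a \<in> borel_measurable M" "b \<in> borel_measurable M"
  shows "(\<lambda>z. D (a z) (b z) v) \<in> borel_measurable M"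
  using measurable_compose[OF borel_measurable_Pair[OF assms] D_borel_pair] by simp

lemma div_f_borel [measurable (raw)]:
  assumes [measurable]: "a \<in> borel_measurable M" "b \<in> borel_measurable M"
  shows "(\<lambda>z. div_f (a z) (b z)) \<in> borel_measurable M"
  unfolding div_f_def by measurable

lemma div_f_continuous: "continuous_on UNIV (div_f x)"
  unfolding div_f_def[abs_def] by (intro continuous_intros D_cont)

text \<open>The local Lipschitz bound passes to the limit of quotients; it is taken on radius
  \<open>R + 1\<close> so that increments shorter than 1 stay inside.\<close>

lemma D_bound:
  "\<exists>L\<ge>0. \<forall>x k v. norm x \<le> R \<and> \<bar>k\<bar> \<le> R \<longrightarrow> norm (D x k v) \<le> L * norm v"
proof -
  obtain L where L: "L \<ge> 0" "\<forall>x y k l. norm x \<le> R + 1 \<and> norm y \<le> R + 1 \<and> \<bar>k\<bar> \<le> R + 1 \<and> \<bar>l\<bar> \<le> R + 1 \<longrightarrow>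
      norm (f x k - f y l) \<le> L * (norm (x - y) + \<bar>k - l\<bar>)" using f_lip by blast
  have "norm (D x k v) \<le> L * norm v" if "norm x \<le> R" "\<bar>k\<bar> \<le> R" for x k v
  proof (cases "x \<in> N")
    case False
    let ?s = "\<lambda>n. inverse (real (Suc n))"
    have sv: "(\<lambda>n. ?s n *\<^sub>R v) \<longlonglongrightarrow> 0"
      using tendsto_scaleR[OF LIMSEQ_inverse_real_of_nat tendsto_const[of v]] by simp
    have "\<forall>\<^sub>F n in sequentially. norm (?s n *\<^sub>R v) < 1"
      using tendstoD[OF sv, of 1] by (simp add: dist_norm)
    then have "\<forall>\<^sub>F n in sequentially. norm ((f (x + ?s n *\<^sub>R v) k - f x k) /\<^sub>R ?s n) \<le> L * norm v"
    proof eventually_elim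
      case (elim n)
      have "norm (x + ?s n *\<^sub>R v) \<le> R + 1" using that elim norm_triangle_ineq[of x "?s n *\<^sub>R v"] by linarith
      then have "norm (f (x + ?s n *\<^sub>R v) k - f x k) \<le> L * (norm (x + ?s n *\<^sub>R v - x) + \<bar>k - k\<bar>)"
        using that by (intro L(2)[rule_format]) auto
      also have "\<dots> = ?s n * (L * norm v)" by (simp del: of_nat_Suc)
      finally have "inverse (?s n) * norm (f (x + ?s n *\<^sub>R v) k - f x k) \<le> inverse (?s n) * (?s n * (L * norm v))"
        by (intro mult_left_mono) auto
      also have "\<dots> = L * norm v" by (simp del: of_nat_Suc)
      finally show ?case by (simp del: of_nat_Suc)
    qed
    then show ?thesis
      by (intro tendsto_upperbound[OF tendsto_norm[OF f_quotient_tendsto[OF False]]]) auto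
  qed (use L in \<open>simp add: D_N\<close>)
  with L(1) show ?thesis by blast
qed

lemma div_f_bound: "\<exists>B\<ge>0. \<forall>x k. norm x \<le> R \<and> \<bar>k\<bar> \<le> R \<longrightarrow> \<bar>div_f x k\<bar> \<le> B"
proof -
  obtain L where L: "L \<ge> 0" "\<forall>x k v. norm x \<le> R \<and> \<bar>k\<bar> \<le> R \<longrightarrow> norm (D x k v) \<le> L * norm v" using D_bound by blast
  have "\<bar>div_f x k\<bar> \<le> (\<Sum>b\<in>(Basis :: 'a set). L)" if "norm x \<le> R" "\<bar>k\<bar> \<le> R" for x k
    unfolding div_f_def
  proof (rule order_trans[OF sum_abs sum_mono])
    fix b :: 'a assume b: "b \<in> Basis"
    have "\<bar>D x k b \<bullet> b\<bar> \<le> norm (D x k b)" by (rule Basis_le_norm[OF b])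
    also have "\<dots> \<le> L * norm b" using L that by blast
    finally show "\<bar>D x k b \<bullet> b\<bar> \<le> L" using b by simp
  qed
  then show ?thesis using L(1) by (intro exI[of _ "\<Sum>b\<in>(Basis :: 'a set). L"]) (auto intro: sum_nonneg)
qed

lemma f_bound: "\<exists>B\<ge>0. \<forall>x k. norm x \<le> R \<and> \<bar>k\<bar> \<le> R \<longrightarrow> norm (f x k) \<le> B"
proof -
  have "bounded ((\<lambda>z. f (fst z) (snd z)) ` (cball 0 R \<times> cball 0 R))"
    by (intro compact_imp_bounded compact_continuous_image compact_Times continuous_on_subset[OF f_continuous]) auto
  then obtain B where B: "\<forall>z\<in>cball 0 R \<times> cball 0 R. norm (f (fst z) (snd z)) \<le> B"
    unfolding bounded_iff by auto
  have "norm (f x k) \<le> \<bar>B\<bar>" if "norm x \<le> R" "\<bar>k\<bar> \<le> R" for x k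
    using B[rule_format, of "(x, k)"] that by auto
  then show ?thesis by (intro exI[of _ "\<bar>B\<bar>"]) auto
qed

text \<open>The entropy flux for the entropy \<open>smooth_abs \<delta> c\<close>, normalised to vanish at \<open>c\<close>, after integration
  by parts.\<close>

lemma entropy_flux_has_derivative:
  assumes \<delta>: "\<delta> > 0" and x: "x \<notin> N"
  shows "((\<lambda>y. smooth_abs1 \<delta> c k *\<^sub>R f y k - smear \<delta> c k (f y)) has_derivative
    (\<lambda>v. smooth_abs1 \<delta> c k *\<^sub>R D x k v - smear \<delta> c k (\<lambda>w. D x w v))) (at x)"
proof -
  have "((\<lambda>y. smear \<delta> c k (f y)) has_derivative (\<lambda>v. smear \<delta> c k (\<lambda>w. D x w v))) (at x)"
    unfolding has_derivative_at_alt
  proof (intro conjI allI impI)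
    have add: "smear \<delta> c k (\<lambda>w. h w + h' w) = smear \<delta> c k h + smear \<delta> c k h'"
      if "continuous_on UNIV h" "continuous_on UNIV h'" for h h' :: "real \<Rightarrow> 'a"
      unfolding smear_def[OF \<delta>] scaleR_add_right
      by (intro Bochner_Integration.integral_add integrable_smear \<delta> that)
    have diff: "smear \<delta> c k (\<lambda>w. h w - h' w) = smear \<delta> c k h - smear \<delta> c k h'"
      if "continuous_on UNIV h" "continuous_on UNIV h'" for h h' :: "real \<Rightarrow> 'a"
      unfolding smear_def[OF \<delta>] scaleR_diff_right
      by (intro Bochner_Integration.integral_diff integrable_smear \<delta> that)
    have "linear (\<lambda>v. smear \<delta> c k (\<lambda>w. D x w v))"
    proof (rule linearI)
      show "smear \<delta> c k (\<lambda>w. D x w (u + v)) = smear \<delta> c k (\<lambda>w. D x w u) + smear \<delta> c k (\<lambda>w. D x w v)" for u v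
        unfolding linear_add[OF D_linear] by (rule add) (rule D_cont)+
      show "smear \<delta> c k (\<lambda>w. D x w (r *\<^sub>R v)) = r *\<^sub>R smear \<delta> c k (\<lambda>w. D x w v)" for r v
        unfolding linear_scale[OF D_linear] smear_def[OF \<delta>]
        by (subst Bochner_Integration.integral_scaleR_right[symmetric])
          (auto intro!: Bochner_Integration.integral_cong simp: mult_ac)
    qed
    then show "bounded_linear (\<lambda>v. smear \<delta> c k (\<lambda>w. D x w v))" by (simp add: linear_conv_bounded_linear)
    fix e :: real assume "e > 0"
    \<comment> \<open>All states in the smeared integral lie between \<open>c\<close> and
      \<open>k\<close>, so a single \<open>d\<close> serves them and differentiation passes under
      the integral.\<close>
    from D_approx[OF x this, of "max \<bar>c\<bar> \<bar>k\<bar>"] obtain d where d: "d > 0"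
      "\<forall>y l. \<bar>l\<bar> \<le> max \<bar>c\<bar> \<bar>k\<bar> \<and> norm (y - x) < d \<longrightarrow> norm (f y l - f x l - D x l (y - x)) \<le> e * norm (y - x)" by blast
    have "norm (smear \<delta> c k (f y) - smear \<delta> c k (f x) - smear \<delta> c k (\<lambda>w. D x w (y - x))) \<le> e * norm (y - x)"
      if "norm (y - x) < d" for y
    proof -
      have "smear \<delta> c k (f y) - smear \<delta> c k (f x) - smear \<delta> c k (\<lambda>w. D x w (y - x))
        = smear \<delta> c k (\<lambda>w. f y w - f x w - D x w (y - x))"
        unfolding diff[OF continuous_on_diff[OF f_continuous_right f_continuous_right] D_cont]
          diff[OF f_continuous_right f_continuous_right] ..
      also have "norm \<dots> \<le> e * norm (y - x) + 0 * \<delta> * \<bar>k - c\<bar>"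
      proof (rule norm_smear_le[OF \<delta>])
        show "continuous_on UNIV (\<lambda>w. f y w - f x w - D x w (y - x))"
          by (intro continuous_intros f_continuous_right D_cont)
        show "norm (f y w - f x w - D x w (y - x)) \<le> e * norm (y - x) + 0 * (w - c)\<^sup>2"
          if "min c k < w" "w < max c k" for w
          using d(2)[rule_format, of w y] that \<open>norm (y - x) < d\<close> by auto
      qed (use \<open>e > 0\<close> in auto)
      finally show ?thesis by simp
    qed
    with d(1) show "\<exists>d>0. \<forall>y. norm (y - x) < d \<longrightarrow>
      norm (smear \<delta> c k (f y) - smear \<delta> c k (f x) - smear \<delta> c k (\<lambda>w. D x w (y - x))) \<le> e * norm (y - x)" by blast
  qed
  then show ?thesis
    by (intro has_derivative_diff has_derivative_scaleR_right f_has_derivative x)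
qed

lemma divergence_f: "x \<notin> N \<Longrightarrow> divergence (\<lambda>y. f y k) x = div_f x k"
  unfolding divergence_def div_f_def using frechet_derivative_at[OF f_has_derivative] by metis

text \<open>The boundary term at \<open>k\<close> contributes exactly
  \<open>smooth_abs1 \<delta> c k * div_f x k\<close>, which the entropy inequality subtracts. The
  smeared divergence that remains becomes the source term with \<open>c\<close> frozen.\<close>

lemma divergence_entropy_flux:
  assumes \<delta>: "\<delta> > 0" and x: "x \<notin> N"
  shows "divergence (\<lambda>y. smooth_abs1 \<delta> c k *\<^sub>R f y k - smear \<delta> c k (f y)) x - smooth_abs1 \<delta> c k * divergence (\<lambda>y. f y k) x
    = - smear \<delta> c k (div_f x)"
proof -
  have "divergence (\<lambda>y. smooth_abs1 \<delta> c k *\<^sub>R f y k - smear \<delta> c k (f y)) x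
      = (\<Sum>b\<in>Basis. (smooth_abs1 \<delta> c k *\<^sub>R D x k b - smear \<delta> c k (\<lambda>w. D x w b)) \<bullet> b)"
    unfolding divergence_def frechet_derivative_at[OF entropy_flux_has_derivative[OF assms], symmetric] ..
  also have "\<dots> = smooth_abs1 \<delta> c k * div_f x k - (\<Sum>b\<in>Basis. smear \<delta> c k (\<lambda>w. D x w b) \<bullet> b)"
    by (simp add: inner_diff_left sum_subtractf div_f_def sum_distrib_left)
  also have "(\<Sum>b\<in>Basis. smear \<delta> c k (\<lambda>w. D x w b) \<bullet> b) = smear \<delta> c k (div_f x)"
  proof -
    have i: "integrable lborel (\<lambda>w. sgn_ind c k w *\<^sub>R (smooth_abs2 \<delta> c w *\<^sub>R D x w b))" for b
      by (rule integrable_smear[OF \<delta> D_cont])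
    have "(\<Sum>b\<in>Basis. smear \<delta> c k (\<lambda>w. D x w b) \<bullet> b)
      = (\<Sum>b\<in>Basis. \<integral>w. (sgn_ind c k w *\<^sub>R (smooth_abs2 \<delta> c w *\<^sub>R D x w b)) \<bullet> b \<partial>lborel)"
      unfolding smear_def[OF \<delta>] by (subst integral_inner_left[OF i]) auto
    also have "\<dots> = (\<integral>w. (\<Sum>b\<in>Basis. (sgn_ind c k w *\<^sub>R (smooth_abs2 \<delta> c w *\<^sub>R D x w b)) \<bullet> b) \<partial>lborel)"
      by (rule Bochner_Integration.integral_sum[symmetric]) (rule integrable_inner_left[OF i])
    also have "\<dots> = smear \<delta> c k (div_f x)"
      unfolding smear_def[OF \<delta>] div_f_def by (simp add: sum_distrib_left mult.assoc)
    finally show ?thesis .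
  qed
  finally show ?thesis by (simp add: divergence_f[OF x])
qed

lemma f_lipschitz_right: "\<exists>L. L-lipschitz_on {a..b} (f x)"
proof -
  obtain L where L: "L \<ge> 0" "\<forall>y z l m. norm y \<le> norm x + \<bar>a\<bar> + \<bar>b\<bar> \<and> norm z \<le> norm x + \<bar>a\<bar> + \<bar>b\<bar> \<and>
      \<bar>l\<bar> \<le> norm x + \<bar>a\<bar> + \<bar>b\<bar> \<and> \<bar>m\<bar> \<le> norm x + \<bar>a\<bar> + \<bar>b\<bar> \<longrightarrow>
      norm (f y l - f z m) \<le> L * (norm (y - z) + \<bar>l - m\<bar>)" using f_lip by blast
  have "norm (f x l - f x m) \<le> L * (norm (x - x) + \<bar>l - m\<bar>)" if "l \<in> {a..b}" "m \<in> {a..b}" for l m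
  proof (rule L(2)[rule_format], intro conjI)
    show "\<bar>l\<bar> \<le> norm x + \<bar>a\<bar> + \<bar>b\<bar>" "\<bar>m\<bar> \<le> norm x + \<bar>a\<bar> + \<bar>b\<bar>"
      using that norm_ge_zero[of x] unfolding atLeastAtMost_iff by linarith+
  qed auto
  then have "L-lipschitz_on {a..b} (f x)" using L(1)
    by (intro lipschitz_onI) (auto simp: dist_norm)
  then show ?thesis ..
qed

text \<open>The base point is \<open>c\<close>, where \<open>smooth_abs1\<close> vanishes, so
  integration by parts leaves no boundary term there.\<close>

lemma entropy_pair_smooth_abs:
  assumes \<delta>: "\<delta> > 0"
  shows "entropy_pair f (smooth_abs \<delta> c) (\<lambda>x k. smooth_abs1 \<delta> c k *\<^sub>R f x k - smear \<delta> c k (f x))"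
  unfolding entropy_pair_def
proof (intro conjI exI allI)
  fix x k
  show "smooth_abs1 \<delta> c k *\<^sub>R f x k - smear \<delta> c k (f x) =
      (LINT \<omega>=ereal c..ereal k|lebesgue. (deriv (smooth_abs \<delta> c) \<omega> *\<^sub>R vector_derivative (f x) (at \<omega>)))"
    unfolding interval_integral_sgn_ind deriv_smooth_abs[OF \<delta>]
      integral_by_parts_sgn_ind[OF f_lipschitz_right DERIV_smooth_abs1[OF \<delta>] continuous_smooth_abs2[OF \<delta>]] smear_def[OF \<delta>] smooth_abs1_center[OF \<delta>]
    by simp
qed (auto intro: convex_smooth_abs[OF \<delta>] C2_smooth_abs[OF \<delta>])

end

subsection \<open>The Kruzhkov entropy inequalities\<close>

text \<open>Time is the outer variable of integration in the definitions, so the slices are needed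
  with \<open>t\<close> fixed.\<close>

lemma AE_lborel_sections:
  assumes N: "N \<in> null_sets (lborel :: ('a::euclidean_space \<times> real) measure)"
  shows "AE t in lborel. AE x in lborel. (x, t) \<notin> N"
proof -
  have [measurable]: "N \<in> sets (lborel \<Otimes>\<^sub>M lborel)" unfolding lborel_prod using N by (rule null_setsD2)
  have "AE z in lborel \<Otimes>\<^sub>M lborel. z \<notin> N" unfolding lborel_prod using N by (rule AE_not_in)
  from lborel_pair.AE_pair[OF this] have 1: "AE x in lborel. AE t in lborel. (x, t) \<notin> N" .
  have 2: "{z \<in> space (lborel \<Otimes>\<^sub>M lborel). (fst z, snd z) \<notin> N} \<in> sets (lborel \<Otimes>\<^sub>M lborel)"
  proof -
    have "{z \<in> space (lborel \<Otimes>\<^sub>M lborel). (fst z, snd z) \<notin> N} = space (lborel \<Otimes>\<^sub>M lborel) - N" by auto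
    also have "\<dots> \<in> sets (lborel \<Otimes>\<^sub>M lborel)" by (intro sets.Diff sets.top) fact
    finally show ?thesis .
  qed
  from lborel_pair.AE_commute[OF 2] 1 show ?thesis by simp
qed

text \<open>Bridge from the iterated integrals of the definitions to one Borel integral over
  space-time: almost every time slice of the exceptional set is null, so the inner integrals agree
  for almost every \<open>t\<close>. Vanishing of \<open>hB\<close> at nonpositive times absorbs the
  restriction to \<open>{0<..}\<close>.\<close>

lemma iterated_lebesgue_integral:
  fixes h hB :: "'a::euclidean_space \<times> real \<Rightarrow> real"
  assumes int: "integrable lborel hB" and ae: "AE z in lborel. snd z > 0 \<longrightarrow> h z = hB z"
    and zero: "\<And>z. snd z \<le> 0 \<Longrightarrow> hB z = 0"
  shows "(LINT t:{0<..}|lebesgue. LINT x|lebesgue. h (x, t)) = (\<integral>z. hB z \<partial>lborel)"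
proof -
  from AE_lborelE[OF ae] obtain N where N: "N \<in> null_sets lborel" "\<forall>z. z \<notin> N \<longrightarrow> snd z > 0 \<longrightarrow> h z = hB z" .
  have hBm: "hB \<in> borel_measurable borel" using int by auto
  have int2: "integrable (lborel \<Otimes>\<^sub>M lborel) (case_prod (\<lambda>x t. hB (x, t)))"
    using int by (simp add: lborel_prod)
  have "AE t in lborel. indicator {0<..} t *\<^sub>R (LINT x|lebesgue. h (x, t)) = (\<integral>x. hB (x, t) \<partial>lborel)"
    using AE_lborel_sections[OF N(1)]
  proof eventually_elim
    case (elim t)
    show ?case
    proof (cases "t > 0")
      case True
      have "AE x in lborel. h (x, t) = hB (x, t)"
        using elim by eventually_elim (use N(2) True in auto)
      moreover have "(\<lambda>x. hB (x, t)) \<in> borel_measurable borel"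
        by (rule measurable_compose[OF borel_measurable_continuous_onI hBm]) (intro continuous_intros)
      ultimately show ?thesis using True AE_lborel_eq_imp_lebesgue(2) by fastforce
    qed (simp add: zero)
  qed
  moreover have "(\<lambda>t. \<integral>x. hB (x, t) \<partial>lborel) \<in> borel_measurable borel"
    using borel_measurable_integrable[OF lborel_pair.integrable_snd[OF int2]] by simp
  ultimately have "(LINT t:{0<..}|lebesgue. LINT x|lebesgue. h (x, t)) = (\<integral>t. \<integral>x. hB (x, t) \<partial>lborel \<partial>lborel)"
    unfolding set_lebesgue_integral_def by (intro AE_lborel_eq_imp_lebesgue(2))
  also have "\<dots> = (\<integral>z. hB z \<partial>lborel)"
    using lborel_pair.integral_snd[OF int2] by (simp add: lborel_prod)
  finally show ?thesis .
qed

lemma partial_derivatives: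
  fixes \<phi> :: "'a::euclidean_space \<times> real \<Rightarrow> real"
  assumes "(\<phi> has_derivative (\<lambda>h. h \<bullet> p)) (at (x, t))"
  shows "deriv (\<lambda>s. \<phi> (x, s)) t = snd p" and "gradient (\<lambda>y. \<phi> (y, t)) x = fst p"
proof -
  have "((\<lambda>s. \<phi> (x, s)) has_derivative (\<lambda>s. (0, s) \<bullet> p)) (at t)"
    by (rule has_derivative_compose[where g = \<phi> and f = "\<lambda>s. (x, s)" and f' = "\<lambda>s. (0, s)"])
      (use assms in \<open>auto intro!: derivative_eq_intros\<close>)
  then have "((\<lambda>s. \<phi> (x, s)) has_real_derivative snd p) (at t)"
    unfolding has_field_derivative_def by (rule has_derivative_eq_rhs) (auto simp: inner_prod_def)
  then show "deriv (\<lambda>s. \<phi> (x, s)) t = snd p" by (rule DERIV_imp_deriv)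
  have "((\<lambda>y. \<phi> (y, t)) has_derivative (\<lambda>v. (v, 0) \<bullet> p)) (at x)"
    by (rule has_derivative_compose[where g = \<phi> and f = "\<lambda>y. (y, t)" and f' = "\<lambda>v. (v, 0)"])
      (use assms in \<open>auto intro!: derivative_eq_intros\<close>)
  then have "((\<lambda>y. \<phi> (y, t)) has_derivative (\<lambda>v. v \<bullet> fst p)) (at x)" by (simp add: inner_prod_def)
  from frechet_derivative_at[OF this] have "frechet_derivative (\<lambda>y. \<phi> (y, t)) (at x) = (\<lambda>v. v \<bullet> fst p)" by simp
  then show "gradient (\<lambda>y. \<phi> (y, t)) x = fst p"
    unfolding gradient_def by (simp add: inner_commute[of _ "fst p"] euclidean_representation)
qed

lemma sgn_ind_if: "sgn_ind c k w = (if c < w \<and> w < k then 1 else if k < w \<and> w < c then -1 else 0)"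
  by (auto simp: sgn_ind_def)

lemma borel_measurable_smear:
  fixes h :: "'b \<Rightarrow> real \<Rightarrow> 'c::euclidean_space"
  assumes \<delta>: "\<delta> > 0" and [measurable]: "v \<in> borel_measurable M"
    "(\<lambda>z. h (fst z) (snd z)) \<in> borel_measurable (M \<Otimes>\<^sub>M lborel)"
  shows "(\<lambda>z. smear \<delta> c (v z) (h z)) \<in> borel_measurable M"
proof -
  have [measurable]: "smooth_abs2 \<delta> c \<in> borel_measurable borel"
    by (rule borel_measurable_continuous_onI[OF continuous_smooth_abs2[OF \<delta>]])
  have "(\<lambda>z. sgn_ind c (v (fst z)) (snd z) *\<^sub>R (smooth_abs2 \<delta> c (snd z) *\<^sub>R h (fst z) (snd z))) \<in> borel_measurable (M \<Otimes>\<^sub>M lborel)"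
    unfolding sgn_ind_if by measurable
  then show ?thesis unfolding smear_def[OF \<delta>]
    by (intro lborel.borel_measurable_lebesgue_integral) (simp add: case_prod_beta')
qed

context flux begin

text \<open>The entropy inequality is taken with \<delta> = 1 / (n + 1) and passed to the limit by
  dominated convergence. \<open>p\<close> is a Borel representative of the space-time gradient of
  the test function.\<close>

lemma kruzkov_inequality:
  fixes u v \<phi> :: "'a \<times> real \<Rightarrow> real" and p :: "'a \<times> real \<Rightarrow> 'a \<times> real"
  assumes sol: "entropy_solution f {0<..} u0 u"
    and v [measurable]: "v \<in> borel_measurable borel" and vC: "\<And>z. \<bar>v z\<bar> \<le> C"
    and uv: "AE z in lborel. snd z > 0 \<longrightarrow> u z = v z"
    and \<phi>_lip: "L-lipschitz_on UNIV \<phi>" and \<phi>_nonneg: "\<And>z. 0 \<le> \<phi> z"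
    and \<phi>_zero: "\<And>z. norm z > R \<or> snd z < \<tau> \<Longrightarrow> \<phi> z = 0" and \<tau>: "\<tau> > 0"
    and p [measurable]: "p \<in> borel_measurable borel" and pM: "\<And>z. norm (p z) \<le> M * indicator (cball 0 R) z"
    and p_zero: "\<And>z. snd z \<le> 0 \<Longrightarrow> p z = 0"
    and \<phi>_deriv: "AE z in lborel. (\<phi> has_derivative (\<lambda>h. h \<bullet> p z)) (at z)"
  shows "0 \<le> (\<integral>z. snd (p z) * \<bar>v z - c\<bar> + sgn (v z - c) *
      (fst (p z) \<bullet> (f (fst z) (v z) - f (fst z) c) - \<phi> z * div_f (fst z) c) \<partial>lborel)"
proof -
  let ?d = "\<lambda>n. inverse (real (Suc n))"
  have dpos: "?d n > 0" and d1: "?d n \<le> 1" for n by (simp_all add: inverse_le_1_iff)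
  have [measurable]: "\<phi> \<in> borel_measurable borel"
    by (rule borel_measurable_continuous_onI[OF lipschitz_on_continuous_on[OF \<phi>_lip]])
  define H where "H n z = snd (p z) * smooth_abs (?d n) c (v z) + \<phi> z * (- smear (?d n) c (v z) (div_f (fst z)))
     + fst (p z) \<bullet> (smooth_abs1 (?d n) c (v z) *\<^sub>R f (fst z) (v z) - smear (?d n) c (v z) (f (fst z)))" for n z
  define H0 where "H0 z = snd (p z) * \<bar>v z - c\<bar> + \<phi> z * (- (sgn (v z - c) * div_f (fst z) c))
     + fst (p z) \<bullet> (sgn (v z - c) *\<^sub>R f (fst z) (v z) - sgn (v z - c) *\<^sub>R f (fst z) c)" for z
  have H0_eq: "H0 z = snd (p z) * \<bar>v z - c\<bar> + sgn (v z - c) *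
      (fst (p z) \<bullet> (f (fst z) (v z) - f (fst z) c) - \<phi> z * div_f (fst z) c)" for z
    unfolding H0_def by (simp add: algebra_simps inner_diff_right)
  have lipc: "Lip_c (UNIV \<times> {0<..}) \<phi>"
    unfolding Lip_c_def
  proof (intro conjI)
    show "\<exists>L. L-lipschitz_on (UNIV \<times> {0<..}) \<phi>" using lipschitz_on_subset[OF \<phi>_lip] by blast
    let ?K = "cball 0 R \<inter> {z :: 'a \<times> real. \<tau> \<le> snd z}"
    have "closed {z :: 'a \<times> real. \<tau> \<le> snd z}" by (intro closed_Collect_le continuous_intros)
    then have K: "compact ?K" by (intro compact_Int_closed) auto
    have "{z \<in> UNIV \<times> {0<..}. \<phi> z \<noteq> 0} \<subseteq> ?K"
    proof
      fix z assume "z \<in> {z \<in> UNIV \<times> {0<..}. \<phi> z \<noteq> 0}"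
      then show "z \<in> ?K" using \<phi>_zero[of z] by fastforce
    qed
    then have cl: "closure {z \<in> UNIV \<times> {0<..}. \<phi> z \<noteq> 0} \<subseteq> ?K" by (intro closure_minimal compact_imp_closed K)
    then show "closure {z \<in> UNIV \<times> {0<..}. \<phi> z \<noteq> 0} \<subseteq> UNIV \<times> {0<..}" using \<tau> by (force simp: mem_Times_iff)
    show "compact (closure {z \<in> UNIV \<times> {0<..}. \<phi> z \<noteq> 0})"
      using compact_Int_closed[OF K, of "closure {z \<in> UNIV \<times> {0<..}. \<phi> z \<noteq> 0}"] cl by (simp add: Int_absorb1)
  qed
  have Hm [measurable]: "H n \<in> borel_measurable borel" for n
  proof -
    have "continuous_on UNIV (smooth_abs (?d n) c)" "continuous_on UNIV (smooth_abs1 (?d n) c)"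
      using DERIV_isCont[OF DERIV_smooth_abs[OF dpos]] DERIV_isCont[OF DERIV_smooth_abs1[OF dpos]]
      by (simp_all add: continuous_on_eq_continuous_at del: of_nat_Suc)
    then have [measurable]: "smooth_abs (?d n) c \<in> borel_measurable borel" "smooth_abs1 (?d n) c \<in> borel_measurable borel"
      by (auto intro: borel_measurable_continuous_onI)
    have [measurable]: "(\<lambda>z. smear (?d n) c (v z) (div_f (fst z))) \<in> borel_measurable borel"
      "(\<lambda>z. smear (?d n) c (v z) (f (fst z))) \<in> borel_measurable borel"
      by (rule borel_measurable_smear[OF dpos]; measurable)+
    show ?thesis unfolding H_def[abs_def] by measurable
  qed
  have C0: "C \<ge> 0" using vC[of 0] by linarith
  \<comment> \<open>One radius for points and states: the smeared integrals run over states between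
    \<open>c\<close> and \<open>v z\<close>.\<close>
  define Q where "Q = max \<bar>R\<bar> (max C \<bar>c\<bar>)"
  obtain Bg where Bg: "Bg \<ge> 0" "\<forall>x k. norm x \<le> Q \<and> \<bar>k\<bar> \<le> Q \<longrightarrow> \<bar>div_f x k\<bar> \<le> Bg" using div_f_bound by blast
  obtain Bf where Bf: "Bf \<ge> 0" "\<forall>x k. norm x \<le> Q \<and> \<bar>k\<bar> \<le> Q \<longrightarrow> norm (f x k) \<le> Bf" using f_bound by blast
  obtain B\<phi> where B\<phi>: "B\<phi> \<ge> 0" "\<And>z. \<phi> z \<le> B\<phi> * indicator (cball 0 R) z"
  proof -
    have "bounded (\<phi> ` cball 0 R)"
      by (intro compact_imp_bounded compact_continuous_image
          continuous_on_subset[OF lipschitz_on_continuous_on[OF \<phi>_lip]]) auto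
    then obtain B where B: "\<forall>z\<in>cball 0 R. \<bar>\<phi> z\<bar> \<le> B" unfolding bounded_iff by auto
    show thesis
    proof (rule that[of "\<bar>B\<bar>"])
      show "\<phi> z \<le> \<bar>B\<bar> * indicator (cball 0 R) z" for z
        using B \<phi>_zero[of z] by (cases "norm z \<le> R") force+
    qed simp
  qed
  define K where "K = \<bar>M\<bar> * (C + \<bar>c\<bar> + 1) + B\<phi> * Bg + \<bar>M\<bar> * (Bf + Bf)"
  have H_bound: "norm (H n z) \<le> K * indicator (cball 0 R) z" for n z
  proof (cases "norm z \<le> R")
    case False
    then show ?thesis using \<phi>_zero[of z] pM[of z] by (simp add: H_def)
  next
    case True
    have x: "norm (fst z) \<le> Q" using True norm_fst_le[of "fst z" "snd z"] unfolding Q_def by (simp add: prod.collapse)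
    have pz: "norm (p z) \<le> \<bar>M\<bar>" using pM[of z] True by simp
    have p2: "\<bar>snd (p z)\<bar> \<le> \<bar>M\<bar>" "norm (fst (p z)) \<le> \<bar>M\<bar>"
      using pz norm_snd_le[of "snd (p z)" "fst (p z)"] norm_fst_le[of "fst (p z)" "snd (p z)"] by auto
    have vz: "\<bar>v z\<bar> \<le> Q" using vC[of z] by (simp add: Q_def)
    have s1: "\<bar>smooth_abs (?d n) c (v z)\<bar> \<le> C + \<bar>c\<bar> + 1"
      using smooth_abs_ge(3)[OF dpos, of n c "v z"] smooth_abs_pos[OF dpos, of n c "v z"] vC[of z] d1[of n] by linarith
    have wQ: "\<bar>w\<bar> \<le> Q" if "min c (v z) < w" "w < max c (v z)" for w
      using that vC[of z] unfolding Q_def by linarith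
    have s2: "\<bar>smear (?d n) c (v z) (div_f (fst z))\<bar> \<le> Bg"
      using norm_smear_le[OF dpos[of n] div_f_continuous[of "fst z"], of c "v z" Bg 0] Bg wQ x by simp
    have s3: "norm (smear (?d n) c (v z) (f (fst z))) \<le> Bf"
      using norm_smear_le[OF dpos[of n] f_continuous_right[of "fst z"], of c "v z" Bf 0] Bf wQ x by simp
    have s4: "norm (smooth_abs1 (?d n) c (v z) *\<^sub>R f (fst z) (v z)) \<le> Bf"
    proof -
      have "\<bar>smooth_abs1 (?d n) c (v z)\<bar> * norm (f (fst z) (v z)) \<le> 1 * Bf"
        using abs_smooth_abs1_le[OF dpos] Bf x vz by (intro mult_mono) auto
      then show ?thesis by simp
    qed
    have a1: "\<bar>snd (p z) * smooth_abs (?d n) c (v z)\<bar> \<le> \<bar>M\<bar> * (C + \<bar>c\<bar> + 1)"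
      unfolding abs_mult using p2 s1 by (intro mult_mono) auto
    have a2: "\<bar>\<phi> z * (- smear (?d n) c (v z) (div_f (fst z)))\<bar> \<le> B\<phi> * Bg"
      unfolding abs_mult abs_minus using B\<phi>(1) B\<phi>(2)[of z] \<phi>_nonneg[of z] True s2 by (intro mult_mono) auto
    have a3: "\<bar>fst (p z) \<bullet> (smooth_abs1 (?d n) c (v z) *\<^sub>R f (fst z) (v z) - smear (?d n) c (v z) (f (fst z)))\<bar> \<le> \<bar>M\<bar> * (Bf + Bf)"
    proof (rule order_trans[OF Cauchy_Schwarz_ineq2 mult_mono])
      show "norm (smooth_abs1 (?d n) c (v z) *\<^sub>R f (fst z) (v z) - smear (?d n) c (v z) (f (fst z))) \<le> Bf + Bf"
        using s3 s4 by (rule order_trans[OF norm_triangle_ineq4 add_mono[rotated]])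
    qed (use p2 in auto)
    have "\<bar>a + b + d\<bar> \<le> A + B + E" if "\<bar>a\<bar> \<le> A" "\<bar>b\<bar> \<le> B" "\<bar>d\<bar> \<le> E" for a b d A B E :: real
      using that by linarith
    from this[OF a1 a2 a3] show ?thesis using True unfolding H_def K_def by simp
  qed
  have Hint: "integrable lborel (H n)" for n by (rule integrable_lborel_bounded_support[OF Hm H_bound])
  have nn: "0 \<le> (\<integral>z. H n z \<partial>lborel)" for n
  proof -
    let ?q = "\<lambda>x k. smooth_abs1 (?d n) c k *\<^sub>R f x k - smear (?d n) c k (f x)"
    let ?h = "\<lambda>z. deriv (\<lambda>s. \<phi> (fst z, s)) (snd z) * smooth_abs (?d n) c (u z)
               + \<phi> z * (divergence (\<lambda>y. ?q y (u z)) (fst z)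
                              - deriv (smooth_abs (?d n) c) (u z) * divergence (\<lambda>y. f y (u z)) (fst z))
               + gradient (\<lambda>y. \<phi> (y, snd z)) (fst z) \<bullet> ?q (fst z) (u z)"
    have "0 \<le> (LINT t:{0<..}|lebesgue. LINT x|lebesgue. ?h (x, t))"
      using sol entropy_pair_smooth_abs[OF dpos] lipc \<phi>_nonneg unfolding entropy_solution_def fst_conv snd_conv by blast
    also have "\<dots> = (\<integral>z. H n z \<partial>lborel)"
    proof (rule iterated_lebesgue_integral[OF Hint])
      show "AE z in lborel. snd z > 0 \<longrightarrow> ?h z = H n z"
        using uv \<phi>_deriv AE_not_in[OF NxUNIV_null]
      proof eventually_elim
        case (elim z)
        show ?case
        proof
          assume "snd z > 0"
          then have uz: "u z = v z" using elim(1) by blast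
          have x: "fst z \<notin> N" using elim(3) by (simp add: mem_Times_iff)
          have "(\<phi> has_derivative (\<lambda>h. h \<bullet> p z)) (at (fst z, snd z))" using elim(2) by simp
          note part = partial_derivatives[OF this]
          show "?h z = H n z"
            unfolding part uz deriv_smooth_abs[OF dpos] divergence_entropy_flux[OF dpos x] H_def ..
        qed
      qed
      show "H n z = 0" if "snd z \<le> 0" for z
        using \<phi>_zero[of z] \<tau> p_zero[OF that] that by (simp add: H_def)
    qed
    finally show ?thesis .
  qed
  have lim: "(\<lambda>n. \<integral>z. H n z \<partial>lborel) \<longlonglongrightarrow> (\<integral>z. H0 z \<partial>lborel)"
  proof (rule integral_dominated_convergence[where w = "\<lambda>z. K * indicator (cball 0 R) z"])
    show "H0 \<in> borel_measurable lborel" unfolding H0_def[abs_def] by measurable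
    show "integrable lborel (\<lambda>z::'a \<times> real. K * indicator (cball 0 R) z :: real)"
      using emeasure_bounded_finite[OF bounded_cball] by (intro integrable_mult_right integrable_real_indicator) auto
    show "AE z in lborel. (\<lambda>n. H n z) \<longlonglongrightarrow> H0 z"
      unfolding H_def H0_def real_scaleR_def[symmetric]
      by (intro AE_I2 tendsto_intros smooth_abs_tendsto smooth_abs1_tendsto smear_tendsto div_f_continuous f_continuous_right)
  qed (use Hm H_bound in auto)
  have "0 \<le> (\<integral>z. H0 z \<partial>lborel)" by (rule LIMSEQ_le_const[OF lim]) (use nn in blast)
  then show ?thesis unfolding H0_eq .
qed

end

subsection \<open>A mollifier\<close>

text \<open>Squaring the positive part makes it continuously differentiable, which is enough since
  test functions are Lipschitz. It is not normalised: only the positivity of its integral will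
  matter.\<close>

definition moll :: "'b::euclidean_space \<Rightarrow> real" where
  "moll w = (max 0 (1 - w \<bullet> w))\<^sup>2"

text \<open>A scalar factor: the gradient of \<open>moll\<close> is
  \<open>moll' w *\<^sub>R w\<close>. This radial form leads to the quadratic form
  \<open>fst w \<bullet> A (fst w)\<close> below.\<close>

definition moll' :: "'b::euclidean_space \<Rightarrow> real" where
  "moll' w = - 4 * max 0 (1 - w \<bullet> w)"

lemma DERIV_max_square: "((\<lambda>s. (max 0 s)\<^sup>2) has_real_derivative 2 * max 0 s) (at s)"
proof -
  consider "s > 0" | "s < 0" | "s = 0" by linarith
  then show ?thesis
  proof cases
    case 1
    have "((\<lambda>s. s\<^sup>2) has_real_derivative 2 * max 0 s) (at s)"
      using 1 by (auto intro!: derivative_eq_intros)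
    then show ?thesis
      by (rule has_field_derivative_transform_within_open[where S = "{0<..}"]) (use 1 in auto)
  next
    case 2
    have "((\<lambda>s. 0) has_real_derivative 2 * max 0 s) (at s)"
      using 2 by (auto intro!: derivative_eq_intros)
    then show ?thesis
      by (rule has_field_derivative_transform_within_open[where S = "{..<0}"]) (use 2 in auto)
  next
    case 3
    have "(\<lambda>h. ((max 0 (0 + h))\<^sup>2 - (max 0 0)\<^sup>2) / h) \<midarrow>0\<rightarrow> (0::real)"
    proof (rule Lim_null_comparison)
      show "\<forall>\<^sub>F h in at 0. norm (((max 0 (0 + h))\<^sup>2 - (max 0 0)\<^sup>2) / h) \<le> \<bar>h::real\<bar>"
        by (rule always_eventually) (auto simp: max_def power2_eq_square)
      show "((\<lambda>h::real. \<bar>h\<bar>) \<longlongrightarrow> 0) (at 0)" using tendsto_rabs_zero[OF tendsto_ident_at] .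
    qed
    then show ?thesis using 3 by (simp add: DERIV_def)
  qed
qed

lemma moll_has_derivative: "(moll has_derivative (\<lambda>h. h \<bullet> (moll' w *\<^sub>R w))) (at w)"
proof -
  have 1: "((\<lambda>w. 1 - w \<bullet> w) has_derivative (\<lambda>h. - (2 * (h \<bullet> w)))) (at w)"
    by (auto intro!: derivative_eq_intros simp: inner_commute)
  have 2: "((\<lambda>s. (max 0 s)\<^sup>2) has_derivative (\<lambda>h. (2 * max 0 (1 - w \<bullet> w)) * h)) (at (1 - w \<bullet> w))"
    using DERIV_max_square unfolding has_field_derivative_def .
  have "moll = (\<lambda>w::'a. (max 0 (1 - w \<bullet> w))\<^sup>2)" by (rule ext) (rule moll_def)
  then show ?thesis using has_derivative_compose[OF 1 2] by (simp add: moll'_def mult_ac)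
qed

lemma moll_outside: "norm w > 1 \<Longrightarrow> moll w = 0" "norm w > 1 \<Longrightarrow> moll' w = 0"
proof -
  assume "norm w > 1"
  then have "w \<bullet> w > 1" by (simp add: dot_square_norm)
  then show "moll w = 0" "moll' w = 0" by (simp_all add: moll_def moll'_def)
qed

lemma moll_bounds: "0 \<le> moll w" "moll w \<le> 1" "\<bar>moll' w\<bar> \<le> 4"
  by (auto simp: moll_def moll'_def power_le_one)

lemma moll_borel [measurable]: "moll \<in> borel_measurable borel" "moll' \<in> borel_measurable borel"
  unfolding moll_def[abs_def] moll'_def[abs_def]
  by (intro borel_measurable_continuous_onI continuous_intros)+

lemma norm_moll'_scaleR: "norm (moll' w *\<^sub>R w) \<le> 4"
proof (cases "norm w > 1")
  case False
  then have "\<bar>moll' w\<bar> * norm w \<le> 4 * 1" by (intro mult_mono moll_bounds) auto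
  then show ?thesis by simp
qed (simp add: moll_outside)

lemma lipschitz_of_derivative_bound:
  fixes G :: "'b::euclidean_space \<Rightarrow> real"
  assumes "\<And>x. (G has_derivative G' x) (at x)" "\<And>x h. \<bar>G' x h\<bar> \<le> C * norm h" "C \<ge> 0"
  shows "C-lipschitz_on UNIV G"
proof (rule bounded_derivative_imp_lipschitz)
  show "onorm (G' x) \<le> C" for x
    using assms(2,3) by (intro onorm_bound) auto
qed (use assms in auto)

lemma moll_lipschitz: "4-lipschitz_on UNIV (moll :: 'b::euclidean_space \<Rightarrow> real)"
proof (rule lipschitz_of_derivative_bound[OF moll_has_derivative])
  show "\<bar>h \<bullet> (moll' x *\<^sub>R x)\<bar> \<le> 4 * norm h" for x h :: 'b
  proof -
    have "\<bar>h \<bullet> (moll' x *\<^sub>R x)\<bar> \<le> norm h * norm (moll' x *\<^sub>R x)" by (rule Cauchy_Schwarz_ineq2)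
    also have "\<dots> \<le> norm h * 4" by (intro mult_left_mono norm_moll'_scaleR) auto
    finally show ?thesis by simp
  qed
qed simp

lemma moll_integrable: "integrable lborel (moll :: 'b::euclidean_space \<Rightarrow> real)"
proof (rule integrable_lborel_bounded_support[where C = 1 and R = 1])
  show "norm (moll w) \<le> 1 * indicator (cball 0 1) w" for w :: 'b
    using moll_bounds[of w] moll_outside[of w] by (auto simp: indicator_def not_le)
qed measurable

lemma moll_integral_pos: "0 < (\<integral>w. moll (w :: 'b::euclidean_space) \<partial>lborel)"
proof -
  have "0 < 1 / 4 * measure lborel (ball (0 :: 'b) (1 / 2))"
    using content_ball_pos[of "1/2" "0 :: 'b"] by simp
  also have "\<dots> = (\<integral>w. 1 / 4 * indicator (ball 0 (1 / 2)) (w :: 'b) \<partial>lborel)" by simp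
  also have "\<dots> \<le> (\<integral>w. moll (w :: 'b) \<partial>lborel)"
  proof (rule integral_mono[OF _ moll_integrable])
    show "integrable lborel (\<lambda>w :: 'b. 1 / 4 * indicator (ball 0 (1 / 2)) w :: real)"
      using emeasure_bounded_finite[OF bounded_ball] by (intro integrable_mult_right integrable_real_indicator) auto
    show "1 / 4 * indicator (ball 0 (1 / 2)) w \<le> moll w" for w :: 'b
    proof (cases "norm w < 1 / 2")
      case True
      then have "w \<bullet> w \<le> (1 / 2)\<^sup>2" by (simp add: dot_square_norm power_mono less_imp_le)
      then have "1 / 2 \<le> 1 - w \<bullet> w" by (simp add: power2_eq_square)
      then have m: "1 / 2 \<le> max 0 (1 - w \<bullet> w)" by (rule max.coboundedI2)
      have "(1 / 2)\<^sup>2 \<le> (max 0 (1 - w \<bullet> w))\<^sup>2" by (rule power_mono[OF m]) simp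
      moreover have "1 / 4 * indicator (ball 0 (1 / 2)) w = (1 / 2 :: real)\<^sup>2"
        using True by (simp add: power2_eq_square)
      ultimately show ?thesis by (simp only: moll_def)
    qed (simp add: moll_bounds)
  qed
  finally show ?thesis .
qed

text \<open>Translation invariance makes the integral of every difference quotient 0, and the
  quotients are bounded with support in a common ball.\<close>

lemma integral_derivative_zero:
  fixes G :: "'b::euclidean_space \<Rightarrow> real"
  assumes G': "\<And>x. (G has_derivative G' x) (at x)" and C: "\<And>x h. \<bar>G' x h\<bar> \<le> C * norm h" "C \<ge> 0"
    and R: "\<And>x. norm x > R \<Longrightarrow> G x = 0"
    and meas: "(\<lambda>x. G' x v) \<in> borel_measurable borel"
  shows "(\<integral>x. G' x v \<partial>lborel) = 0"
proof -
  have lip: "C-lipschitz_on UNIV G" by (rule lipschitz_of_derivative_bound[OF assms(1-3)])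
  have [measurable]: "G \<in> borel_measurable borel"
    by (rule borel_measurable_continuous_onI[OF lipschitz_on_continuous_on[OF lip]])
  let ?s = "\<lambda>n. inverse (real (Suc n))"
  \<comment> \<open>Comparison with a point \<open>y\<close> just outside the ball, where
    \<open>G\<close> vanishes; both points have norm at most
    \<open>\<bar>R\<bar> + 1\<close>.\<close>
  have Gb: "norm (G x) \<le> (C * 2 * (\<bar>R\<bar> + 1)) * indicator (cball 0 R) x" for x
  proof (cases "norm x \<le> R")
    case True
    obtain y :: 'b where y: "norm y = \<bar>R\<bar> + 1" using vector_choose_size[of "\<bar>R\<bar> + 1"] by auto
    have "\<bar>G x - G y\<bar> \<le> C * norm (x - y)" using lipschitz_onD[OF lip, of x y] by (simp add: dist_norm)
    also have "norm (x - y) \<le> norm x + norm y" by (rule norm_triangle_ineq4)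
    finally have "\<bar>G x - G y\<bar> \<le> C * (norm x + norm y)" using C(2) by (simp add: mult_left_mono)
    also have "\<dots> \<le> C * (2 * (\<bar>R\<bar> + 1))" using True y C(2) by (intro mult_left_mono) auto
    finally show ?thesis using True R[of y] y by (simp add: algebra_simps)
  qed (simp add: R)
  have Gi: "integrable lborel G" by (rule integrable_lborel_bounded_support[OF _ Gb]) measurable
  have q0: "(\<integral>x. dir_quot G v n x \<partial>lborel) = 0" for n
  proof -
    have "(\<integral>x. dir_quot G v n x \<partial>lborel) = ((\<integral>x. G (x + ?s n *\<^sub>R v) \<partial>lborel) - (\<integral>x. G x \<partial>lborel)) / ?s n"
      unfolding dir_quot_def using Gi integrable_lborel_translation[OF Gi] by (simp del: of_nat_Suc)
    then show ?thesis by (simp add: integral_lborel_translation)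
  qed
  have "(\<lambda>n. \<integral>x. dir_quot G v n x \<partial>lborel) \<longlonglongrightarrow> (\<integral>x. G' x v \<partial>lborel)"
  proof (rule integral_dominated_convergence[where w = "\<lambda>x. C * norm v * indicator (cball 0 (R + norm v)) x"])
    show "integrable lborel (\<lambda>x::'b. C * norm v * indicator (cball 0 (R + norm v)) x)"
      using emeasure_bounded_finite[OF bounded_cball] by (intro integrable_mult_right integrable_real_indicator) auto
    show "dir_quot G v n \<in> borel_measurable lborel" for n unfolding dir_quot_def[abs_def] by measurable
    show "AE x in lborel. (\<lambda>n. dir_quot G v n x) \<longlonglongrightarrow> G' x v"
    proof (rule AE_I2)
      fix x
      have lin: "linear (G' x)" by (rule bounded_linear.linear[OF has_derivative_bounded_linear[OF G']])
      have "((\<lambda>s. G (x + s *\<^sub>R v)) has_derivative (\<lambda>s. G' x (s *\<^sub>R v))) (at 0)"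
        by (rule has_derivative_compose[where g = G and f = "\<lambda>s. x + s *\<^sub>R v" and f' = "\<lambda>s. s *\<^sub>R v"])
          (use G'[of x] in \<open>auto intro!: derivative_eq_intros\<close>)
      then have d: "((\<lambda>s. G (x + s *\<^sub>R v)) has_real_derivative G' x v) (at 0)"
        unfolding has_field_derivative_def by (rule has_derivative_eq_rhs) (auto simp: linear_scale[OF lin])
      have "dir_deriv G v x = G' x v" unfolding dir_deriv_def by (rule DERIV_imp_deriv[OF d])
      moreover have "(\<lambda>s. G (x + s *\<^sub>R v)) differentiable (at 0)" using d real_differentiable_def by blast
      ultimately show "(\<lambda>n. dir_quot G v n x) \<longlonglongrightarrow> G' x v" using dir_quot_tendsto by metis
    qed
    show "AE x in lborel. norm (dir_quot G v n x) \<le> C * norm v * indicator (cball 0 (R + norm v)) x" for n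
    proof (rule AE_I2)
      fix x
      show "norm (dir_quot G v n x) \<le> C * norm v * indicator (cball 0 (R + norm v)) x"
      proof (cases "norm x \<le> R + norm v")
        case True
        then show ?thesis using dir_quot_bound[OF lip, of v n x] by simp
      next
        case False
        have "norm (?s n *\<^sub>R v) \<le> norm v" by (simp add: mult_left_le_one_le inverse_le_1_iff)
        moreover have "norm x \<le> norm (x + ?s n *\<^sub>R v) + norm (?s n *\<^sub>R v)"
          using norm_triangle_ineq4[of "x + ?s n *\<^sub>R v" "?s n *\<^sub>R v"] by simp
        ultimately have "norm (x + ?s n *\<^sub>R v) > R" "norm x > R" using False norm_ge_zero[of v] by linarith+
        then show ?thesis using False by (simp add: dir_quot_def R del: of_nat_Suc)
      qed
    qed
  qed (use meas in simp)
  then show ?thesis unfolding q0 using LIMSEQ_unique[OF tendsto_const] by metis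
qed

lemma moll_divergence_identity:
  fixes A :: "'a::euclidean_space \<Rightarrow> 'a"
  assumes A: "linear A"
  shows "(\<integral>w. moll' w * (fst w \<bullet> A (fst w)) + moll w * (\<Sum>b\<in>Basis. A b \<bullet> b) \<partial>(lborel :: ('a \<times> real) measure)) = 0"
    and "integrable (lborel :: ('a \<times> real) measure) (\<lambda>w. moll' w * (fst w \<bullet> A (fst w)) + moll w * (\<Sum>b\<in>Basis. A b \<bullet> b))"
proof -
  have blA: "bounded_linear A" using A by (simp add: linear_conv_bounded_linear)
  obtain K where K: "K > 0" "\<And>x. norm (A x) \<le> norm x * K" using bounded_linear.pos_bounded[OF blA] by blast
  \<comment> \<open>The component along \<open>b\<close> of the field
    \<open>moll w *\<^sub>R A (fst w)\<close>. \<open>A\<close> acts in space only, so its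
    divergence sums derivatives in the directions \<open>(b, 0)\<close>.\<close>
  define G where "G b w = moll w * (A (fst w) \<bullet> b)" for b and w :: "'a \<times> real"
  define G' where "G' b w h = moll w * (A (fst h) \<bullet> b) + (h \<bullet> (moll' w *\<^sub>R w)) * (A (fst w) \<bullet> b)" for b and w h :: "'a \<times> real"
  have Gd: "(G b has_derivative G' b w) (at w)" for b w
  proof -
    have "((\<lambda>w. A (fst w) \<bullet> b) has_derivative (\<lambda>h. A (fst h) \<bullet> b)) (at w)"
      by (intro has_derivative_inner_left bounded_linear.has_derivative[OF blA] has_derivative_fst has_derivative_ident)
    from has_derivative_mult[OF moll_has_derivative this] show ?thesis
      unfolding G_def[abs_def] G'_def[abs_def] .
  qed
  \<comment> \<open>5 = 1 + 4: on the unit ball \<open>moll\<close> is at most 1 and its gradient at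
    most 4.\<close>
  have Gb: "\<bar>G' b w h\<bar> \<le> 5 * K * norm h" if "b \<in> Basis" for b w h
  proof (cases "norm w > 1")
    case True
    then show ?thesis using K by (simp add: G'_def moll_outside)
  next
    case False
    have Ab: "\<bar>A x \<bullet> b\<bar> \<le> K * norm x" for x
      using Basis_le_norm[OF that, of "A x"] K(2)[of x] by (simp add: mult.commute)
    have fw: "norm (fst w) \<le> 1" using False norm_fst_le[of "fst w" "snd w"] by simp
    have fh: "norm (fst h) \<le> norm h" using norm_fst_le[of "fst h" "snd h"] by simp
    have "\<bar>moll w * (A (fst h) \<bullet> b)\<bar> \<le> 1 * (K * norm h)"
      unfolding abs_mult using moll_bounds[of w] Ab[of "fst h"] fh K(1)
      by (intro mult_mono) (auto intro: order_trans)
    moreover have "\<bar>(h \<bullet> (moll' w *\<^sub>R w)) * (A (fst w) \<bullet> b)\<bar> \<le> (norm h * 4) * (K * 1)"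
      unfolding abs_mult
    proof (rule mult_mono)
      show "\<bar>h \<bullet> (moll' w *\<^sub>R w)\<bar> \<le> norm h * 4"
        by (rule order_trans[OF Cauchy_Schwarz_ineq2 mult_left_mono[OF norm_moll'_scaleR]]) simp
      show "\<bar>A (fst w) \<bullet> b\<bar> \<le> K * 1" using Ab[of "fst w"] fw K(1) by (meson mult_left_mono less_imp_le order_trans)
    qed auto
    ultimately show ?thesis unfolding G'_def by (simp add: algebra_simps)
  qed
  have contA: "continuous_on UNIV A" by (rule linear_continuous_on[OF blA])
  have [measurable]: "A \<in> borel_measurable borel" by (rule borel_measurable_continuous_onI[OF contA])
  have Gm: "(\<lambda>w. G' b w h) \<in> borel_measurable borel" for b h
    unfolding G'_def by measurable
  have int: "integrable lborel (\<lambda>w. G' b w h)" if "b \<in> Basis" for b h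
  proof (rule integrable_lborel_bounded_support[where C = "5 * K * norm h" and R = 1])
    show "norm (G' b w h) \<le> 5 * K * norm h * indicator (cball 0 1) w" for w
      using Gb[OF that, of w h] by (cases "norm w \<le> 1") (simp_all add: G'_def moll_outside)
  qed (rule Gm)
  have zero: "(\<integral>w. G' b w h \<partial>lborel) = 0" if "b \<in> Basis" for b h
    by (rule integral_derivative_zero[OF Gd Gb[OF that], where R = 1])
      (use K Gm in \<open>auto simp: G_def moll_outside\<close>)
  have eq: "moll' w * (fst w \<bullet> A (fst w)) + moll w * (\<Sum>b\<in>Basis. A b \<bullet> b) = (\<Sum>b\<in>Basis. G' b w (b, 0))" for w
  proof -
    have "(\<Sum>b\<in>Basis. G' b w (b, 0)) = moll w * (\<Sum>b\<in>Basis. A b \<bullet> b) + moll' w * (\<Sum>b\<in>Basis. (fst w \<bullet> b) * (A (fst w) \<bullet> b))"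
      by (simp add: G'_def sum.distrib sum_distrib_left inner_prod_def inner_commute mult_ac)
    also have "(\<Sum>b\<in>Basis. (fst w \<bullet> b) * (A (fst w) \<bullet> b)) = fst w \<bullet> A (fst w)"
      by (rule euclidean_inner[symmetric])
    finally show ?thesis by (simp only: add.commute)
  qed
  show "integrable (lborel :: ('a \<times> real) measure) (\<lambda>w. moll' w * (fst w \<bullet> A (fst w)) + moll w * (\<Sum>b\<in>Basis. A b \<bullet> b))"
    unfolding eq by (intro Bochner_Integration.integrable_sum int)
  show "(\<integral>w. moll' w * (fst w \<bullet> A (fst w)) + moll w * (\<Sum>b\<in>Basis. A b \<bullet> b) \<partial>(lborel :: ('a \<times> real) measure)) = 0"
    unfolding eq by (subst Bochner_Integration.integral_sum) (auto simp: int zero)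
qed

subsection \<open>Convergence of rescaled translations\<close>

lemma integral_lborel_affine:
  fixes h :: "'b::euclidean_space \<Rightarrow> real"
  assumes [measurable]: "h \<in> borel_measurable borel" and \<epsilon>: "\<epsilon> > 0"
  shows "(\<integral>y. h y \<partial>lborel) = \<epsilon> ^ DIM('b) * (\<integral>w. h (x - \<epsilon> *\<^sub>R w) \<partial>lborel)"
proof -
  have "(\<integral>y. h y \<partial>lborel) = (\<integral>y. h y \<partial>density (distr lborel borel (\<lambda>w. x + (- \<epsilon>) *\<^sub>R w)) (\<lambda>_. ennreal (\<bar>- \<epsilon>\<bar> ^ DIM('b))))"
    using lborel_affine[of "- \<epsilon>" x] \<epsilon> by simp
  also have "\<dots> = (\<integral>w. \<bar>- \<epsilon>\<bar> ^ DIM('b) *\<^sub>R h (x + (- \<epsilon>) *\<^sub>R w) \<partial>lborel)"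
    by (subst integral_density) (auto simp: integral_distr)
  finally show ?thesis using \<epsilon> by simp
qed

lemma integrable_lborel_product:
  fixes F :: "'b::euclidean_space \<times> 'b \<Rightarrow> real"
  assumes "F \<in> borel_measurable borel"
    and "\<And>w X. \<bar>F (w, X)\<bar> \<le> C * (indicator (cball 0 S) w * indicator (cball 0 R) X)"
  shows "integrable lborel F"
proof (rule integrable_lborel_bounded_support[where C = "\<bar>C\<bar>" and R = "S + R"])
  fix z :: "'b \<times> 'b"
  obtain w X where z: "z = (w, X)" by (cases z)
  have "norm z \<le> S + R" if "norm w \<le> S" "norm X \<le> R"
    using norm_Pair_le[of w X] that unfolding z by linarith
  then show "norm (F z) \<le> \<bar>C\<bar> * indicator (cball 0 (S + R)) z"
    using assms(2)[of w X] z by (cases "norm w \<le> S"; cases "norm X \<le> R") (auto simp: indicator_def)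
qed (rule assms(1))

lemma integral_lborel_product:
  fixes F :: "'b::euclidean_space \<times> 'b \<Rightarrow> real"
  assumes "integrable lborel F"
  shows "(\<integral>z. F z \<partial>lborel) = (\<integral>w. \<integral>X. F (w, X) \<partial>lborel \<partial>lborel)"
    and "(\<integral>z. F z \<partial>lborel) = (\<integral>X. \<integral>w. F (w, X) \<partial>lborel \<partial>lborel)"
proof -
  have int: "integrable (lborel \<Otimes>\<^sub>M lborel) (case_prod (\<lambda>w X. F (w, X)))"
    using assms by (simp add: lborel_prod)
  show "(\<integral>z. F z \<partial>lborel) = (\<integral>w. \<integral>X. F (w, X) \<partial>lborel \<partial>lborel)"
    using lborel_pair.integral_fst[OF int] by (simp add: lborel_prod)
  show "(\<integral>z. F z \<partial>lborel) = (\<integral>X. \<integral>w. F (w, X) \<partial>lborel \<partial>lborel)"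
    using lborel_pair.integral_snd[OF int] by (simp add: lborel_prod)
qed

text \<open>For fixed \<open>w\<close> the integral over \<open>X\<close> tends to 0 by continuity
  of translations, and it stays below twice the norm of the truncated function, so dominated
  convergence applies over the unit ball of \<open>w\<close>. Steps of both signs occur
  later.\<close>

lemma L1_rescaled_translation:
  fixes G :: "'b::euclidean_space \<Rightarrow> real"
  assumes G [measurable]: "G \<in> borel_measurable borel" and B: "\<And>X. norm X \<le> R + 1 \<Longrightarrow> \<bar>G X\<bar> \<le> B"
    and r: "r \<longlonglongrightarrow> 0" "\<And>n. \<bar>r n\<bar> \<le> 1" and R: "R \<ge> 0"
  shows "(\<lambda>n. \<integral>z. indicator (cball 0 1) (fst z) * indicator (cball 0 R) (snd z) *
      \<bar>G (snd z + r n *\<^sub>R fst z) - G (snd z)\<bar> \<partial>lborel) \<longlonglongrightarrow> 0"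
proof -
  have [measurable]: "cball (0::'b) s \<in> sets borel" for s by simp
  have B0: "B \<ge> 0" using B[of 0] R by (force intro: order_trans[OF abs_ge_zero])
  \<comment> \<open>Truncation makes \<open>G\<close> integrable and is invisible at points of the
    ball of radius \<open>R\<close> and at their shifts of length at most 1.\<close>
  define h where "h X = indicator (cball 0 (R + 1)) X * G X" for X
  have hm [measurable]: "h \<in> borel_measurable borel" unfolding h_def[abs_def] by measurable
  have hb: "norm (h X) \<le> B * indicator (cball 0 (R + 1)) X" for X
    using B[of X] by (simp add: h_def indicator_def)
  have hi: "integrable lborel h" by (rule integrable_lborel_bounded_support[OF hm hb])
  define F where "F n z = indicator (cball 0 1) (fst z) * indicator (cball 0 R) (snd z) *
      \<bar>G (snd z + r n *\<^sub>R fst z) - G (snd z)\<bar>" for n and z :: "'b \<times> 'b"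
  have Fm [measurable]: "F n \<in> borel_measurable borel" for n unfolding F_def[abs_def] by measurable
  have small: "norm (X + r n *\<^sub>R w) \<le> R + 1" if "norm w \<le> 1" "norm X \<le> R" for w X n
  proof -
    have "\<bar>r n\<bar> * norm w \<le> 1 * 1" using that(1) r(2)[of n] by (intro mult_mono) auto
    then have "norm (r n *\<^sub>R w) \<le> 1" by simp
    then show ?thesis using that(2) norm_triangle_ineq[of X "r n *\<^sub>R w"] by linarith
  qed
  have Fb: "\<bar>F n (w, X)\<bar> \<le> (2 * B) * (indicator (cball 0 1) w * indicator (cball 0 R) X)" for n w X
  proof (cases "norm w \<le> 1 \<and> norm X \<le> R")
    case True
    then show ?thesis using B[OF small[of w X n]] B[of X] by (simp add: F_def)
  qed (auto simp: F_def)
  have Fi: "integrable lborel (F n)" for n by (rule integrable_lborel_product[OF Fm Fb])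
  have Fh: "F n (w, X) \<le> indicator (cball 0 1) w * norm (h (X + r n *\<^sub>R w) - h X)" for n w X
  proof (cases "norm w \<le> 1 \<and> norm X \<le> R")
    case True
    then show ?thesis using small[of w X n] by (simp add: F_def h_def)
  qed (auto simp: F_def)
  have F0: "F n z \<ge> 0" for n z by (simp add: F_def)
  define I where "I n w = (\<integral>X. norm (h (X + r n *\<^sub>R w) - h X) \<partial>lborel)" for n w
  have Im [measurable]: "I n \<in> borel_measurable borel" for n
    unfolding I_def by (rule lborel.borel_measurable_lebesgue_integral) (simp add: case_prod_beta')
  have Ii: "integrable lborel (\<lambda>X. norm (h (X + b) - h X))" for b
    by (intro integrable_norm Bochner_Integration.integrable_diff integrable_lborel_translation hi)
  have Ib: "\<bar>I n w\<bar> \<le> 2 * (\<integral>X. norm (h X) \<partial>lborel)" for n w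
  proof -
    have i: "integrable lborel (\<lambda>X. norm (h (X + r n *\<^sub>R w)))" "integrable lborel (\<lambda>X. norm (h X))"
      by (intro integrable_norm integrable_lborel_translation hi)+
    have "I n w \<le> (\<integral>X. norm (h (X + r n *\<^sub>R w)) + norm (h X) \<partial>lborel)"
      unfolding I_def by (intro integral_mono Ii Bochner_Integration.integrable_add i norm_triangle_ineq4)
    also have "\<dots> = 2 * (\<integral>X. norm (h X) \<partial>lborel)"
      using integral_lborel_translation[of "\<lambda>X. norm (h X)" "r n *\<^sub>R w"] i by simp
    moreover have "0 \<le> I n w" unfolding I_def by (intro integral_nonneg_AE AE_I2) auto
    ultimately show ?thesis by simp
  qed
  have I0: "(\<lambda>n. I n w) \<longlonglongrightarrow> 0" for w
    unfolding I_def using tendsto_scaleR[OF r(1) tendsto_const[of w]] by (intro L1_translation[OF hi]) simp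
  have "(\<lambda>n. \<integral>w. indicator (cball 0 1) w * I n w \<partial>lborel) \<longlonglongrightarrow> integral\<^sup>L lborel (\<lambda>_::'b. 0::real)"
  proof (rule integral_dominated_convergence[where w = "\<lambda>w. 2 * (\<integral>X. norm (h X) \<partial>lborel) * indicator (cball 0 1) w"])
    show "integrable lborel (\<lambda>w::'b. 2 * (\<integral>X. norm (h X) \<partial>lborel) * indicator (cball 0 1) w)"
      using emeasure_bounded_finite[OF bounded_cball] by (intro integrable_mult_right integrable_real_indicator) auto
    show "AE w in lborel. (\<lambda>n. indicator (cball 0 1) w * I n w) \<longlonglongrightarrow> 0"
      using tendsto_mult_right_zero[OF I0] by (intro AE_I2)
    show "AE w in lborel. norm (indicator (cball 0 1) w * I n w) \<le> 2 * (\<integral>X. norm (h X) \<partial>lborel) * indicator (cball 0 1) w" for n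
      using Ib by (intro AE_I2) (auto simp: indicator_def)
  qed auto
  then have lim: "(\<lambda>n. \<integral>w. indicator (cball 0 1) w * I n w \<partial>lborel) \<longlonglongrightarrow> 0" by simp
  have iI: "integrable lborel (\<lambda>w. indicator (cball 0 1) w * I n w)" for n
    by (rule integrable_lborel_bounded_support[where C = "2 * (\<integral>X. norm (h X) \<partial>lborel)" and R = 1])
      (use Ib in \<open>auto simp: indicator_def\<close>)
  have int_F_section: "(\<integral>X. F n (w, X) \<partial>lborel) \<le> indicator (cball 0 1) w * I n w" for n w
  proof -
    have Fsec: "norm (F n (w, X)) \<le> 2 * B * indicator (cball 0 R) X" for X
      using Fb[of n w X] B0 by (cases "norm w \<le> 1"; cases "norm X \<le> R") auto
    have "integrable lborel (\<lambda>X. F n (w, X))"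
      by (rule integrable_lborel_bounded_support[where C = "2 * B" and R = R])
        (use Fsec in auto)
    then have "(\<integral>X. F n (w, X) \<partial>lborel) \<le> (\<integral>X. indicator (cball 0 1) w * norm (h (X + r n *\<^sub>R w) - h X) \<partial>lborel)"
      by (intro integral_mono integrable_mult_right Ii Fh)
    then show ?thesis by (simp add: I_def)
  qed
  have "(\<integral>z. F n z \<partial>lborel) \<le> (\<integral>w. indicator (cball 0 1) w * I n w \<partial>lborel)" for n
  proof -
    have "integrable lborel (\<lambda>w. \<integral>X. F n (w, X) \<partial>lborel)"
      using lborel_pair.integrable_fst[of "\<lambda>w X. F n (w, X)"] Fi[of n] by (simp add: lborel_prod)
    then show ?thesis unfolding integral_lborel_product(1)[OF Fi] by (intro integral_mono iI int_F_section)
  qed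
  then have "(\<lambda>n. \<integral>z. F n z \<partial>lborel) \<longlonglongrightarrow> 0"
    by (intro tendsto_sandwich[OF _ _ tendsto_const lim] always_eventually allI integral_nonneg_AE AE_I2 F0)
  then show ?thesis unfolding F_def .
qed

text \<open>Convergence in the mean over pairs \<open>(w, X)\<close> becomes almost everywhere
  convergence after passing to a subsequence.\<close>

lemma AE_rescaled_translation_subseq:
  fixes v :: "'b::euclidean_space \<Rightarrow> real"
  assumes v [measurable]: "v \<in> borel_measurable borel" and C: "\<And>X. \<bar>v X\<bar> \<le> C"
    and r: "r \<longlonglongrightarrow> 0" "\<And>n. \<bar>r n\<bar> \<le> 1" and R: "R \<ge> 0"
  obtains s :: "nat \<Rightarrow> nat" where "strict_mono s"
    "AE z in lborel. norm (fst z) \<le> 1 \<and> norm (snd z) \<le> R \<longrightarrow> (\<lambda>n. v (snd z + r (s n) *\<^sub>R fst z)) \<longlonglongrightarrow> v (snd z)"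
proof -
  have [measurable]: "cball (0::'b) s \<in> sets borel" for s by simp
  define F where "F n z = indicator (cball 0 1) (fst z) * indicator (cball 0 R) (snd z) *
      (v (snd z + r n *\<^sub>R fst z) - v (snd z))" for n and z :: "'b \<times> 'b"
  have Fm: "F n \<in> borel_measurable borel" for n unfolding F_def[abs_def] by measurable
  have Fi: "integrable lborel (F n)" for n
  proof (rule integrable_lborel_product[OF Fm])
    show "\<bar>F n (w, X)\<bar> \<le> (2 * C) * (indicator (cball 0 1) w * indicator (cball 0 R) X)" for w X
      using C[of "X + r n *\<^sub>R w"] C[of X] by (auto simp: F_def indicator_def)
  qed
  have "(\<lambda>n. \<integral>z. norm (F n z) \<partial>lborel) \<longlonglongrightarrow> 0"
    using L1_rescaled_translation[OF v C r R] unfolding F_def by (simp add: abs_mult)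
  from tendsto_L1_AE_subseq[OF Fi this] obtain s where s: "strict_mono s" "AE z in lborel. (\<lambda>n. F (s n) z) \<longlonglongrightarrow> 0" by blast
  have "AE z in lborel. norm (fst z) \<le> 1 \<and> norm (snd z) \<le> R \<longrightarrow> (\<lambda>n. v (snd z + r (s n) *\<^sub>R fst z)) \<longlonglongrightarrow> v (snd z)"
    using s(2)
  proof eventually_elim
    case (elim z)
    show ?case
    proof
      assume "norm (fst z) \<le> 1 \<and> norm (snd z) \<le> R"
      then have "(\<lambda>n. v (snd z + r (s n) *\<^sub>R fst z) - v (snd z)) \<longlonglongrightarrow> 0" using elim by (simp add: F_def)
      then show "(\<lambda>n. v (snd z + r (s n) *\<^sub>R fst z)) \<longlonglongrightarrow> v (snd z)" by (simp add: LIM_zero_iff)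
    qed
  qed
  with s(1) show thesis by (rule that)
qed

text \<open>The sign may oscillate when \<open>a = b\<close>, but it is bounded and its factor then
  tends to 0; otherwise it is continuous at the limit.\<close>

lemma sgn_mult_tendsto:
  fixes a b :: real and B :: "'c::real_normed_vector"
  assumes b: "b' \<longlonglongrightarrow> b" and B: "B' \<longlonglongrightarrow> B" and zero: "a = b \<Longrightarrow> B = 0"
  shows "(\<lambda>n. sgn (a - b' n) *\<^sub>R B' n) \<longlonglongrightarrow> sgn (a - b) *\<^sub>R B"
proof (cases "a = b")
  case True
  have "(\<lambda>n. sgn (a - b' n) *\<^sub>R B' n) \<longlonglongrightarrow> 0"
  proof (rule Lim_null_comparison)
    show "\<forall>\<^sub>F n in sequentially. norm (sgn (a - b' n) *\<^sub>R B' n) \<le> norm (B' n)"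
      by (rule always_eventually) (auto simp: sgn_real_def)
    show "(\<lambda>n. norm (B' n)) \<longlonglongrightarrow> 0" using B zero[OF True] tendsto_norm_zero by blast
  qed
  then show ?thesis using True by simp
next
  case False
  then show ?thesis by (intro tendsto_intros b B) auto
qed

subsection \<open>Doubling of variables\<close>

text \<open>A test function on all of space-time bundled with a Borel gradient. Differentiability is
  required almost everywhere only, as for Lipschitz functions, whereas \<open>p\<close> vanishes at
  every point off the support, so that all integrands do.\<close>

definition test_function :: "('a::euclidean_space \<times> real \<Rightarrow> real) \<Rightarrow> ('a \<times> real \<Rightarrow> 'a \<times> real) \<Rightarrow> bool" where
  "test_function \<phi> p \<longleftrightarrow> (\<exists>L. L-lipschitz_on UNIV \<phi>) \<and> (\<forall>z. 0 \<le> \<phi> z) \<and>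
     (\<exists>R \<tau>. 0 < \<tau> \<and> (\<forall>z. norm z > R \<or> snd z < \<tau> \<longrightarrow> \<phi> z = 0 \<and> p z = 0)) \<and>
     p \<in> borel_measurable borel \<and> (\<exists>M. \<forall>z. norm (p z) \<le> M) \<and>
     (AE z in lborel. (\<phi> has_derivative (\<lambda>h. h \<bullet> p z)) (at z))"

context flux begin

text \<open>Quantified over all real \<open>c\<close>, so that \<open>c\<close> can be the value of
  the other solution at a frozen point.\<close>

definition kruzkov :: "('a \<times> real \<Rightarrow> real) \<Rightarrow> bool" where
  "kruzkov v \<longleftrightarrow> (\<forall>\<phi> p c. test_function \<phi> p \<longrightarrow>
     0 \<le> (\<integral>z. snd (p z) * \<bar>v z - c\<bar> + sgn (v z - c) *
      (fst (p z) \<bullet> (f (fst z) (v z) - f (fst z) c) - \<phi> z * div_f (fst z) c) \<partial>lborel))"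

lemma entropy_solution_imp_kruzkov:
  assumes sol: "entropy_solution f {0<..} u0 u"
    and v: "v \<in> borel_measurable borel" and vC: "\<And>z. \<bar>v z\<bar> \<le> C"
    and uv: "AE z in lborel. snd z > 0 \<longrightarrow> u z = v z"
  shows "kruzkov v"
  unfolding kruzkov_def
proof (intro allI impI)
  fix \<phi> :: "'a \<times> real \<Rightarrow> real" and p c
  assume "test_function \<phi> p"
  then obtain L R \<tau> M where L: "L-lipschitz_on UNIV \<phi>" and nn: "\<forall>z. 0 \<le> \<phi> z"
    and \<tau>: "0 < \<tau>" and zero: "\<forall>z. norm z > R \<or> snd z < \<tau> \<longrightarrow> \<phi> z = 0 \<and> p z = 0"
    and p: "p \<in> borel_measurable borel" and M: "\<forall>z. norm (p z) \<le> M"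
    and d: "AE z in lborel. (\<phi> has_derivative (\<lambda>h. h \<bullet> p z)) (at z)"
    unfolding test_function_def by (elim conjE exE)
  have pM: "norm (p z) \<le> M * indicator (cball 0 R) z" for z
    using M[THEN spec, of z] zero[THEN spec, of z] by (cases "norm z \<le> R") auto
  show "0 \<le> (\<integral>z. snd (p z) * \<bar>v z - c\<bar> + sgn (v z - c) *
      (fst (p z) \<bullet> (f (fst z) (v z) - f (fst z) c) - \<phi> z * div_f (fst z) c) \<partial>lborel)"
    by (rule kruzkov_inequality[OF sol v vC uv L _ _ \<tau> p pM _ d]) (use nn zero \<tau> in auto)
qed

lemma D_representation: "D x k v = (\<Sum>b\<in>Basis. (v \<bullet> b) *\<^sub>R D x k b)"
proof -
  have "D x k v = D x k (\<Sum>b\<in>Basis. (v \<bullet> b) *\<^sub>R b)" by (simp add: euclidean_representation)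
  also have "\<dots> = (\<Sum>b\<in>Basis. (v \<bullet> b) *\<^sub>R D x k b)"
    by (simp add: linear_sum[OF D_linear] linear_scale[OF D_linear])
  finally show ?thesis .
qed

lemma D_borel [measurable (raw)]:
  assumes [measurable]: "a \<in> borel_measurable M" "b \<in> borel_measurable M" "c \<in> borel_measurable M"
  shows "(\<lambda>z. D (a z) (b z) (c z)) \<in> borel_measurable M"
  unfolding D_representation[of "a _" "b _" "c _"] by measurable

text \<open>Approximation uniform over states of modulus at most \<open>C\<close> replaces the
  quotient by \<open>D x (k' n) z\<close>, whatever \<open>k' n\<close> is; continuity of
  \<open>D\<close> in the state then gives the limit.\<close>

lemma difference_quotient_tendsto:
  assumes x: "x \<notin> N" and k: "k' \<longlonglongrightarrow> k" "\<And>n. \<bar>k' n\<bar> \<le> C" and e: "e \<longlonglongrightarrow> 0" "\<And>n. e n > 0"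
  shows "(\<lambda>n. (f x (k' n) - f (x - e n *\<^sub>R z) (k' n)) /\<^sub>R e n) \<longlonglongrightarrow> D x k z"
proof -
  have "(\<lambda>n. (f x (k' n) - f (x - e n *\<^sub>R z) (k' n)) /\<^sub>R e n - D x (k' n) z) \<longlonglongrightarrow> 0"
  proof (rule LIMSEQ_I)
    fix \<epsilon> :: real assume \<epsilon>: "\<epsilon> > 0"
    define \<epsilon>' where "\<epsilon>' = \<epsilon> / (norm z + 1)"
    have z1: "norm z + 1 > 0" using norm_ge_zero[of z] by linarith
    have "\<epsilon>' > 0" using \<epsilon> z1 by (simp add: \<epsilon>'_def)
    from D_approx[OF x this, of C] obtain d where d: "d > 0"
      "\<forall>y k. \<bar>k\<bar> \<le> C \<and> norm (y - x) < d \<longrightarrow> norm (f y k - f x k - D x k (y - x)) \<le> \<epsilon>' * norm (y - x)" by blast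
    have "(\<lambda>n. e n *\<^sub>R z) \<longlonglongrightarrow> 0" using tendsto_scaleR[OF e(1) tendsto_const[of z]] by simp
    from LIMSEQ_D[OF this d(1)] obtain no where no: "\<And>n. n \<ge> no \<Longrightarrow> norm (e n *\<^sub>R z) < d" by auto
    have "norm ((f x (k' n) - f (x - e n *\<^sub>R z) (k' n)) /\<^sub>R e n - D x (k' n) z - 0) < \<epsilon>" if n: "n \<ge> no" for n
    proof -
      have en: "e n > 0" by (rule e(2))
      have "norm (f (x - e n *\<^sub>R z) (k' n) - f x (k' n) - D x (k' n) (- (e n *\<^sub>R z))) \<le> \<epsilon>' * norm (e n *\<^sub>R z)"
        using d(2)[rule_format, of "k' n" "x - e n *\<^sub>R z"] k(2)[of n] no[OF n] by simp
      also have "D x (k' n) (- (e n *\<^sub>R z)) = - (e n *\<^sub>R D x (k' n) z)"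
        by (simp add: linear_neg[OF D_linear] linear_scale[OF D_linear])
      finally have 1: "norm (f x (k' n) - f (x - e n *\<^sub>R z) (k' n) - e n *\<^sub>R D x (k' n) z) \<le> \<epsilon>' * (e n * norm z)"
        using en by (simp add: norm_minus_commute algebra_simps)
      have "(f x (k' n) - f (x - e n *\<^sub>R z) (k' n)) /\<^sub>R e n - D x (k' n) z
        = (f x (k' n) - f (x - e n *\<^sub>R z) (k' n) - e n *\<^sub>R D x (k' n) z) /\<^sub>R e n"
        using en by (simp add: scaleR_diff_right)
      then have "norm ((f x (k' n) - f (x - e n *\<^sub>R z) (k' n)) /\<^sub>R e n - D x (k' n) z)
         = norm (f x (k' n) - f (x - e n *\<^sub>R z) (k' n) - e n *\<^sub>R D x (k' n) z) / e n"
        using en by (simp add: divide_inverse mult.commute)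
      also have "\<dots> \<le> (\<epsilon>' * (e n * norm z)) / e n" using 1 en by (intro divide_right_mono) auto
      also have "\<dots> = \<epsilon>' * norm z" using en by simp
      also have "\<dots> < \<epsilon>' * (norm z + 1)" using \<open>\<epsilon>' > 0\<close> by simp
      also have "\<dots> = \<epsilon>" using z1 by (simp add: \<epsilon>'_def)
      finally show ?thesis by simp
    qed
    then show "\<exists>no. \<forall>n\<ge>no. norm ((f x (k' n) - f (x - e n *\<^sub>R z) (k' n)) /\<^sub>R e n - D x (k' n) z - 0) < \<epsilon>" by blast
  qed
  moreover have "(\<lambda>n. D x (k' n) z) \<longlonglongrightarrow> D x k z"
    using continuous_on_tendsto_compose[OF D_cont k(1)] by simp
  ultimately show ?thesis using tendsto_add by fastforce
qed

end

text \<open>Standing data after the reduction: \<open>u\<close> and \<open>v\<close> are Borel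
  representatives with a common bound, \<open>p\<close> is the gradient of \<open>\<psi>\<close>,
  and \<tau> is a lower bound for the times in its support, which limits the mollification
  radius.\<close>

locale doubling = flux f D N for f :: "'a::euclidean_space \<Rightarrow> real \<Rightarrow> 'a" and D N +
  fixes u v \<psi> :: "'a \<times> real \<Rightarrow> real" and p :: "'a \<times> real \<Rightarrow> 'a \<times> real" and C R \<tau> L M :: real
  assumes u_borel [measurable]: "u \<in> borel_measurable borel" and v_borel [measurable]: "v \<in> borel_measurable borel"
    and uC: "\<And>z. \<bar>u z\<bar> \<le> C" and vC: "\<And>z. \<bar>v z\<bar> \<le> C"
    and kruzkov_u: "kruzkov u" and kruzkov_v: "kruzkov v"
    and \<psi>_lip: "L-lipschitz_on UNIV \<psi>" and \<psi>_nonneg: "\<And>z. 0 \<le> \<psi> z"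
    and \<tau>: "\<tau> > 0" and R: "R \<ge> 0" and zero: "\<And>z. norm z > R \<or> snd z < \<tau> \<Longrightarrow> \<psi> z = 0 \<and> p z = 0"
    and p_borel [measurable]: "p \<in> borel_measurable borel" and pM: "\<And>z. norm (p z) \<le> M"
    and \<psi>_deriv: "AE z in lborel. (\<psi> has_derivative (\<lambda>h. h \<bullet> p z)) (at z)"
begin

text \<open>Gradients in \<open>X\<close> and in \<open>Y\<close> of
  \<open>\<psi> X * moll w\<close> with \<open>w = (X - Y) /\<^sub>R \<epsilon>\<close>. Keeping
  \<open>w\<close> as a separate argument makes the later change of variables a plain
  instantiation.\<close>

definition grad_X where "grad_X \<epsilon> w X = moll w *\<^sub>R p X + (\<psi> X / \<epsilon>) *\<^sub>R (moll' w *\<^sub>R w)"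
definition grad_Y where "grad_Y \<epsilon> w X = - ((\<psi> X / \<epsilon>) *\<^sub>R (moll' w *\<^sub>R w))"

text \<open>Integrand of the inequality for \<open>u\<close> in \<open>X\<close> with constant
  \<open>v Y\<close>; its companion \<open>ineq_v\<close> belongs to \<open>v\<close> in
  \<open>Y\<close> with constant \<open>u X\<close>.\<close>

definition ineq_u where
  "ineq_u \<epsilon> w X Y = snd (grad_X \<epsilon> w X) * \<bar>u X - v Y\<bar> + sgn (u X - v Y) *
     (fst (grad_X \<epsilon> w X) \<bullet> (f (fst X) (u X) - f (fst X) (v Y)) - (\<psi> X * moll w) * div_f (fst X) (v Y))"

definition ineq_v where
  "ineq_v \<epsilon> w X Y = snd (grad_Y \<epsilon> w X) * \<bar>v Y - u X\<bar> + sgn (v Y - u X) *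
     (fst (grad_Y \<epsilon> w X) \<bullet> (f (fst Y) (v Y) - f (fst Y) (u X)) - (\<psi> X * moll w) * div_f (fst Y) (u X))"

lemma \<psi>_borel [measurable]: "\<psi> \<in> borel_measurable borel"
  by (rule borel_measurable_continuous_onI[OF lipschitz_on_continuous_on[OF \<psi>_lip]])

lemma C0: "C \<ge> 0" using uC[of 0] by linarith

lemma M0: "M \<ge> 0" using pM[of 0] norm_ge_zero[of "p 0"] by linarith

lemma \<psi>_bound: "\<exists>K\<ge>0. \<forall>z. \<psi> z \<le> K"
proof -
  have "bounded (\<psi> ` cball 0 R)"
    by (intro compact_imp_bounded compact_continuous_image
        continuous_on_subset[OF lipschitz_on_continuous_on[OF \<psi>_lip]]) auto
  then obtain K where K: "\<forall>z\<in>cball 0 R. \<bar>\<psi> z\<bar> \<le> K" unfolding bounded_iff by auto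
  have "\<psi> z \<le> \<bar>K\<bar>" for z
    using K[rule_format, of z] zero[of z] by (cases "norm z \<le> R") auto
  then show ?thesis by (intro exI[of _ "\<bar>K\<bar>"]) auto
qed

text \<open>Some nonnegative upper bound of \<open>\<psi>\<close>, not necessarily the
  least.\<close>

definition sup_\<psi> where "sup_\<psi> = (SOME K. K \<ge> 0 \<and> (\<forall>z. \<psi> z \<le> K))"

lemma sup_\<psi>: "sup_\<psi> \<ge> 0" "\<psi> z \<le> sup_\<psi>"
  using someI_ex[of "\<lambda>K. K \<ge> 0 \<and> (\<forall>z. \<psi> z \<le> K)"] \<psi>_bound unfolding sup_\<psi>_def by blast+

section \<open>The doubled test function in each of its two variables\<close>

lemma moll_shift_has_derivative:
  assumes "\<epsilon> > 0"
  shows "((\<lambda>X. moll ((X - Y) /\<^sub>R \<epsilon>)) has_derivative (\<lambda>h. h \<bullet> ((moll' ((X - Y) /\<^sub>R \<epsilon>) *\<^sub>R ((X - Y) /\<^sub>R \<epsilon>)) /\<^sub>R \<epsilon>))) (at X)"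
    and "((\<lambda>Y. moll ((X - Y) /\<^sub>R \<epsilon>)) has_derivative (\<lambda>h. h \<bullet> - ((moll' ((X - Y) /\<^sub>R \<epsilon>) *\<^sub>R ((X - Y) /\<^sub>R \<epsilon>)) /\<^sub>R \<epsilon>))) (at Y)"
proof -
  have "((\<lambda>X. (X - Y) /\<^sub>R \<epsilon>) has_derivative (\<lambda>h. h /\<^sub>R \<epsilon>)) (at X)"
    by (auto intro!: derivative_eq_intros)
  from has_derivative_compose[OF this moll_has_derivative]
  show "((\<lambda>X. moll ((X - Y) /\<^sub>R \<epsilon>)) has_derivative (\<lambda>h. h \<bullet> ((moll' ((X - Y) /\<^sub>R \<epsilon>) *\<^sub>R ((X - Y) /\<^sub>R \<epsilon>)) /\<^sub>R \<epsilon>))) (at X)"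
    by (rule has_derivative_eq_rhs) (simp add: fun_eq_iff)
  have "((\<lambda>Y. (X - Y) /\<^sub>R \<epsilon>) has_derivative (\<lambda>h. (- h) /\<^sub>R \<epsilon>)) (at Y)"
    by (auto intro!: derivative_eq_intros)
  from has_derivative_compose[OF this moll_has_derivative]
  show "((\<lambda>Y. moll ((X - Y) /\<^sub>R \<epsilon>)) has_derivative (\<lambda>h. h \<bullet> - ((moll' ((X - Y) /\<^sub>R \<epsilon>) *\<^sub>R ((X - Y) /\<^sub>R \<epsilon>)) /\<^sub>R \<epsilon>))) (at Y)"
    by (rule has_derivative_eq_rhs) (simp add: fun_eq_iff)
qed

lemma moll_shift_lipschitz:
  assumes "\<epsilon> > 0"
  shows "\<bar>moll ((X - Y) /\<^sub>R \<epsilon>) - moll ((X' - Y') /\<^sub>R \<epsilon>)\<bar> \<le> 4 / \<epsilon> * norm (X - X' - (Y - Y') :: 'a \<times> real)"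
proof -
  have "\<bar>moll ((X - Y) /\<^sub>R \<epsilon>) - moll ((X' - Y') /\<^sub>R \<epsilon>)\<bar> \<le> 4 * norm ((X - Y) /\<^sub>R \<epsilon> - (X' - Y') /\<^sub>R \<epsilon>)"
    using lipschitz_onD[OF moll_lipschitz, of "(X - Y) /\<^sub>R \<epsilon>" "(X' - Y') /\<^sub>R \<epsilon>"] by (simp add: dist_norm)
  also have "(X - Y) /\<^sub>R \<epsilon> - (X' - Y') /\<^sub>R \<epsilon> = (X - X' - (Y - Y')) /\<^sub>R \<epsilon>"
    by (simp flip: scaleR_diff_right)
  finally show ?thesis using assms by (simp add: divide_inverse mult_ac)
qed

lemma norm_scaled_moll': "\<epsilon> > 0 \<Longrightarrow> norm ((\<psi> X / \<epsilon>) *\<^sub>R (moll' w *\<^sub>R w)) \<le> sup_\<psi> / \<epsilon> * 4"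
  unfolding norm_scaleR[of "\<psi> X / \<epsilon>"] using sup_\<psi>(1) sup_\<psi>(2)[of X] \<psi>_nonneg[of X]
  by (intro mult_mono norm_moll'_scaleR) (auto intro: divide_right_mono)

lemma grad_bounds:
  assumes "\<epsilon> > 0"
  shows "norm (grad_X \<epsilon> w X) \<le> M + sup_\<psi> / \<epsilon> * 4" "norm (grad_Y \<epsilon> w X) \<le> sup_\<psi> / \<epsilon> * 4"
proof -
  have "norm (moll w *\<^sub>R p X) \<le> 1 * M"
    unfolding norm_scaleR using moll_bounds[of w] pM[of X] by (intro mult_mono) auto
  then show "norm (grad_X \<epsilon> w X) \<le> M + sup_\<psi> / \<epsilon> * 4"
    unfolding grad_X_def using norm_scaled_moll'[OF assms, of X w] by (intro norm_triangle_le add_mono) auto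
  show "norm (grad_Y \<epsilon> w X) \<le> sup_\<psi> / \<epsilon> * 4"
    unfolding grad_Y_def norm_minus_cancel by (rule norm_scaled_moll'[OF assms])
qed

lemma grad_borel [measurable (raw)]:
  assumes [measurable]: "a \<in> borel_measurable Q" "b \<in> borel_measurable Q"
  shows "(\<lambda>z. grad_X \<epsilon> (a z) (b z)) \<in> borel_measurable Q" "(\<lambda>z. grad_Y \<epsilon> (a z) (b z)) \<in> borel_measurable Q"
  unfolding grad_X_def grad_Y_def by measurable

lemma ineq_borel [measurable (raw)]:
  assumes [measurable]: "a \<in> borel_measurable Q" "b \<in> borel_measurable Q" "c \<in> borel_measurable Q"
  shows "(\<lambda>z. ineq_u \<epsilon> (a z) (b z) (c z)) \<in> borel_measurable Q" "(\<lambda>z. ineq_v \<epsilon> (a z) (b z) (c z)) \<in> borel_measurable Q"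
  unfolding ineq_u_def ineq_v_def by measurable

lemma test_function_X:
  assumes \<epsilon>: "\<epsilon> > 0"
  shows "test_function (\<lambda>X. \<psi> X * moll ((X - Y) /\<^sub>R \<epsilon>)) (\<lambda>X. grad_X \<epsilon> ((X - Y) /\<^sub>R \<epsilon>) X)"
  unfolding test_function_def
proof (intro conjI allI)
  show "\<exists>L. L-lipschitz_on UNIV (\<lambda>X. \<psi> X * moll ((X - Y) /\<^sub>R \<epsilon>))"
  proof (intro exI lipschitz_onI)
    show "0 \<le> sup_\<psi> * (4 / \<epsilon>) + L" using sup_\<psi>(1) \<epsilon> lipschitz_on_nonneg[OF \<psi>_lip] by simp
    fix X X'
    let ?m = "\<lambda>X. moll ((X - Y) /\<^sub>R \<epsilon>)"
    have "\<bar>\<psi> X * ?m X - \<psi> X' * ?m X'\<bar> = \<bar>\<psi> X * (?m X - ?m X') + (\<psi> X - \<psi> X') * ?m X'\<bar>"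
      by (simp add: algebra_simps)
    also have "\<dots> \<le> \<bar>\<psi> X\<bar> * \<bar>?m X - ?m X'\<bar> + \<bar>\<psi> X - \<psi> X'\<bar> * \<bar>?m X'\<bar>"
      unfolding abs_mult[symmetric] by (rule abs_triangle_ineq)
    also have "\<dots> \<le> sup_\<psi> * (4 / \<epsilon> * norm (X - X')) + (L * norm (X - X')) * 1"
    proof (intro add_mono mult_mono)
      show "\<bar>\<psi> X\<bar> \<le> sup_\<psi>" using sup_\<psi>(2)[of X] \<psi>_nonneg[of X] by simp
      show "\<bar>?m X - ?m X'\<bar> \<le> 4 / \<epsilon> * norm (X - X')" using moll_shift_lipschitz[OF \<epsilon>, of X Y X' Y] by simp
      show "\<bar>\<psi> X - \<psi> X'\<bar> \<le> L * norm (X - X')" using lipschitz_onD[OF \<psi>_lip, of X X'] by (simp add: dist_norm)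
      show "\<bar>?m X'\<bar> \<le> 1" using moll_bounds[of "(X' - Y) /\<^sub>R \<epsilon>"] by simp
    qed (use sup_\<psi>(1) lipschitz_on_nonneg[OF \<psi>_lip] in auto)
    finally show "dist (\<psi> X * ?m X) (\<psi> X' * ?m X') \<le> (sup_\<psi> * (4 / \<epsilon>) + L) * dist X X'"
      by (simp add: dist_norm algebra_simps)
  qed
  show "0 \<le> \<psi> X * moll ((X - Y) /\<^sub>R \<epsilon>)" for X using \<psi>_nonneg moll_bounds by (intro mult_nonneg_nonneg)
  show "\<exists>R \<tau>. 0 < \<tau> \<and> (\<forall>X. norm X > R \<or> snd X < \<tau> \<longrightarrow> \<psi> X * moll ((X - Y) /\<^sub>R \<epsilon>) = 0 \<and> grad_X \<epsilon> ((X - Y) /\<^sub>R \<epsilon>) X = 0)"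
    using zero \<tau> by (intro exI[of _ R] exI[of _ \<tau>]) (auto simp: grad_X_def)
  show "(\<lambda>X. grad_X \<epsilon> ((X - Y) /\<^sub>R \<epsilon>) X) \<in> borel_measurable borel" by measurable
  show "\<exists>M. \<forall>X. norm (grad_X \<epsilon> ((X - Y) /\<^sub>R \<epsilon>) X) \<le> M" using grad_bounds(1)[OF \<epsilon>] by blast
  show "AE X in lborel. ((\<lambda>X. \<psi> X * moll ((X - Y) /\<^sub>R \<epsilon>)) has_derivative (\<lambda>h. h \<bullet> grad_X \<epsilon> ((X - Y) /\<^sub>R \<epsilon>) X)) (at X)"
    using \<psi>_deriv
  proof eventually_elim
    case (elim X)
    show ?case
      by (rule has_derivative_eq_rhs[OF has_derivative_mult[OF elim moll_shift_has_derivative(1)[OF \<epsilon>]]])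
        (simp add: fun_eq_iff grad_X_def inner_add_right divide_inverse mult_ac)
  qed
qed

text \<open>The mollifier confines \<open>Y\<close> to distance \<epsilon> from \<open>X\<close>, so
  the support may reach down to time \<tau> - \<epsilon>, which must stay positive.\<close>

lemma test_function_Y:
  assumes \<epsilon>: "\<epsilon> > 0" "\<epsilon> < \<tau>"
  shows "test_function (\<lambda>Y. \<psi> X * moll ((X - Y) /\<^sub>R \<epsilon>)) (\<lambda>Y. grad_Y \<epsilon> ((X - Y) /\<^sub>R \<epsilon>) X)"
  unfolding test_function_def
proof (intro conjI allI)
  show "\<exists>L. L-lipschitz_on UNIV (\<lambda>Y. \<psi> X * moll ((X - Y) /\<^sub>R \<epsilon>))"
  proof (intro exI lipschitz_onI)
    show "0 \<le> sup_\<psi> * (4 / \<epsilon>)" using sup_\<psi>(1) \<epsilon> by simp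
    fix Y Y'
    have "\<bar>\<psi> X\<bar> * \<bar>moll ((X - Y) /\<^sub>R \<epsilon>) - moll ((X - Y') /\<^sub>R \<epsilon>)\<bar> \<le> sup_\<psi> * (4 / \<epsilon> * norm (Y - Y'))"
      using sup_\<psi> \<psi>_nonneg[of X] moll_shift_lipschitz[OF \<epsilon>(1), of X Y X Y']
      by (intro mult_mono) (auto simp: norm_minus_commute)
    then show "dist (\<psi> X * moll ((X - Y) /\<^sub>R \<epsilon>)) (\<psi> X * moll ((X - Y') /\<^sub>R \<epsilon>)) \<le> sup_\<psi> * (4 / \<epsilon>) * dist Y Y'"
      unfolding dist_real_def right_diff_distrib[symmetric] abs_mult dist_norm by (simp only: mult.assoc)
  qed
  show "0 \<le> \<psi> X * moll ((X - Y) /\<^sub>R \<epsilon>)" for Y using \<psi>_nonneg moll_bounds by (intro mult_nonneg_nonneg)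
  show "\<exists>R \<tau>. 0 < \<tau> \<and> (\<forall>Y. norm Y > R \<or> snd Y < \<tau> \<longrightarrow> \<psi> X * moll ((X - Y) /\<^sub>R \<epsilon>) = 0 \<and> grad_Y \<epsilon> ((X - Y) /\<^sub>R \<epsilon>) X = 0)"
  proof (rule exI[of _ "R + \<epsilon>"], rule exI[of _ "\<tau> - \<epsilon>"], intro conjI allI impI)
    show "0 < \<tau> - \<epsilon>" using \<epsilon> by simp
    fix Y :: "'a \<times> real" assume Y: "norm Y > R + \<epsilon> \<or> snd Y < \<tau> - \<epsilon>"
    have "\<psi> X = 0 \<or> norm ((X - Y) /\<^sub>R \<epsilon>) > 1"
    proof (cases "norm X > R \<or> snd X < \<tau>")
      case False
      have "norm Y \<le> norm X + norm (X - Y)" by (metis norm_minus_commute norm_triangle_sub)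
      moreover have "\<bar>snd X - snd Y\<bar> \<le> norm (X - Y)"
        using norm_snd_le[of "snd (X - Y)" "fst (X - Y)"] unfolding prod.collapse by simp
      ultimately have "norm (X - Y) > \<epsilon>" using Y False by linarith
      moreover have "norm ((X - Y) /\<^sub>R \<epsilon>) = norm (X - Y) / \<epsilon>" using \<epsilon>(1) by (simp add: divide_inverse mult.commute)
      ultimately show ?thesis using \<epsilon>(1) by (simp add: pos_less_divide_eq)
    qed (use zero in blast)
    then show "\<psi> X * moll ((X - Y) /\<^sub>R \<epsilon>) = 0" "grad_Y \<epsilon> ((X - Y) /\<^sub>R \<epsilon>) X = 0"
      using moll_outside[of "(X - Y) /\<^sub>R \<epsilon>"] by (auto simp: grad_Y_def)
  qed
  show "(\<lambda>Y. grad_Y \<epsilon> ((X - Y) /\<^sub>R \<epsilon>) X) \<in> borel_measurable borel" by measurable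
  show "\<exists>M. \<forall>Y. norm (grad_Y \<epsilon> ((X - Y) /\<^sub>R \<epsilon>) X) \<le> M" using grad_bounds(2)[OF \<epsilon>(1)] by blast
  show "AE Y in lborel. ((\<lambda>Y. \<psi> X * moll ((X - Y) /\<^sub>R \<epsilon>)) has_derivative (\<lambda>h. h \<bullet> grad_Y \<epsilon> ((X - Y) /\<^sub>R \<epsilon>) X)) (at Y)"
  proof (rule AE_I2)
    fix Y
    show "((\<lambda>Y. \<psi> X * moll ((X - Y) /\<^sub>R \<epsilon>)) has_derivative (\<lambda>h. h \<bullet> grad_Y \<epsilon> ((X - Y) /\<^sub>R \<epsilon>) X)) (at Y)"
      by (rule has_derivative_eq_rhs[OF has_derivative_mult_right[OF moll_shift_has_derivative(2)[OF \<epsilon>(1)]]])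
        (simp add: fun_eq_iff grad_Y_def divide_inverse mult_ac)
  qed
qed

lemma ineq_u_integral_nonneg: "\<epsilon> > 0 \<Longrightarrow> 0 \<le> (\<integral>X. ineq_u \<epsilon> ((X - Y) /\<^sub>R \<epsilon>) X Y \<partial>lborel)"
  using kruzkov_u[unfolded kruzkov_def, rule_format, OF test_function_X, of \<epsilon> Y "v Y"] unfolding ineq_u_def .

lemma ineq_v_integral_nonneg: "\<epsilon> > 0 \<Longrightarrow> \<epsilon> < \<tau> \<Longrightarrow> 0 \<le> (\<integral>Y. ineq_v \<epsilon> ((X - Y) /\<^sub>R \<epsilon>) X Y \<partial>lborel)"
  using kruzkov_v[unfolded kruzkov_def, rule_format, OF test_function_Y, of \<epsilon> X "u X"] unfolding ineq_v_def .

text \<open>Radius \<open>R + 1\<close> covers points \<open>X\<close> of the support together with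
  \<open>X - \<epsilon> *\<^sub>R w\<close> for \<epsilon> and \<open>norm w\<close> at most
  1.\<close>

lemma uniform_bounds:
  obtains K where "K \<ge> 0"
    "\<forall>x k. norm x \<le> R + 1 \<and> \<bar>k\<bar> \<le> C \<longrightarrow> norm (f x k) \<le> K \<and> \<bar>div_f x k\<bar> \<le> K"
    "\<forall>x y k. norm x \<le> R + 1 \<and> norm y \<le> R + 1 \<and> \<bar>k\<bar> \<le> C \<longrightarrow> norm (f x k - f y k) \<le> K * norm (x - y)"
proof -
  let ?Q = "max (R + 1) C"
  obtain Kf where Kf: "Kf \<ge> 0" "\<forall>x k. norm x \<le> ?Q \<and> \<bar>k\<bar> \<le> ?Q \<longrightarrow> norm (f x k) \<le> Kf" using f_bound by blast
  obtain Kg where Kg: "Kg \<ge> 0" "\<forall>x k. norm x \<le> ?Q \<and> \<bar>k\<bar> \<le> ?Q \<longrightarrow> \<bar>div_f x k\<bar> \<le> Kg" using div_f_bound by blast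
  obtain L where L: "L \<ge> 0" "\<forall>x y k l. norm x \<le> ?Q \<and> norm y \<le> ?Q \<and> \<bar>k\<bar> \<le> ?Q \<and> \<bar>l\<bar> \<le> ?Q \<longrightarrow>
      norm (f x k - f y l) \<le> L * (norm (x - y) + \<bar>k - l\<bar>)" using f_lip by blast
  show thesis
  proof (rule that[of "Kf + Kg + L"], goal_cases)
    case 2
    show ?case
    proof (intro allI impI)
      fix x :: 'a and k assume "norm x \<le> R + 1 \<and> \<bar>k\<bar> \<le> C"
      then have "norm x \<le> ?Q \<and> \<bar>k\<bar> \<le> ?Q" by auto
      from Kf(2)[rule_format, OF this] Kg(2)[rule_format, OF this] Kf(1) Kg(1) L(1)
      show "norm (f x k) \<le> Kf + Kg + L \<and> \<bar>div_f x k\<bar> \<le> Kf + Kg + L" by linarith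
    qed
  next
    case 3
    show ?case
    proof (intro allI impI)
      fix x y :: 'a and k assume "norm x \<le> R + 1 \<and> norm y \<le> R + 1 \<and> \<bar>k\<bar> \<le> C"
      then have "norm x \<le> ?Q \<and> norm y \<le> ?Q \<and> \<bar>k\<bar> \<le> ?Q \<and> \<bar>k\<bar> \<le> ?Q" by auto
      from L(2)[rule_format, OF this] have "norm (f x k - f y k) \<le> L * norm (x - y)" by simp
      also have "\<dots> \<le> (Kf + Kg + L) * norm (x - y)" using Kf(1) Kg(1) by (intro mult_right_mono) auto
      finally show "norm (f x k - f y k) \<le> (Kf + Kg + L) * norm (x - y)" .
    qed
  qed (use Kf(1) Kg(1) L(1) in auto)
qed

lemma kruzkov_term_bound:
  assumes "\<bar>a\<bar> \<le> C" "\<bar>b\<bar> \<le> C" "norm P \<le> Kp" "norm F1 \<le> K" "norm F2 \<le> K" "\<bar>G\<bar> \<le> K" "0 \<le> s" "s \<le> sup_\<psi>"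
  shows "\<bar>snd (P :: 'a \<times> real) * \<bar>a - b\<bar> + sgn (a - b) * (fst P \<bullet> (F1 - F2) - s * G)\<bar> \<le> Kp * (2 * C) + (Kp * (2 * K) + sup_\<psi> * K)"
proof -
  have Kp: "0 \<le> Kp" using assms(3) norm_ge_zero[of P] by linarith
  have K: "0 \<le> K" using assms(6) by linarith
  have P: "\<bar>snd P\<bar> \<le> Kp" "norm (fst P) \<le> Kp"
    using assms(3) norm_snd_le[of "snd P" "fst P"] norm_fst_le[of "fst P" "snd P"] by auto
  have 1: "\<bar>snd P * \<bar>a - b\<bar>\<bar> \<le> Kp * (2 * C)"
    unfolding abs_mult using P assms(1,2) Kp by (intro mult_mono) auto
  have "norm (F1 - F2) \<le> 2 * K" using norm_triangle_ineq4[of F1 F2] assms(4,5) by linarith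
  then have 2: "\<bar>fst P \<bullet> (F1 - F2)\<bar> \<le> Kp * (2 * K)"
    using Cauchy_Schwarz_ineq2[of "fst P" "F1 - F2"] mult_mono[OF P(2), of "norm (F1 - F2)" "2 * K"] Kp by force
  have 3: "\<bar>s * G\<bar> \<le> sup_\<psi> * K" unfolding abs_mult using assms(6-8) sup_\<psi>(1) by (intro mult_mono) auto
  have "\<bar>sgn (a - b) * (fst P \<bullet> (F1 - F2) - s * G)\<bar> \<le> 1 * (Kp * (2 * K) + sup_\<psi> * K)"
    unfolding abs_mult using 2 3 by (intro mult_mono) (auto simp: sgn_real_def)
  from order_trans[OF abs_triangle_ineq add_mono[OF 1 this]] show ?thesis by simp
qed

text \<open>This bound grows like 1 / \<epsilon> and serves Fubini's theorem at fixed \<epsilon>;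
  the limit rests on \<open>doubled_bounds\<close>.\<close>

lemma ineq_bound:
  assumes \<epsilon>: "0 < \<epsilon>" "\<epsilon> \<le> 1"
  obtains K where "\<forall>X Y. \<bar>ineq_u \<epsilon> ((X - Y) /\<^sub>R \<epsilon>) X Y\<bar> \<le> K * (indicator (cball 0 1) ((X - Y) /\<^sub>R \<epsilon>) * indicator (cball 0 R) X)"
    "\<forall>X Y. \<bar>ineq_v \<epsilon> ((X - Y) /\<^sub>R \<epsilon>) X Y\<bar> \<le> K * (indicator (cball 0 1) ((X - Y) /\<^sub>R \<epsilon>) * indicator (cball 0 R) X)"
proof -
  obtain K where K: "K \<ge> 0"
    "\<forall>x k. norm x \<le> R + 1 \<and> \<bar>k\<bar> \<le> C \<longrightarrow> norm (f x k) \<le> K \<and> \<bar>div_f x k\<bar> \<le> K" using uniform_bounds by metis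
  define Kp where "Kp = M + sup_\<psi> / \<epsilon> * 4"
  define Q where "Q = Kp * (2 * C) + (Kp * (2 * K) + sup_\<psi> * K)"
  have P: "norm (grad_X \<epsilon> w X) \<le> Kp" "norm (grad_Y \<epsilon> w X) \<le> Kp" for w X
    using grad_bounds[OF \<epsilon>(1), of w X] M0 unfolding Kp_def by auto
  have both: "\<bar>ineq_u \<epsilon> ((X - Y) /\<^sub>R \<epsilon>) X Y\<bar> \<le> Q * (indicator (cball 0 1) ((X - Y) /\<^sub>R \<epsilon>) * indicator (cball 0 R) X) \<and>
     \<bar>ineq_v \<epsilon> ((X - Y) /\<^sub>R \<epsilon>) X Y\<bar> \<le> Q * (indicator (cball 0 1) ((X - Y) /\<^sub>R \<epsilon>) * indicator (cball 0 R) X)" for X Y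
  proof (cases "norm ((X - Y) /\<^sub>R \<epsilon>) \<le> 1 \<and> norm X \<le> R")
    case True
    define w where "w = (X - Y) /\<^sub>R \<epsilon>"
    have Y: "Y = X - \<epsilon> *\<^sub>R w" using \<epsilon> by (simp add: w_def)
    have "norm (\<epsilon> *\<^sub>R w) \<le> 1 * 1" unfolding norm_scaleR using \<epsilon> True by (intro mult_mono) (auto simp: w_def)
    then have "norm Y \<le> R + 1" unfolding Y using True norm_triangle_ineq4[of X "\<epsilon> *\<^sub>R w"] by linarith
    then have y: "norm (fst Y) \<le> R + 1" and x: "norm (fst X) \<le> R + 1"
      using norm_fst_le[of "fst Y" "snd Y"] norm_fst_le[of "fst X" "snd X"] True by auto
    note Kx = K(2)[rule_format, OF conjI[OF x]] and Ky = K(2)[rule_format, OF conjI[OF y]]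
    have s: "0 \<le> \<psi> X * moll w" "\<psi> X * moll w \<le> sup_\<psi>"
      using \<psi>_nonneg[of X] moll_bounds[of w] sup_\<psi>(2)[of X] mult_left_le[of "moll w" "\<psi> X"] by auto
    have "\<bar>ineq_u \<epsilon> w X Y\<bar> \<le> Q"
      unfolding ineq_u_def Q_def using Kx[OF uC[of X]] Kx[OF vC[of Y]] by (intro kruzkov_term_bound uC vC P s) auto
    moreover have "\<bar>ineq_v \<epsilon> w X Y\<bar> \<le> Q"
      unfolding ineq_v_def Q_def using Ky[OF uC[of X]] Ky[OF vC[of Y]] by (intro kruzkov_term_bound uC vC P s) auto
    ultimately show ?thesis using True by (simp add: w_def)
  next
    case False
    then have "(moll ((X - Y) /\<^sub>R \<epsilon>) = 0 \<and> moll' ((X - Y) /\<^sub>R \<epsilon>) = 0) \<or> (\<psi> X = 0 \<and> p X = 0)"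
      using moll_outside[of "(X - Y) /\<^sub>R \<epsilon>"] zero[of X] by (meson not_le)
    then have "ineq_u \<epsilon> ((X - Y) /\<^sub>R \<epsilon>) X Y = 0" "ineq_v \<epsilon> ((X - Y) /\<^sub>R \<epsilon>) X Y = 0"
      by (auto simp: ineq_u_def ineq_v_def grad_X_def grad_Y_def)
    then show ?thesis using False by (auto simp: indicator_def)
  qed
  show thesis by (rule that[of Q]) (use both in blast)+
qed

section \<open>Integration over both points and the change of variables\<close>

definition doubled where "doubled \<epsilon> z = ineq_u \<epsilon> (fst z) (snd z) (snd z - \<epsilon> *\<^sub>R fst z) + ineq_v \<epsilon> (fst z) (snd z) (snd z - \<epsilon> *\<^sub>R fst z)"

text \<open>Fubini is used in both orders: for fixed \<open>Y\<close> the first inequality is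
  integrated over \<open>X\<close>, for fixed \<open>X\<close> the second over \<open>Y\<close>. The
  substitution in \<open>Y\<close> produces a power of \<epsilon>, which is positive and can be
  divided out.\<close>

lemma doubled_integral_nonneg:
  assumes \<epsilon>: "0 < \<epsilon>" "\<epsilon> \<le> 1" "\<epsilon> < \<tau>"
  shows "0 \<le> (\<integral>z. doubled \<epsilon> z \<partial>lborel)"
proof -
  obtain K where K:
    "\<forall>X Y. \<bar>ineq_u \<epsilon> ((X - Y) /\<^sub>R \<epsilon>) X Y\<bar> \<le> K * (indicator (cball 0 1) ((X - Y) /\<^sub>R \<epsilon>) * indicator (cball 0 R) X)"
    "\<forall>X Y. \<bar>ineq_v \<epsilon> ((X - Y) /\<^sub>R \<epsilon>) X Y\<bar> \<le> K * (indicator (cball 0 1) ((X - Y) /\<^sub>R \<epsilon>) * indicator (cball 0 R) X)"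
    using ineq_bound[OF \<epsilon>(1,2)] .
  \<comment> \<open>Here \<open>z = (Y, X)\<close>; the first component becomes \<open>w\<close>
    only after the substitution.\<close>
  let ?A = "\<lambda>z. ineq_u \<epsilon> ((snd z - fst z) /\<^sub>R \<epsilon>) (snd z) (fst z)" and ?B = "\<lambda>z. ineq_v \<epsilon> ((snd z - fst z) /\<^sub>R \<epsilon>) (snd z) (fst z)"
  have ind: "indicator (cball 0 1) ((X - Y) /\<^sub>R \<epsilon>) * indicator (cball 0 R) X
      \<le> (indicator (cball 0 (R + 1)) Y * indicator (cball 0 R) X :: real)" for X Y :: "'a \<times> real"
  proof (cases "norm ((X - Y) /\<^sub>R \<epsilon>) \<le> 1 \<and> norm X \<le> R")
    case True
    have "norm (X - Y) = \<epsilon> * norm ((X - Y) /\<^sub>R \<epsilon>)" using \<epsilon> by simp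
    also have "\<dots> \<le> 1 * 1" using True \<epsilon> by (intro mult_mono) auto
    finally have "norm (X - Y) \<le> 1" by simp
    then have "norm Y \<le> R + 1" using True norm_triangle_sub[of Y X] by (simp add: norm_minus_commute)
    then show ?thesis by (simp add: indicator_def)
  qed (auto simp: indicator_def)
  have K0: "\<bar>a\<bar> \<le> \<bar>K\<bar> * t" if "\<bar>a\<bar> \<le> K * s" "s \<le> t" "0 \<le> s" for a s t :: real
  proof -
    have "K * s \<le> \<bar>K\<bar> * t" using that by (intro mult_mono) auto
    then show ?thesis using that(1) by linarith
  qed
  have mA: "?A \<in> borel_measurable borel" and mB: "?B \<in> borel_measurable borel" by measurable
  have intA: "integrable lborel ?A"
  proof (rule integrable_lborel_product[OF mA])
    show "\<bar>?A (Y, X)\<bar> \<le> \<bar>K\<bar> * (indicator (cball 0 (R + 1)) Y * indicator (cball 0 R) X)" for Y X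
      using K0[OF K(1)[rule_format, of X Y] ind] by simp
  qed
  have intB: "integrable lborel ?B"
  proof (rule integrable_lborel_product[OF mB])
    show "\<bar>?B (Y, X)\<bar> \<le> \<bar>K\<bar> * (indicator (cball 0 (R + 1)) Y * indicator (cball 0 R) X)" for Y X
      using K0[OF K(2)[rule_format, of X Y] ind] by simp
  qed
  have "0 \<le> (\<integral>z. ?A z \<partial>lborel)"
    unfolding integral_lborel_product(1)[OF intA] fst_conv snd_conv
    by (rule integral_nonneg_AE, rule AE_I2, rule ineq_u_integral_nonneg[OF \<epsilon>(1)])
  moreover have "0 \<le> (\<integral>z. ?B z \<partial>lborel)"
    unfolding integral_lborel_product(2)[OF intB] fst_conv snd_conv
    by (rule integral_nonneg_AE, rule AE_I2, rule ineq_v_integral_nonneg[OF \<epsilon>(1,3)])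
  ultimately have "0 \<le> (\<integral>z. ?A z + ?B z \<partial>lborel)" using intA intB by simp
  also have "\<dots> = (\<integral>X. \<integral>Y. ?A (Y, X) + ?B (Y, X) \<partial>lborel \<partial>lborel)"
    by (rule integral_lborel_product(2)) (use intA intB in simp)
  also have "\<dots> = (\<integral>X. \<epsilon> ^ DIM('a \<times> real) * (\<integral>w. doubled \<epsilon> (w, X) \<partial>lborel) \<partial>lborel)"
  proof (rule Bochner_Integration.integral_cong[OF refl])
    fix X
    have "(\<lambda>Y. ?A (Y, X) + ?B (Y, X)) \<in> borel_measurable borel" by simp measurable
    from integral_lborel_affine[OF this \<epsilon>(1), of X]
    show "(\<integral>Y. ?A (Y, X) + ?B (Y, X) \<partial>lborel) = \<epsilon> ^ DIM('a \<times> real) * (\<integral>w. doubled \<epsilon> (w, X) \<partial>lborel)"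
      using \<epsilon>(1) by (simp add: doubled_def)
  qed
  also have "\<dots> = \<epsilon> ^ DIM('a \<times> real) * (\<integral>X. \<integral>w. doubled \<epsilon> (w, X) \<partial>lborel \<partial>lborel)" by simp
  also have "(\<integral>X. \<integral>w. doubled \<epsilon> (w, X) \<partial>lborel \<partial>lborel) = (\<integral>z. doubled \<epsilon> z \<partial>lborel)"
  proof (rule integral_lborel_product(2)[symmetric], rule integrable_lborel_product)
    show "doubled \<epsilon> \<in> borel_measurable borel" unfolding doubled_def[abs_def] by measurable
    show "\<bar>doubled \<epsilon> (w, X)\<bar> \<le> (2 * K) * (indicator (cball 0 1) w * indicator (cball 0 R) X)" for w X
      using K(1)[rule_format, of X "X - \<epsilon> *\<^sub>R w"] K(2)[rule_format, of X "X - \<epsilon> *\<^sub>R w"] \<epsilon>(1) by (simp add: doubled_def)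
  qed
  finally have *: "0 \<le> \<epsilon> ^ DIM('a \<times> real) * (\<integral>z. doubled \<epsilon> z \<partial>lborel)" .
  have "0 < \<epsilon> ^ DIM('a \<times> real)" using \<epsilon>(1) by (rule zero_less_power)
  from mult_le_cancel_left_pos[OF this, of 0] * show ?thesis by (simp only: mult_zero_right)
qed

text \<open>In the sum of the two inequalities the time derivatives of the mollifier cancel. The summand
  \<open>doubled_error\<close> collects the only terms in which the discontinuous function \<open>div_f\<close> is evaluated at
  the translated point.\<close>

definition test_part :: "real \<Rightarrow> ('a \<times> real) \<times> ('a \<times> real) \<Rightarrow> real" where
  "test_part \<epsilon> z = moll (fst z) * (snd (p (snd z)) * \<bar>u (snd z) - v (snd z - \<epsilon> *\<^sub>R fst z)\<bar>
     + sgn (u (snd z) - v (snd z - \<epsilon> *\<^sub>R fst z)) *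
       (fst (p (snd z)) \<bullet> (f (fst (snd z)) (u (snd z)) - f (fst (snd z)) (v (snd z - \<epsilon> *\<^sub>R fst z)))))"

text \<open>Absorbs the factor 1 / \<epsilon> of the mollifier's gradient into a backward difference
  quotient of \<open>f\<close> in space, at a frozen state.\<close>

definition flux_quot :: "real \<Rightarrow> ('a \<times> real) \<times> ('a \<times> real) \<Rightarrow> real \<Rightarrow> 'a" where
  "flux_quot \<epsilon> z k = (f (fst (snd z)) k - f (fst (snd z) - \<epsilon> *\<^sub>R fst (fst z)) k) /\<^sub>R \<epsilon>"

definition doubled_main where
  "doubled_main \<epsilon> z = test_part \<epsilon> z + \<psi> (snd z) * (sgn (u (snd z) - v (snd z - \<epsilon> *\<^sub>R fst z)) *
     (moll' (fst z) * (fst (fst z) \<bullet> (flux_quot \<epsilon> z (u (snd z)) - flux_quot \<epsilon> z (v (snd z - \<epsilon> *\<^sub>R fst z))))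
      + moll (fst z) * (div_f (fst (snd z)) (u (snd z)) - div_f (fst (snd z)) (v (snd z - \<epsilon> *\<^sub>R fst z)))))"

definition doubled_error where
  "doubled_error \<epsilon> z = \<psi> (snd z) * (sgn (u (snd z) - v (snd z - \<epsilon> *\<^sub>R fst z)) *
     (moll (fst z) * (div_f (fst (snd z - \<epsilon> *\<^sub>R fst z)) (u (snd z)) - div_f (fst (snd z)) (u (snd z)))))"

text \<open>As \<open>sgn\<close> is odd, the flux differences regroup by state into quotients at
  \<open>u X\<close> and at \<open>v Y\<close>. In the source terms
  \<open>div_f (fst X) (u X)\<close> is added and subtracted: the main part compares two states at
  one point, the error two points at one state.\<close>

lemma doubled_split:
  assumes \<epsilon>: "\<epsilon> > 0"
  shows "doubled \<epsilon> z = doubled_main \<epsilon> z + doubled_error \<epsilon> z"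
proof -
  obtain w X where z: "z = (w, X)" by (cases z)
  define Y where "Y = X - \<epsilon> *\<^sub>R w"
  have y: "fst X - \<epsilon> *\<^sub>R fst w = fst Y" by (simp add: Y_def)
  have neg: "sgn (v Y - u X) = - sgn (u X - v Y)" by (simp add: sgn_real_def)
  have c: "\<psi> X / \<epsilon> = \<psi> X * inverse \<epsilon>" by (simp add: divide_inverse)
  show ?thesis
    unfolding doubled_def doubled_main_def test_part_def doubled_error_def ineq_u_def ineq_v_def grad_X_def grad_Y_def flux_quot_def z fst_conv snd_conv Y_def[symmetric] y neg
    by (simp add: c abs_minus_commute[of "v Y"] inner_add_left inner_diff_right inner_minus_left algebra_simps)
qed

lemma target_borel [measurable]:
  "doubled_main \<epsilon> \<in> borel_measurable borel" "doubled_error \<epsilon> \<in> borel_measurable borel" "test_part \<epsilon> \<in> borel_measurable borel"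
  unfolding doubled_main_def[abs_def] test_part_def[abs_def] doubled_error_def[abs_def] flux_quot_def by measurable

lemma outside:
  assumes "\<not> (norm (fst z) \<le> 1 \<and> norm (snd z) \<le> R)"
  shows "doubled_main \<epsilon> z = 0" "doubled_error \<epsilon> z = 0"
proof -
  have "(moll (fst z) = 0 \<and> moll' (fst z) = 0) \<or> (\<psi> (snd z) = 0 \<and> p (snd z) = 0)"
    using moll_outside[of "fst z"] zero[of "snd z"] assms by (meson not_le)
  then show "doubled_main \<epsilon> z = 0" "doubled_error \<epsilon> z = 0" by (auto simp: doubled_main_def test_part_def doubled_error_def)
qed

lemma shift_norm:
  assumes "0 < \<epsilon>" "\<epsilon> \<le> 1" "norm w \<le> 1" "norm X \<le> R"
  shows "norm (X - \<epsilon> *\<^sub>R w) \<le> R + 1" "norm (fst X - \<epsilon> *\<^sub>R fst w) \<le> R + 1" "norm (fst X) \<le> R + 1" "norm (fst w) \<le> 1"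
proof -
  have "norm (\<epsilon> *\<^sub>R w) \<le> 1 * 1" unfolding norm_scaleR using assms by (intro mult_mono) auto
  then show 1: "norm (X - \<epsilon> *\<^sub>R w) \<le> R + 1" using assms(4) norm_triangle_ineq4[of X "\<epsilon> *\<^sub>R w"] by linarith
  have "norm (fst (X - \<epsilon> *\<^sub>R w)) \<le> norm (X - \<epsilon> *\<^sub>R w)"
    using norm_fst_le[of "fst (X - \<epsilon> *\<^sub>R w)" "snd (X - \<epsilon> *\<^sub>R w)"] unfolding prod.collapse .
  with 1 show "norm (fst X - \<epsilon> *\<^sub>R fst w) \<le> R + 1" by simp
  show "norm (fst X) \<le> R + 1" "norm (fst w) \<le> 1"
    using norm_fst_le[of "fst X" "snd X"] norm_fst_le[of "fst w" "snd w"] assms unfolding prod.collapse by linarith+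
qed

text \<open>Uniformity in \<epsilon> comes from the Lipschitz bound of \<open>f\<close> in space,
  which compensates the factor 1 / \<epsilon> in \<open>flux_quot\<close>.\<close>

lemma doubled_bounds:
  obtains K where "K \<ge> 0"
    "\<forall>\<epsilon> z. 0 < \<epsilon> \<and> \<epsilon> \<le> 1 \<longrightarrow> \<bar>doubled_main \<epsilon> z\<bar> \<le> K * (indicator (cball 0 1) (fst z) * indicator (cball 0 R) (snd z))"
    "\<forall>\<epsilon> z. 0 < \<epsilon> \<and> \<epsilon> \<le> 1 \<longrightarrow> \<bar>doubled_error \<epsilon> z\<bar> \<le> K * (indicator (cball 0 1) (fst z) * indicator (cball 0 R) (snd z))"
proof -
  obtain K where K: "K \<ge> 0"
    "\<forall>x k. norm x \<le> R + 1 \<and> \<bar>k\<bar> \<le> C \<longrightarrow> norm (f x k) \<le> K \<and> \<bar>div_f x k\<bar> \<le> K"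
    "\<forall>x y k. norm x \<le> R + 1 \<and> norm y \<le> R + 1 \<and> \<bar>k\<bar> \<le> C \<longrightarrow> norm (f x k - f y k) \<le> K * norm (x - y)"
    by (rule uniform_bounds)
  \<comment> \<open>The nesting follows \<open>doubled_main\<close>: factors 1 bound
    \<open>moll\<close>, the sign and \<open>norm (fst w)\<close>, the factor 4 bounds
    \<open>moll'\<close>, and each 2 comes from a difference.\<close>
  define Q where "Q = 1 * (M * (2 * C) + 1 * (M * (2 * K))) + sup_\<psi> * (1 * (4 * (1 * (2 * K)) + 1 * (2 * K)))"
  have *: "\<bar>doubled_main \<epsilon> z\<bar> \<le> Q \<and> \<bar>doubled_error \<epsilon> z\<bar> \<le> Q" if \<epsilon>: "0 < \<epsilon>" "\<epsilon> \<le> 1" and nz: "norm (fst z) \<le> 1" "norm (snd z) \<le> R" for \<epsilon> z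
  proof -
    define w X Y where "w = fst z" and "X = snd z" and "Y = snd z - \<epsilon> *\<^sub>R fst z"
    note sh = shift_norm[OF \<epsilon> nz, folded w_def X_def]
    have y: "fst X - \<epsilon> *\<^sub>R fst w = fst Y" by (simp add: Y_def X_def w_def)
    note sh = sh[unfolded y]
    have sgn1: "\<bar>sgn t\<bar> \<le> 1" for t :: real by (simp add: sgn_real_def)
    have P: "\<bar>snd (p X)\<bar> \<le> M" "norm (fst (p X)) \<le> M"
      using pM[of X] norm_snd_le[of "snd (p X)" "fst (p X)"] norm_fst_le[of "fst (p X)" "snd (p X)"] by auto
    have m: "\<bar>moll w\<bar> \<le> 1" "\<bar>moll' w\<bar> \<le> 4" using moll_bounds[of w] by auto
    have \<psi>1: "\<bar>\<psi> X\<bar> \<le> sup_\<psi>" using sup_\<psi>(2)[of X] \<psi>_nonneg[of X] by simp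
    have uv: "\<bar>u X - v Y\<bar> \<le> 2 * C" using uC[of X] vC[of Y] by linarith
    have fb: "norm (f (fst X) (u X) - f (fst X) (v Y)) \<le> 2 * K"
      using K(2)[rule_format, OF conjI[OF sh(3) uC[of X]]] K(2)[rule_format, OF conjI[OF sh(3) vC[of Y]]]
        norm_triangle_ineq4[of "f (fst X) (u X)" "f (fst X) (v Y)"] by linarith
    have gb: "\<bar>div_f (fst X) (u X) - div_f (fst X) (v Y)\<bar> \<le> 2 * K" "\<bar>div_f (fst Y) (u X) - div_f (fst X) (u X)\<bar> \<le> 2 * K"
      using K(2)[rule_format, OF conjI[OF sh(3) uC[of X]]] K(2)[rule_format, OF conjI[OF sh(3) vC[of Y]]]
        K(2)[rule_format, OF conjI[OF sh(2) uC[of X]]] by linarith+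
    have dqb: "norm (flux_quot \<epsilon> z k) \<le> K" if "\<bar>k\<bar> \<le> C" for k
    proof -
      have "norm (f (fst X) k - f (fst Y) k) \<le> K * norm (fst X - fst Y)"
        using K(3) sh(2,3) that by blast
      also have "fst X - fst Y = \<epsilon> *\<^sub>R fst w" by (simp add: Y_def X_def w_def)
      also have "K * norm (\<epsilon> *\<^sub>R fst w) \<le> K * (\<epsilon> * 1)"
        unfolding norm_scaleR using \<epsilon> sh(4) K(1) by (intro mult_left_mono mult_mono) auto
      finally have "norm (f (fst X) k - f (fst Y) k) \<le> K * \<epsilon>" by simp
      then have "inverse \<epsilon> * norm (f (fst X) k - f (fst Y) k) \<le> inverse \<epsilon> * (K * \<epsilon>)"
        using \<epsilon> by (intro mult_left_mono) auto
      also have "inverse \<epsilon> * (K * \<epsilon>) = K" using \<epsilon> by simp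
      finally have "inverse \<epsilon> * norm (f (fst X) k - f (fst Y) k) \<le> K" .
      moreover have "\<bar>inverse \<epsilon>\<bar> = inverse \<epsilon>" using \<epsilon> by simp
      ultimately show ?thesis unfolding flux_quot_def X_def[symmetric] w_def[symmetric] y norm_scaleR by (simp only:)
    qed
    have dqd: "norm (flux_quot \<epsilon> z (u X) - flux_quot \<epsilon> z (v Y)) \<le> 2 * K"
      using dqb[OF uC[of X]] dqb[OF vC[of Y]] norm_triangle_ineq4[of "flux_quot \<epsilon> z (u X)" "flux_quot \<epsilon> z (v Y)"] by linarith
    have inner: "\<bar>a \<bullet> b\<bar> \<le> s * t" if "norm a \<le> s" "norm b \<le> t" for a b :: 'a and s t :: real
    proof -
      have "0 \<le> s" using that(1) norm_ge_zero[of a] by linarith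
      then have "norm a * norm b \<le> s * t" using that by (intro mult_mono) auto
      then show ?thesis using Cauchy_Schwarz_ineq2[of a b] by linarith
    qed
    have mul: "\<bar>a * b\<bar> \<le> s * t" if "\<bar>a\<bar> \<le> s" "\<bar>b\<bar> \<le> t" for a b s t :: real
    proof -
      have "0 \<le> s" using that(1) by linarith
      then show ?thesis unfolding abs_mult using that by (intro mult_mono) auto
    qed
    have add: "\<bar>a + b\<bar> \<le> s + t" if "\<bar>a\<bar> \<le> s" "\<bar>b\<bar> \<le> t" for a b s t :: real
      using that by linarith
    have "\<bar>doubled_main \<epsilon> z\<bar> \<le> Q"
      unfolding doubled_main_def test_part_def X_def[symmetric] w_def[symmetric] Q_def
      unfolding w_def Y_def[symmetric] unfolding w_def[symmetric]
      using P m \<psi>1 uv fb gb dqd sgn1 sh(4)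
      by (intro add mul inner) (simp_all add: Y_def X_def w_def)
    moreover have "\<bar>doubled_error \<epsilon> z\<bar> \<le> sup_\<psi> * (1 * (1 * (2 * K)))"
      unfolding doubled_error_def X_def[symmetric]
      using P m \<psi>1 uv fb gb dqd sgn1
      by (intro mul) (simp_all add: Y_def X_def w_def)
    moreover have "sup_\<psi> * (1 * (1 * (2 * K))) \<le> Q"
    proof -
      have "0 \<le> M * C" "0 \<le> M * K" "0 \<le> sup_\<psi> * K" using M0 C0 K(1) sup_\<psi>(1) by auto
      then show ?thesis unfolding Q_def by (simp add: algebra_simps)
    qed
    ultimately show ?thesis by linarith
  qed
  have Q0: "Q \<ge> 0"
  proof -
    have "0 \<le> M * C" "0 \<le> M * K" "0 \<le> sup_\<psi> * K" using M0 C0 K(1) sup_\<psi>(1) by auto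
    then show ?thesis unfolding Q_def by (simp add: algebra_simps)
  qed
  have **: "\<bar>doubled_main \<epsilon> z\<bar> \<le> Q * (indicator (cball 0 1) (fst z) * indicator (cball 0 R) (snd z)) \<and>
     \<bar>doubled_error \<epsilon> z\<bar> \<le> Q * (indicator (cball 0 1) (fst z) * indicator (cball 0 R) (snd z))" if \<epsilon>: "0 < \<epsilon> \<and> \<epsilon> \<le> 1" for \<epsilon> z
  proof (cases "norm (fst z) \<le> 1 \<and> norm (snd z) \<le> R")
    case True
    then show ?thesis using *[of \<epsilon> z] \<epsilon> by simp
  next
    case False
    then show ?thesis unfolding outside[OF False] using Q0 by (simp add: indicator_def)
  qed
  show thesis by (rule that[OF Q0]) (use ** in blast)+
qed

section \<open>The limit \<epsilon> \<rightarrow> 0\<close>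

definition kruzkov_integrand where
  "kruzkov_integrand X = snd (p X) * \<bar>u X - v X\<bar> + sgn (u X - v X) * (fst (p X) \<bullet> (f (fst X) (u X) - f (fst X) (v X)))"

definition doubled_limit :: "('a \<times> real) \<times> ('a \<times> real) \<Rightarrow> real" where
  "doubled_limit z = moll (fst z) * kruzkov_integrand (snd z) + \<psi> (snd z) * (sgn (u (snd z) - v (snd z)) *
     (moll' (fst z) * (fst (fst z) \<bullet> (D (fst (snd z)) (u (snd z)) (fst (fst z)) - D (fst (snd z)) (v (snd z)) (fst (fst z))))
      + moll (fst z) * (div_f (fst (snd z)) (u (snd z)) - div_f (fst (snd z)) (v (snd z)))))"

lemma kruzkov_integrand_borel [measurable]: "kruzkov_integrand \<in> borel_measurable borel"
  unfolding kruzkov_integrand_def[abs_def] by measurable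

lemma doubled_limit_borel [measurable]: "doubled_limit \<in> borel_measurable borel"
  unfolding doubled_limit_def[abs_def] by measurable

text \<open>Only \<open>v\<close> is evaluated at the shifted point. Where \<open>u\<close> and
  \<open>v\<close> agree at \<open>X\<close>, both factors of the sign vanish in the limit, so
  \<open>sgn_mult_tendsto\<close> covers the jump.\<close>

lemma doubled_main_tendsto:
  assumes x: "fst (snd z) \<notin> N" and e: "e \<longlonglongrightarrow> 0" "\<And>n. e n > 0"
    and v: "(\<lambda>n. v (snd z - e n *\<^sub>R fst z)) \<longlonglongrightarrow> v (snd z)"
  shows "(\<lambda>n. doubled_main (e n) z) \<longlonglongrightarrow> doubled_limit z"
proof -
  define w X V where "w = fst z" and "X = snd z" and "V n = v (snd z - e n *\<^sub>R fst z)" for n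
  have V: "V \<longlonglongrightarrow> v X" using v unfolding V_def X_def .
  have fV: "(\<lambda>n. f (fst X) (V n)) \<longlonglongrightarrow> f (fst X) (v X)"
    using continuous_on_tendsto_compose[OF f_continuous_right V] by simp
  have gV: "(\<lambda>n. div_f (fst X) (V n)) \<longlonglongrightarrow> div_f (fst X) (v X)"
    using continuous_on_tendsto_compose[OF div_f_continuous V] by simp
  have d1: "(\<lambda>n. flux_quot (e n) z (u X)) \<longlonglongrightarrow> D (fst X) (u X) (fst w)"
    unfolding flux_quot_def X_def[symmetric] w_def[symmetric]
    by (rule difference_quotient_tendsto[OF x[folded X_def] tendsto_const uC e])
  have d2: "(\<lambda>n. flux_quot (e n) z (V n)) \<longlonglongrightarrow> D (fst X) (v X) (fst w)"
    unfolding flux_quot_def X_def[symmetric] w_def[symmetric]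
    by (rule difference_quotient_tendsto[where C = C, OF x[folded X_def] V _ e]) (simp add: V_def vC)
  have s1: "(\<lambda>n. sgn (u X - V n) *\<^sub>R (fst (p X) \<bullet> (f (fst X) (u X) - f (fst X) (V n))))
     \<longlonglongrightarrow> sgn (u X - v X) *\<^sub>R (fst (p X) \<bullet> (f (fst X) (u X) - f (fst X) (v X)))"
    by (rule sgn_mult_tendsto[OF V]) (auto intro!: tendsto_intros fV)
  have s2: "(\<lambda>n. sgn (u X - V n) *\<^sub>R (moll' w * (fst w \<bullet> (flux_quot (e n) z (u X) - flux_quot (e n) z (V n)))
      + moll w * (div_f (fst X) (u X) - div_f (fst X) (V n))))
     \<longlonglongrightarrow> sgn (u X - v X) *\<^sub>R (moll' w * (fst w \<bullet> (D (fst X) (u X) (fst w) - D (fst X) (v X) (fst w)))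
      + moll w * (div_f (fst X) (u X) - div_f (fst X) (v X)))"
    by (rule sgn_mult_tendsto[OF V]) (auto intro!: tendsto_intros d1 d2 gV)
  show ?thesis
    unfolding doubled_main_def test_part_def doubled_limit_def kruzkov_integrand_def V_def[symmetric] unfolding X_def[symmetric] w_def[symmetric]
    by (intro tendsto_intros s1[unfolded real_scaleR_def] s2[unfolded real_scaleR_def] V)
qed

lemma doubled_limit_integral: "integrable lborel kruzkov_integrand" "integrable lborel doubled_limit \<Longrightarrow>
    (\<integral>z. doubled_limit z \<partial>lborel) = (\<integral>w. moll (w :: 'a \<times> real) \<partial>lborel) * (\<integral>X. kruzkov_integrand X \<partial>lborel)"
proof -
  obtain K where K: "K \<ge> 0"
    "\<forall>x k. norm x \<le> R + 1 \<and> \<bar>k\<bar> \<le> C \<longrightarrow> norm (f x k) \<le> K \<and> \<bar>div_f x k\<bar> \<le> K"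
    by (rule uniform_bounds)
  show "integrable lborel kruzkov_integrand"
  proof (rule integrable_lborel_bounded_support[where C = "M * (2 * C) + (M * (2 * K) + sup_\<psi> * K)" and R = R])
    show "norm (kruzkov_integrand X) \<le> (M * (2 * C) + (M * (2 * K) + sup_\<psi> * K)) * indicator (cball 0 R) X" for X
    proof (cases "norm X \<le> R")
      case True
      then have x: "norm (fst X) \<le> R + 1" using norm_fst_le[of "fst X" "snd X"] by simp
      note Kx = K(2)[rule_format, OF conjI[OF x]]
      \<comment> \<open>No source term is left in the limit; the general bound is used with
        \<open>s = 0\<close> and \<open>G = 0\<close>.\<close>
      have "\<bar>snd (p X) * \<bar>u X - v X\<bar> + sgn (u X - v X) * (fst (p X) \<bullet> (f (fst X) (u X) - f (fst X) (v X)) - 0 * 0)\<bar>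
         \<le> M * (2 * C) + (M * (2 * K) + sup_\<psi> * K)"
        by (rule kruzkov_term_bound[OF uC vC pM]) (use Kx[OF uC[of X]] Kx[OF vC[of X]] K(1) sup_\<psi>(1) in auto)
      then show ?thesis using True by (simp add: kruzkov_integrand_def)
    qed (use zero in \<open>simp add: kruzkov_integrand_def\<close>)
  qed measurable
  assume int: "integrable lborel doubled_limit"
  have "(\<integral>z. doubled_limit z \<partial>lborel) = (\<integral>X. \<integral>w. doubled_limit (w, X) \<partial>lborel \<partial>lborel)"
    by (rule integral_lborel_product(2)[OF int])
  also have "\<dots> = (\<integral>X. (\<integral>w. moll (w :: 'a \<times> real) \<partial>lborel) * kruzkov_integrand X \<partial>lborel)"
  proof (rule Bochner_Integration.integral_cong[OF refl])
    fix X
    \<comment> \<open>The linear map whose quadratic form and trace make up the bracket for fixed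
      \<open>X\<close>.\<close>
    let ?A = "\<lambda>z. D (fst X) (u X) z - D (fst X) (v X) z"
    have lin: "linear ?A" by (intro linear_compose_sub D_linear)
    have tr: "div_f (fst X) (u X) - div_f (fst X) (v X) = (\<Sum>b\<in>Basis. ?A b \<bullet> b)"
      by (simp add: div_f_def inner_diff_left sum_subtractf)
    note id = moll_divergence_identity[OF lin, folded tr]
    have "(\<integral>w. doubled_limit (w, X) \<partial>lborel) = (\<integral>w. moll w * kruzkov_integrand X + (\<psi> X * sgn (u X - v X)) * (moll' w * (fst w \<bullet> ?A (fst w))
        + moll w * (div_f (fst X) (u X) - div_f (fst X) (v X))) \<partial>(lborel :: ('a \<times> real) measure))"
      unfolding doubled_limit_def fst_conv snd_conv by (simp only: mult.assoc)
    also have "\<dots> = (\<integral>w. moll w * kruzkov_integrand X \<partial>(lborel :: ('a \<times> real) measure)) + (\<integral>w. (\<psi> X * sgn (u X - v X)) * (moll' w * (fst w \<bullet> ?A (fst w))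
        + moll w * (div_f (fst X) (u X) - div_f (fst X) (v X))) \<partial>(lborel :: ('a \<times> real) measure))"
      by (rule Bochner_Integration.integral_add) (intro integrable_mult_left integrable_mult_right moll_integrable id(2))+
    also have "\<dots> = (\<integral>w. moll (w :: 'a \<times> real) \<partial>lborel) * kruzkov_integrand X"
      unfolding Bochner_Integration.integral_mult_right_zero id(1) by simp
    finally show "(\<integral>w. doubled_limit (w, X) \<partial>lborel) = (\<integral>w. moll (w :: 'a \<times> real) \<partial>lborel) * kruzkov_integrand X" .
  qed
  also have "\<dots> = (\<integral>w. moll (w :: 'a \<times> real) \<partial>lborel) * (\<integral>X. kruzkov_integrand X \<partial>lborel)" by simp
  finally show "(\<integral>z. doubled_limit z \<partial>lborel) = (\<integral>w. moll (w :: 'a \<times> real) \<partial>lborel) * (\<integral>X. kruzkov_integrand X \<partial>lborel)" .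
qed

text \<open>Compare \<open>div_f y (u X)\<close> with \<open>div_f y (u Y)\<close> and \<open>div_f y (u Y)\<close> with \<open>div_f x (u X)\<close>, where
  \<open>X = (x, t)\<close> and \<open>Y = X - \<epsilon> w = (y, s)\<close>: the second difference is a translation of a fixed
  function, and the first becomes one in which only the continuous argument of \<open>div_f\<close> varies, after
  taking \<open>Y\<close> as the variable of integration.\<close>

lemma doubled_error_tendsto:
  assumes e: "e \<longlonglongrightarrow> 0" "\<And>n. e n > 0" "\<And>n. e n \<le> 1"
    and u: "AE z in lborel. norm (fst z) \<le> 1 \<and> norm (snd z) \<le> R + 1 \<longrightarrow> (\<lambda>n. u (snd z + e n *\<^sub>R fst z)) \<longlonglongrightarrow> u (snd z)"
  shows "(\<lambda>n. \<integral>z. doubled_error (e n) z \<partial>lborel) \<longlonglongrightarrow> 0"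
proof -
  obtain K where K: "K \<ge> 0"
    "\<forall>x k. norm x \<le> R + 1 \<and> \<bar>k\<bar> \<le> C \<longrightarrow> norm (f x k) \<le> K \<and> \<bar>div_f x k\<bar> \<le> K"
    by (rule uniform_bounds)
  have gK: "\<bar>div_f (fst X) k\<bar> \<le> K" if "norm X \<le> R + 1" "\<bar>k\<bar> \<le> C" for X :: "'a \<times> real" and k
    using K(2)[rule_format, of "fst X" k] that norm_fst_le[of "fst X" "snd X"] by simp
  let ?i = "\<lambda>r z. indicator (cball 0 1) (fst z) * indicator (cball 0 r) (snd z) :: real"
  have [measurable]: "cball (0 :: 'a \<times> real) s \<in> sets borel" for s by simp
  \<comment> \<open>Point and state are taken at the same \<open>X\<close>. This gives a fixed
    bounded Borel function, whose translations are controlled in the mean even though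
    \<open>div_f\<close> need not be continuous in space.\<close>
  define G where "G X = div_f (fst X) (u X)" for X
  have [measurable]: "G \<in> borel_measurable borel" unfolding G_def[abs_def] by measurable
  define E1 where "E1 n z = ?i R z * \<bar>G (snd z + (- e n) *\<^sub>R fst z) - G (snd z)\<bar>" for n and z :: "('a \<times> real) \<times> ('a \<times> real)"
  define S where "S n z = ?i R z * \<bar>div_f (fst (snd z - e n *\<^sub>R fst z)) (u (snd z)) - G (snd z - e n *\<^sub>R fst z)\<bar>" for n and z :: "('a \<times> real) \<times> ('a \<times> real)"
  \<comment> \<open>\<open>S\<close> with \<open>Y\<close> as the variable: the point is now fixed
    and only the state moves. The radius grows by 1 because \<open>Y\<close> is a shift of
    \<open>X\<close>.\<close>
  define S' where "S' n z = ?i (R + 1) z * \<bar>div_f (fst (snd z)) (u (snd z + e n *\<^sub>R fst z)) - G (snd z)\<bar>" for n and z :: "('a \<times> real) \<times> ('a \<times> real)"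
  have Em [measurable]: "E1 n \<in> borel_measurable borel" "S n \<in> borel_measurable borel" "S' n \<in> borel_measurable borel" for n
    unfolding E1_def[abs_def] S_def[abs_def] S'_def[abs_def] by measurable
  have E1_lim: "(\<lambda>n. \<integral>z. E1 n z \<partial>lborel) \<longlonglongrightarrow> 0"
    unfolding E1_def
  proof (rule L1_rescaled_translation[where B = K])
    show "\<bar>G X\<bar> \<le> K" if "norm X \<le> R + 1" for X unfolding G_def using gK[OF that uC] .
    show "(\<lambda>n. - e n) \<longlonglongrightarrow> 0" using tendsto_minus[OF e(1)] by simp
    show "\<bar>- e n\<bar> \<le> 1" for n using e(2)[of n] e(3)[of n] by simp
  qed (use R in auto)
  have S_bound: "\<bar>S n (w, X)\<bar> \<le> (2 * K) * (indicator (cball 0 1) w * indicator (cball 0 R) X)" for n w X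
  proof (cases "norm w \<le> 1 \<and> norm X \<le> R")
    case True
    have "norm (X - e n *\<^sub>R w) \<le> R + 1" using shift_norm(1)[OF e(2,3)] True by blast
    from gK[OF this uC[of X]] gK[OF this uC[of "X - e n *\<^sub>R w"]]
    show ?thesis using True by (simp add: S_def G_def)
  qed (auto simp: S_def)
  have S'_bound: "\<bar>S' n (w, Y)\<bar> \<le> (2 * K) * (indicator (cball 0 1) w * indicator (cball 0 (R + 1)) Y)" for n w Y
  proof (cases "norm w \<le> 1 \<and> norm Y \<le> R + 1")
    case True
    then have Y: "norm Y \<le> R + 1" by simp
    from gK[OF Y uC[of Y]] gK[OF Y uC[of "Y + e n *\<^sub>R w"]]
    show ?thesis using True by (simp add: S'_def G_def)
  qed (auto simp: S'_def)
  have E1_bound: "\<bar>E1 n (w, X)\<bar> \<le> (2 * K) * (indicator (cball 0 1) w * indicator (cball 0 R) X)" for n w X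
  proof (cases "norm w \<le> 1 \<and> norm X \<le> R")
    case True
    have Y: "norm (X - e n *\<^sub>R w) \<le> R + 1" using shift_norm(1)[OF e(2,3)] True by blast
    have "norm X \<le> R + 1" using True by simp
    from gK[OF this uC[of X]] gK[OF Y uC[of "X - e n *\<^sub>R w"]]
    show ?thesis using True by (simp add: E1_def G_def)
  qed (auto simp: E1_def)
  have Si: "integrable lborel (S n)" for n by (rule integrable_lborel_product[OF Em(2) S_bound])
  have S'i: "integrable lborel (S' n)" for n by (rule integrable_lborel_product[OF Em(3) S'_bound])
  have E1i: "integrable lborel (E1 n)" for n by (rule integrable_lborel_product[OF Em(1) E1_bound])
  have shift_le: "S n (w, Y + e n *\<^sub>R w) \<le> S' n (w, Y)" for n w Y
  proof (cases "norm w \<le> 1 \<and> norm (Y + e n *\<^sub>R w) \<le> R")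
    case True
    have "norm (Y + e n *\<^sub>R w - e n *\<^sub>R w) \<le> R + 1" using shift_norm(1)[OF e(2,3)] True by blast
    then show ?thesis using True by (simp add: S_def S'_def)
  qed (auto simp: S_def S'_def)
  \<comment> \<open>For fixed \<open>w\<close> substitute \<open>X = Y + e n *\<^sub>R w\<close>;
    the integrand is nonnegative, so the larger ball only increases the integral.\<close>
  have S_le: "(\<integral>z. S n z \<partial>lborel) \<le> (\<integral>z. S' n z \<partial>lborel)" for n
  proof -
    let ?Sh = "\<lambda>z. S n (fst z, snd z + e n *\<^sub>R fst z)"
    have m: "?Sh \<in> borel_measurable borel"
      unfolding S_def fst_conv snd_conv by measurable
    have Shi: "integrable lborel ?Sh"
    proof (rule integrable_lborel_product[OF m])
      fix w Y
      have "0 \<le> S n (w, Y + e n *\<^sub>R w)" by (simp add: S_def)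
      then have "\<bar>S n (w, Y + e n *\<^sub>R w)\<bar> \<le> \<bar>S' n (w, Y)\<bar>" using shift_le[of n w Y] by linarith
      also note S'_bound[of n w Y]
      finally show "\<bar>S n (fst (w, Y), snd (w, Y) + e n *\<^sub>R fst (w, Y))\<bar> \<le> (2 * K) * (indicator (cball 0 1) w * indicator (cball 0 (R + 1)) Y)"
        by simp
    qed
    have "(\<integral>z. S n z \<partial>lborel) = (\<integral>w. \<integral>X. S n (w, X) \<partial>lborel \<partial>lborel)" by (rule integral_lborel_product(1)[OF Si])
    also have "\<dots> = (\<integral>w. \<integral>Y. ?Sh (w, Y) \<partial>lborel \<partial>lborel)"
    proof (rule Bochner_Integration.integral_cong[OF refl])
      fix w
      show "(\<integral>X. S n (w, X) \<partial>lborel) = (\<integral>Y. ?Sh (w, Y) \<partial>lborel)"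
        using integral_lborel_translation[of "\<lambda>X. S n (w, X)" "e n *\<^sub>R w"] by simp
    qed
    also have "\<dots> = (\<integral>z. ?Sh z \<partial>lborel)" by (rule integral_lborel_product(1)[OF Shi, symmetric])
    also have "\<dots> \<le> (\<integral>z. S' n z \<partial>lborel)"
    proof (rule integral_mono[OF Shi S'i])
      show "?Sh z \<le> S' n z" for z using shift_le[of n "fst z" "snd z"] by simp
    qed
    finally show ?thesis .
  qed
  have S'_lim: "(\<lambda>n. \<integral>z. S' n z \<partial>lborel) \<longlonglongrightarrow> (\<integral>z. 0 \<partial>(lborel :: (('a \<times> real) \<times> ('a \<times> real)) measure))"
  proof (rule integral_dominated_convergence[where w = "\<lambda>z. (2 * K) * ?i (R + 1) z"])
    show "integrable lborel (\<lambda>z :: ('a \<times> real) \<times> ('a \<times> real). (2 * K) * ?i (R + 1) z)"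
    proof (rule integrable_lborel_product[where C = "2 * K" and S = 1 and R = "R + 1"])
      show "(\<lambda>z :: ('a \<times> real) \<times> ('a \<times> real). 2 * K * (indicator (cball 0 1) (fst z) * indicator (cball 0 (R + 1)) (snd z))) \<in> borel_measurable borel"
        by measurable
      show "\<bar>2 * K * (indicator (cball 0 1) (fst (w, X)) * indicator (cball 0 (R + 1)) (snd (w, X)))\<bar>
        \<le> 2 * K * (indicator (cball 0 1) w * indicator (cball 0 (R + 1)) X)" for w X :: "'a \<times> real"
        using K(1) by (simp add: indicator_def)
    qed
    show "AE z in lborel. (\<lambda>n. S' n z) \<longlonglongrightarrow> 0"
      using u
    proof eventually_elim
      case (elim z)
      show ?case
      proof (cases "norm (fst z) \<le> 1 \<and> norm (snd z) \<le> R + 1")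
        case True
        then have "(\<lambda>n. u (snd z + e n *\<^sub>R fst z)) \<longlonglongrightarrow> u (snd z)" using elim by blast
        from continuous_on_tendsto_compose[OF div_f_continuous[of "fst (snd z)"] this]
        have "(\<lambda>n. div_f (fst (snd z)) (u (snd z + e n *\<^sub>R fst z))) \<longlonglongrightarrow> div_f (fst (snd z)) (u (snd z))" by simp
        from tendsto_rabs[OF tendsto_diff[OF this tendsto_const[of "G (snd z)"]]]
        have "(\<lambda>n. \<bar>div_f (fst (snd z)) (u (snd z + e n *\<^sub>R fst z)) - G (snd z)\<bar>) \<longlonglongrightarrow> 0" by (simp add: G_def)
        from tendsto_mult_right_zero[OF this] show ?thesis unfolding S'_def .
      next
        case False
        then have "S' n z = 0" for n by (auto simp: S'_def)
        then show ?thesis by simp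
      qed
    qed
    show "AE z in lborel. norm (S' n z) \<le> (2 * K) * ?i (R + 1) z" for n
    proof (rule AE_I2)
      fix z show "norm (S' n z) \<le> (2 * K) * ?i (R + 1) z" using S'_bound[of n "fst z" "snd z"] by simp
    qed
  qed auto
  have E_le: "\<bar>doubled_error (e n) z\<bar> \<le> sup_\<psi> * (E1 n z + S n z)" for n z
  proof (cases "norm (fst z) \<le> 1 \<and> norm (snd z) \<le> R")
    case True
    define Y where "Y = snd z - e n *\<^sub>R fst z"
    have "\<bar>doubled_error (e n) z\<bar> \<le> sup_\<psi> * (1 * (1 * \<bar>div_f (fst Y) (u (snd z)) - div_f (fst (snd z)) (u (snd z))\<bar>))"
      unfolding doubled_error_def abs_mult Y_def[symmetric] using sup_\<psi>(1) sup_\<psi>(2)[of "snd z"] \<psi>_nonneg[of "snd z"] moll_bounds[of "fst z"]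
      by (intro mult_mono) (auto simp: sgn_real_def)
    also have "\<dots> \<le> sup_\<psi> * (E1 n z + S n z)"
    proof (rule mult_left_mono[OF _ sup_\<psi>(1)])
      have tri: "1 * (1 * \<bar>a - c\<bar>) \<le> \<bar>b - c\<bar> + \<bar>a - b\<bar>" for a b c :: real by simp
      have eqs: "E1 n z = \<bar>G Y - G (snd z)\<bar>" "S n z = \<bar>div_f (fst Y) (u (snd z)) - G Y\<bar>"
        using True by (simp_all add: E1_def S_def Y_def)
      show "1 * (1 * \<bar>div_f (fst Y) (u (snd z)) - div_f (fst (snd z)) (u (snd z))\<bar>) \<le> E1 n z + S n z"
        unfolding eqs G_def by (rule tri)
    qed
    finally show ?thesis .
  next
    case False
    then show ?thesis unfolding outside[OF False] using sup_\<psi>(1) by (simp add: E1_def S_def)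
  qed
  show ?thesis
  proof (rule Lim_null_comparison)
    show "\<forall>\<^sub>F n in sequentially. norm (\<integral>z. doubled_error (e n) z \<partial>lborel) \<le> sup_\<psi> * ((\<integral>z. E1 n z \<partial>lborel) + (\<integral>z. S' n z \<partial>lborel))"
    proof (rule always_eventually, rule allI)
      fix n
      have i: "integrable lborel (\<lambda>z. sup_\<psi> * (E1 n z + S n z))" using E1i Si by simp
      have Ei: "integrable lborel (doubled_error (e n))"
      proof (rule Bochner_Integration.integrable_bound[OF i])
        show "AE z in lborel. norm (doubled_error (e n) z) \<le> norm (sup_\<psi> * (E1 n z + S n z))"
          using order_trans[OF E_le abs_ge_self] by (intro AE_I2) simp
      qed measurable
      have "norm (\<integral>z. doubled_error (e n) z \<partial>lborel) \<le> (\<integral>z. norm (doubled_error (e n) z) \<partial>lborel)" by (rule integral_norm_bound)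
      also have "\<dots> \<le> (\<integral>z. sup_\<psi> * (E1 n z + S n z) \<partial>lborel)"
        by (intro integral_mono integrable_norm Ei i) (simp add: E_le)
      also have "\<dots> = sup_\<psi> * ((\<integral>z. E1 n z \<partial>lborel) + (\<integral>z. S n z \<partial>lborel))" using E1i Si by simp
      also have "\<dots> \<le> sup_\<psi> * ((\<integral>z. E1 n z \<partial>lborel) + (\<integral>z. S' n z \<partial>lborel))"
        using S_le[of n] sup_\<psi>(1) by (intro mult_left_mono) auto
      finally show "norm (\<integral>z. doubled_error (e n) z \<partial>lborel) \<le> sup_\<psi> * ((\<integral>z. E1 n z \<partial>lborel) + (\<integral>z. S' n z \<partial>lborel))" .
    qed
    have "(\<lambda>n. sup_\<psi> * ((\<integral>z. E1 n z \<partial>lborel) + (\<integral>z. S' n z \<partial>lborel))) \<longlonglongrightarrow> sup_\<psi> * (0 + 0)"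
      using S'_lim by (intro tendsto_intros E1_lim) simp
    then show "(\<lambda>n. sup_\<psi> * ((\<integral>z. E1 n z \<partial>lborel) + (\<integral>z. S' n z \<partial>lborel))) \<longlonglongrightarrow> 0" by simp
  qed
qed

text \<open>The doubled integral is nonnegative for each step; in the limit it factors into the
  integral of \<open>moll\<close>, which is positive, and the integral in question.\<close>

theorem kruzkov_integrand_integral_nonneg: "0 \<le> (\<integral>X. kruzkov_integrand X \<partial>lborel)"
proof -
  \<comment> \<open>The 1 keeps shifts inside radius \<open>R + 1\<close>; \<tau> / 2 keeps the test
    function in \<open>Y\<close> away from the initial time.\<close>
  define e0 where "e0 = min 1 (\<tau> / 2)"
  have e0: "0 < e0" "e0 \<le> 1" "e0 < \<tau>" using \<tau> by (auto simp: e0_def)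
  define \<epsilon> where "\<epsilon> n = e0 * inverse (real (Suc n))" for n
  have inv: "0 < inverse (real (Suc n))" "inverse (real (Suc n)) \<le> 1" for n by (simp_all add: inverse_le_1_iff)
  have \<epsilon>0: "0 < \<epsilon> n" "\<epsilon> n \<le> e0" for n
    using e0 inv[of n] by (simp_all add: \<epsilon>_def mult_left_le del: of_nat_Suc)
  have \<epsilon>_lim: "\<epsilon> \<longlonglongrightarrow> 0"
    unfolding \<epsilon>_def[abs_def] using tendsto_mult[OF tendsto_const[of e0] LIMSEQ_inverse_real_of_nat] by simp
  have a1: "(\<lambda>n. - \<epsilon> n) \<longlonglongrightarrow> 0" using tendsto_minus[OF \<epsilon>_lim] by simp
  have a2: "\<bar>- \<epsilon> n\<bar> \<le> 1" for n using \<epsilon>0[of n] e0 by simp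
  \<comment> \<open>A first subsequence for \<open>v\<close>, with negative steps, at points
    \<open>X\<close> of the support.\<close>
  from AE_rescaled_translation_subseq[OF v_borel vC a1 a2 R] obtain s1 :: "nat \<Rightarrow> nat" where s1: "strict_mono s1"
    "AE z in lborel. norm (fst z) \<le> 1 \<and> norm (snd z) \<le> R \<longrightarrow> (\<lambda>n. v (snd z + (- \<epsilon> (s1 n)) *\<^sub>R fst z)) \<longlonglongrightarrow> v (snd z)" by blast
  have b1: "(\<lambda>n. \<epsilon> (s1 n)) \<longlonglongrightarrow> 0" using LIMSEQ_subseq_LIMSEQ[OF \<epsilon>_lim s1(1)] by (simp add: o_def)
  have b2: "\<bar>\<epsilon> (s1 n)\<bar> \<le> 1" for n using \<epsilon>0[of "s1 n"] e0 by simp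
  have R1: "R + 1 \<ge> 0" using R by simp
  \<comment> \<open>Refined for \<open>u\<close> with positive steps and radius
    \<open>R + 1\<close>, because the error term was rewritten with \<open>Y\<close> as the
    variable.\<close>
  from AE_rescaled_translation_subseq[OF u_borel uC b1 b2 R1] obtain s2 :: "nat \<Rightarrow> nat" where s2: "strict_mono s2"
    "AE z in lborel. norm (fst z) \<le> 1 \<and> norm (snd z) \<le> R + 1 \<longrightarrow> (\<lambda>n. u (snd z + \<epsilon> (s1 (s2 n)) *\<^sub>R fst z)) \<longlonglongrightarrow> u (snd z)" by blast
  define e where "e n = \<epsilon> (s1 (s2 n))" for n
  have e: "e \<longlonglongrightarrow> 0" "\<And>n. e n > 0" "\<And>n. e n \<le> 1" "\<And>n. e n < \<tau>"
  proof -
    show "e \<longlonglongrightarrow> 0" unfolding e_def[abs_def] using LIMSEQ_subseq_LIMSEQ[OF b1 s2(1)] by (simp add: o_def)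
    show "e n > 0" "e n \<le> 1" "e n < \<tau>" for n using \<epsilon>0[of "s1 (s2 n)"] e0 by (auto simp: e_def)
  qed
  have v_lim: "AE z in lborel. norm (fst z) \<le> 1 \<and> norm (snd z) \<le> R \<longrightarrow> (\<lambda>n. v (snd z - e n *\<^sub>R fst z)) \<longlonglongrightarrow> v (snd z)"
    using s1(2)
  proof eventually_elim
    case (elim z)
    show ?case
    proof
      assume "norm (fst z) \<le> 1 \<and> norm (snd z) \<le> R"
      with elim have "(\<lambda>n. v (snd z + (- \<epsilon> (s1 n)) *\<^sub>R fst z)) \<longlonglongrightarrow> v (snd z)" by blast
      from LIMSEQ_subseq_LIMSEQ[OF this s2(1)] show "(\<lambda>n. v (snd z - e n *\<^sub>R fst z)) \<longlonglongrightarrow> v (snd z)"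
        by (simp add: o_def e_def)
    qed
  qed
  have E_lim: "(\<lambda>n. \<integral>z. doubled_error (e n) z \<partial>lborel) \<longlonglongrightarrow> 0"
    by (rule doubled_error_tendsto[OF e(1-3)]) (use s2(2) in \<open>simp only: e_def\<close>)
  obtain K where K: "K \<ge> 0"
    "\<forall>\<epsilon> z. 0 < \<epsilon> \<and> \<epsilon> \<le> 1 \<longrightarrow> \<bar>doubled_main \<epsilon> z\<bar> \<le> K * (indicator (cball 0 1) (fst z) * indicator (cball 0 R) (snd z))"
    "\<forall>\<epsilon> z. 0 < \<epsilon> \<and> \<epsilon> \<le> 1 \<longrightarrow> \<bar>doubled_error \<epsilon> z\<bar> \<le> K * (indicator (cball 0 1) (fst z) * indicator (cball 0 R) (snd z))"
    by (rule doubled_bounds)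
  have [measurable]: "cball (0 :: 'a \<times> real) s \<in> sets borel" for s by simp
  let ?dom = "\<lambda>z :: ('a \<times> real) \<times> ('a \<times> real). K * (indicator (cball 0 1) (fst z) * indicator (cball 0 R) (snd z))"
  have dom: "integrable lborel ?dom"
  proof (rule integrable_lborel_product[where C = K and S = 1 and R = R])
    show "?dom \<in> borel_measurable borel" by measurable
    show "\<bar>?dom (w, X)\<bar> \<le> K * (indicator (cball 0 1) w * indicator (cball 0 R) X)" for w X
      using K(1) by (simp add: indicator_def)
  qed
  have xN: "AE z in (lborel :: (('a \<times> real) \<times> ('a \<times> real)) measure). fst (snd z) \<notin> N"
  proof -
    have m: "{z \<in> space (lborel \<Otimes>\<^sub>M lborel). fst (snd z) \<notin> N} \<in> sets (lborel \<Otimes>\<^sub>M (lborel :: ('a \<times> real) measure))"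
    proof -
      have [measurable]: "N \<in> sets borel" using N_null by auto
      show ?thesis by measurable
    qed
    have "AE X in (lborel :: ('a \<times> real) measure). fst X \<notin> N"
      using AE_not_in[OF NxUNIV_null] by eventually_elim (simp add: mem_Times_iff)
    then have "AE w in (lborel :: ('a \<times> real) measure). AE X in (lborel :: ('a \<times> real) measure). fst (snd (w, X)) \<notin> N"
      unfolding snd_conv by (rule AE_I2)
    from lborel_pair.AE_pair_measure[OF m this] show ?thesis unfolding lborel_prod .
  qed
  have ptw: "AE z in lborel. (\<lambda>n. doubled_main (e n) z) \<longlonglongrightarrow> doubled_limit z"
    using v_lim xN
  proof eventually_elim
    case (elim z)
    show ?case
    proof (cases "norm (fst z) \<le> 1 \<and> norm (snd z) \<le> R")
      case True
      then show ?thesis using elim by (intro doubled_main_tendsto e) auto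
    next
      case False
      then have "doubled_limit z = 0"
        using moll_outside[of "fst z"] zero[of "snd z"] by (auto simp: doubled_limit_def kruzkov_integrand_def not_le)
      then show ?thesis by (simp add: outside[OF False])
    qed
  qed
  have doubled_main_bound: "AE z in lborel. norm (doubled_main (e n) z) \<le> ?dom z" for n
    unfolding real_norm_def by (rule AE_I2) (rule K(2)[rule_format, OF conjI[OF e(2,3)]])
  have H1m: "doubled_main (e n) \<in> borel_measurable lborel" for n by measurable
  have Hm: "doubled_limit \<in> borel_measurable lborel" by measurable
  have H1_lim: "(\<lambda>n. \<integral>z. doubled_main (e n) z \<partial>lborel) \<longlonglongrightarrow> (\<integral>z. doubled_limit z \<partial>lborel)"
    by (rule integral_dominated_convergence[OF Hm H1m dom ptw doubled_main_bound])
  have Hinf_int: "integrable lborel doubled_limit"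
    by (rule integrable_dominated_convergence[OF Hm H1m dom ptw doubled_main_bound])
  have H1i: "integrable lborel (doubled_main (e n))" for n
    by (rule integrable_dominated_convergence2[OF Hm H1m dom ptw doubled_main_bound])
  have Ei: "integrable lborel (doubled_error (e n))" for n
  proof (rule Bochner_Integration.integrable_bound[OF dom])
    show "AE z in lborel. norm (doubled_error (e n) z) \<le> norm (?dom z)"
      unfolding real_norm_def
      by (rule AE_I2) (rule order_trans[OF K(3)[rule_format, OF conjI[OF e(2,3)]] abs_ge_self])
  qed measurable
  have "(\<lambda>n. (\<integral>z. doubled_main (e n) z \<partial>lborel) + (\<integral>z. doubled_error (e n) z \<partial>lborel)) \<longlonglongrightarrow> (\<integral>z. doubled_limit z \<partial>lborel) + 0"
    by (intro tendsto_add H1_lim E_lim)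
  moreover have "(\<integral>z. doubled_main (e n) z \<partial>lborel) + (\<integral>z. doubled_error (e n) z \<partial>lborel) \<ge> 0" for n
    using doubled_integral_nonneg[OF e(2,3,4), of n] H1i Ei by (simp add: doubled_split[OF e(2)])
  ultimately have "0 \<le> (\<integral>z. doubled_limit z \<partial>lborel) + 0" by (intro LIMSEQ_le_const) auto
  then have "0 \<le> (\<integral>w. moll (w :: 'a \<times> real) \<partial>lborel) * (\<integral>X. kruzkov_integrand X \<partial>lborel)"
    using doubled_limit_integral(2)[OF Hinf_int] by simp
  then show ?thesis using moll_integral_pos[where 'b = "'a \<times> real"] by (simp add: zero_le_mult_iff)
qed

end

subsection \<open>From the definitions to the doubling argument\<close>

text \<open>Compactness makes local Lipschitz bounds uniform on bounded sets; a family constant in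
  time over \<open>{0}\<close> puts \<open>f\<close> into the form of the compactness
  theorem.\<close>

lemma flux_assumption_lipschitz:
  fixes f :: "'a::euclidean_space \<Rightarrow> real \<Rightarrow> 'a"
  assumes "locally_lipschitz (\<lambda>(x, k). f x k)"
  shows "\<exists>L\<ge>0. \<forall>x y k l. norm x \<le> R \<and> norm y \<le> R \<and> \<bar>k\<bar> \<le> R \<and> \<bar>l\<bar> \<le> R \<longrightarrow>
      norm (f x k - f y l) \<le> L * (norm (x - y) + \<bar>k - l\<bar>)"
proof -
  let ?F = "\<lambda>(x, k). f x k"
  let ?X = "cball (0 :: 'a) R \<times> cball (0 :: real) R"
  have "local_lipschitz {0 :: real} ?X (\<lambda>_. ?F)"
  proof (rule local_lipschitzI)
    fix t :: real and z :: "'a \<times> real"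
    from assms obtain e L where e: "e > 0" and L: "L-lipschitz_on (ball z e) ?F"
      unfolding locally_lipschitz_def by blast
    have "L-lipschitz_on (cball z (e / 2) \<inter> ?X) ?F"
      by (rule lipschitz_on_subset[OF L]) (use e in auto)
    then show "\<exists>u>0. \<exists>L. \<forall>t\<in>cball t u \<inter> {0}. L-lipschitz_on (cball z u \<inter> ?X) ?F"
      using e by (intro exI[of _ "e / 2"]) auto
  qed
  from local_lipschitz_compact_implies_lipschitz[OF this compact_Times[OF compact_cball compact_cball]
      compact_sing continuous_on_const]
  obtain L where "\<forall>t\<in>{0 :: real}. L-lipschitz_on ?X ?F" by auto
  then have L: "L-lipschitz_on ?X ?F" by simp
  have "norm (f x k - f y l) \<le> L * (norm (x - y) + \<bar>k - l\<bar>)"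
    if "norm x \<le> R \<and> norm y \<le> R \<and> \<bar>k\<bar> \<le> R \<and> \<bar>l\<bar> \<le> R" for x y k l
  proof -
    have "norm (f x k - f y l) \<le> L * dist (x, k) (y, l)"
      using lipschitz_onD[OF L, of "(x, k)" "(y, l)"] that by (simp add: dist_norm)
    also have "dist (x, k) (y, l) \<le> dist x y + dist k l"
      unfolding dist_Pair_Pair by (rule sqrt_sum_squares_le_sum) auto
    finally show ?thesis
      using lipschitz_on_nonneg[OF L] by (simp add: dist_norm mult_left_mono order_trans[OF _ mult_left_mono])
  qed
  then show ?thesis using lipschitz_on_nonneg[OF L] by blast
qed

lemma flux_assumption_imp_flux:
  fixes f :: "'a::euclidean_space \<Rightarrow> real \<Rightarrow> 'a"
  assumes "flux_assumption f"
  shows "\<exists>D N. flux f D N"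
proof -
  have loc: "locally_lipschitz (\<lambda>(x, k). f x k)" using assms by (simp add: flux_assumption_def)
  from assms obtain \<Theta> where \<Theta>: "\<Theta> \<in> null_sets lebesgue"
    "\<forall>x. x \<notin> \<Theta> \<longrightarrow> continuous_on UNIV (Dx f x)"
    "\<forall>x. x \<notin> \<Theta> \<longrightarrow> (\<forall>K. compact K \<and> K \<noteq> {} \<longrightarrow>
           ((\<lambda>y. SUP k\<in>K. norm (f y k - f x k - Dx f x k (y - x)) / norm (y - x)) \<longlongrightarrow> 0) (at x))"
    unfolding flux_assumption_def by blast
  \<comment> \<open>A null set of the completion lies in a Borel null set; discarding the larger set
    is harmless and allows a Borel \<open>D\<close>.\<close>
  from \<Theta>(1) obtain N where N: "N \<in> null_sets lborel" "\<Theta> \<subseteq> N"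
    unfolding null_sets_completion_iff2 by blast
  define D where "D x k v = (if x \<in> N then 0 else blinfun_apply (Dx f x k) v)" for x k v
  have Dx: "D x k = blinfun_apply (Dx f x k)" if "x \<notin> N" for x k using that by (simp add: D_def fun_eq_iff)
  have contf: "continuous_on UNIV (f y)" for y
  proof -
    have "isCont (f y) k" for k
    proof -
      from loc obtain e L where e: "e > 0" and L: "L-lipschitz_on (ball (y, k) e) (\<lambda>(x, k). f x k)"
        unfolding locally_lipschitz_def by blast
      have "continuous_on (ball (y, k) e) (\<lambda>(x, k). f x k)" by (rule lipschitz_on_continuous_on[OF L])
      then have c: "isCont (\<lambda>(x, k). f x k) (y, k)" using e by (simp add: continuous_on_interior)
      have "isCont (\<lambda>k. (y, k)) k" by (intro continuous_intros)
      from isCont_o2[OF this c] show ?thesis by simp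
    qed
    then show ?thesis by (simp add: continuous_on_eq_continuous_at)
  qed
  have "flux f D N"
  proof (rule flux.intro)
    show "\<exists>L\<ge>0. \<forall>x y k l. norm x \<le> R \<and> norm y \<le> R \<and> \<bar>k\<bar> \<le> R \<and> \<bar>l\<bar> \<le> R \<longrightarrow>
      norm (f x k - f y l) \<le> L * (norm (x - y) + \<bar>k - l\<bar>)" for R
      by (rule flux_assumption_lipschitz[OF loc])
    show "N \<in> null_sets lborel" by (rule N(1))
    show "D x k v = 0" if "x \<in> N" for x k v using that by (simp add: D_def)
    show "linear (D x k)" for x k
    proof (cases "x \<in> N")
      case True
      then have "D x k = (\<lambda>_. 0)" by (simp add: D_def fun_eq_iff)
      then show ?thesis by (simp add: linear_zero)
    next
      case False
      show ?thesis unfolding Dx[OF False] by (rule bounded_linear.linear[OF blinfun.bounded_linear_right])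
    qed
    show "continuous_on UNIV (\<lambda>k. D x k v)" for x v
    proof (cases "x \<in> N")
      case False
      then have c: "continuous_on UNIV (Dx f x)" using \<Theta>(2) N(2) by blast
      show ?thesis unfolding Dx[OF False] by (intro continuous_intros c)
    qed (simp add: D_def)
    show "\<exists>d>0. \<forall>y k. \<bar>k\<bar> \<le> R \<and> norm (y - x) < d \<longrightarrow> norm (f y k - f x k - D x k (y - x)) \<le> e * norm (y - x)"
      if x: "x \<notin> N" and e: "e > 0" for x e R
    proof (cases "R \<ge> 0")
      case True
      let ?K = "{- R..R}"
      let ?q = "\<lambda>y k. norm (f y k - f x k - Dx f x k (y - x)) / norm (y - x)"
      have c: "continuous_on UNIV (Dx f x)" using \<Theta>(2) N(2) x by blast
      have "x \<notin> \<Theta>" using N(2) x by blast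
      then have "((\<lambda>y. SUP k\<in>?K. ?q y k) \<longlongrightarrow> 0) (at x)"
        using \<Theta>(3) True by auto
      from tendstoD[OF this e] obtain d where d: "d > 0"
        "\<And>y. y \<noteq> x \<Longrightarrow> dist y x < d \<Longrightarrow> dist (SUP k\<in>?K. ?q y k) 0 < e"
        unfolding eventually_at by auto
      have "norm (f y k - f x k - D x k (y - x)) \<le> e * norm (y - x)" if k: "\<bar>k\<bar> \<le> R" and y: "norm (y - x) < d" for y k
      proof (cases "y = x")
        case True
        then show ?thesis unfolding Dx[OF x] by simp
      next
        case False
        \<comment> \<open>A real supremum bounds its members only when the set is bounded above,
          which continuity in the state on a compact interval provides.\<close>
        have "continuous_on ?K (?q y)"
          by (intro continuous_intros continuous_on_subset[OF contf] continuous_on_subset[OF c]) (use False in auto)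
        then have "bdd_above (?q y ` ?K)"
          by (intro bounded_imp_bdd_above compact_imp_bounded compact_continuous_image) auto
        then have "?q y k \<le> (SUP k\<in>?K. ?q y k)" using k by (intro cSUP_upper) auto
        also have "\<dots> < e" using d(2)[OF False] y by (simp add: dist_norm)
        finally have "norm (f y k - f x k - Dx f x k (y - x)) \<le> e * norm (y - x)"
          using False by (simp add: pos_divide_less_eq less_imp_le)
        then show ?thesis unfolding Dx[OF x] .
      qed
      with d(1) show ?thesis by blast
    next
      \<comment> \<open>For negative \<open>R\<close> no state qualifies.\<close>
      case False
      then have "\<not> \<bar>k\<bar> \<le> R" for k by simp
      then show ?thesis by (intro exI[of _ 1]) simp
    qed
  qed
  then show ?thesis by blast
qed

text \<open>A bound valid at every point allows evaluation at frozen and shifted points without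
  exceptional sets.\<close>

lemma L_infinity_borel_representative:
  fixes u :: "'a::euclidean_space \<times> real \<Rightarrow> real"
  assumes "L_infinity (UNIV \<times> {0<..}) u"
  shows "\<exists>v C. v \<in> borel_measurable borel \<and> (\<forall>z. \<bar>v z\<bar> \<le> C) \<and> (AE z in lborel. snd z > 0 \<longrightarrow> u z = v z)"
proof -
  let ?S = "UNIV \<times> {0<..} :: ('a \<times> real) set"
  have S: "?S \<in> sets lebesgue" by (simp add: borel_open open_Times)
  from assms obtain C where u: "u \<in> borel_measurable (lebesgue_on ?S)" and C: "AE z in lebesgue_on ?S. \<bar>u z\<bar> \<le> C"
    unfolding L_infinity_def by blast
  have "(\<lambda>z. indicator ?S z *\<^sub>R u z) \<in> borel_measurable lebesgue"
    using u borel_measurable_restrict_space_iff[of ?S lebesgue u] S by simp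
  from completion_ex_borel_measurable_real[OF this] obtain w where w: "w \<in> borel_measurable borel"
    "AE z in lborel. indicator ?S z *\<^sub>R u z = w z" by auto
  \<comment> \<open>Truncation at the essential bound; at positive times it changes \<open>w\<close>
    on a null set only.\<close>
  define v where "v z = max (- \<bar>C\<bar>) (min \<bar>C\<bar> (w z))" for z
  have "AE z in lebesgue. z \<in> ?S \<longrightarrow> \<bar>u z\<bar> \<le> C" using C S by (simp add: AE_restrict_space_iff)
  then have "AE z in lborel. z \<in> ?S \<longrightarrow> \<bar>u z\<bar> \<le> C" unfolding AE_completion_iff .
  with w(2) have "AE z in lborel. snd z > 0 \<longrightarrow> u z = v z"
  proof eventually_elim
    case (elim z)
    show ?case
    proof
      assume "snd z > 0"
      then have z: "z \<in> ?S" by (simp add: mem_Times_iff)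
      with elim have "u z = w z" "\<bar>w z\<bar> \<le> C" by auto
      then show "u z = v z" unfolding v_def by linarith
    qed
  qed
  moreover have "v \<in> borel_measurable borel" using w(1) unfolding v_def[abs_def] by measurable
  moreover have "\<bar>v z\<bar> \<le> \<bar>C\<bar>" for z by (auto simp: v_def)
  ultimately show ?thesis by blast
qed

text \<open>The gradient is assembled from directional derivatives and set to 0 on the null set of
  Rademacher's theorem; this keeps its bound and its vanishing on \<open>U\<close> valid at every
  point.\<close>

lemma lipschitz_gradient_representative:
  fixes \<phi> :: "'b::euclidean_space \<Rightarrow> real"
  assumes lip: "L-lipschitz_on UNIV \<phi>" and U: "open U" "\<And>z. z \<in> U \<Longrightarrow> \<phi> z = 0"
  obtains p where "p \<in> borel_measurable borel" "\<forall>z. norm (p z) \<le> L" "\<forall>z\<in>U. p z = 0"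
    "AE z in lborel. (\<phi> has_derivative (\<lambda>h. h \<bullet> p z)) (at z)"
proof -
  from AE_lborelE[OF rademacher[OF lip]] obtain N where N: "N \<in> null_sets lborel"
    "\<forall>z. z \<notin> N \<longrightarrow> \<phi> differentiable (at z)" .
  define p where "p z = (\<Sum>b\<in>Basis. (if z \<in> N then 0 else dir_deriv \<phi> b z) *\<^sub>R b)" for z
  have [measurable]: "\<phi> \<in> borel_measurable borel"
    by (rule borel_measurable_continuous_onI[OF lipschitz_on_continuous_on[OF lip]])
  have along: "((\<lambda>s. \<phi> (z + s *\<^sub>R v)) has_real_derivative frechet_derivative \<phi> (at z) v) (at 0)" if "z \<notin> N" for z v
  proof -
    have d: "(\<phi> has_derivative frechet_derivative \<phi> (at z)) (at z)"
      using N(2) that frechet_derivative_works by blast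
    have lin: "linear (frechet_derivative \<phi> (at z))" using N(2) that linear_frechet_derivative by blast
    have "((\<lambda>s. \<phi> (z + s *\<^sub>R v)) has_derivative (\<lambda>s. frechet_derivative \<phi> (at z) (s *\<^sub>R v))) (at 0)"
      by (rule has_derivative_compose[where g = \<phi> and f = "\<lambda>s. z + s *\<^sub>R v" and f' = "\<lambda>s. s *\<^sub>R v"])
        (use d in \<open>auto intro!: derivative_eq_intros\<close>)
    then show ?thesis
      unfolding has_field_derivative_def by (rule has_derivative_eq_rhs) (auto simp: linear_scale[OF lin])
  qed
  have dd: "dir_deriv \<phi> v z = frechet_derivative \<phi> (at z) v" if "z \<notin> N" for z v
    unfolding dir_deriv_def by (rule DERIV_imp_deriv[OF along[OF that]])
  have q: "(\<lambda>n. dir_quot \<phi> v n z) \<longlonglongrightarrow> dir_deriv \<phi> v z" if "z \<notin> N" for z v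
    using along[OF that, of v] by (intro dir_quot_tendsto) (auto simp: real_differentiable_def)
  have "p \<in> borel_measurable borel"
    unfolding p_def[abs_def]
  proof (intro borel_measurable_sum borel_measurable_scaleR borel_measurable_const)
    show "(\<lambda>z. if z \<in> N then 0 else dir_deriv \<phi> b z) \<in> borel_measurable borel" for b
      by (rule borel_measurable_limit_off_null[OF N(1) _ q]) (unfold dir_quot_def, measurable)
  qed
  moreover have deriv: "(\<phi> has_derivative (\<lambda>h. h \<bullet> p z)) (at z)" if "z \<notin> N" for z
  proof -
    have d: "(\<phi> has_derivative frechet_derivative \<phi> (at z)) (at z)"
      using N(2) that frechet_derivative_works by blast
    have lin: "linear (frechet_derivative \<phi> (at z))" using N(2) that linear_frechet_derivative by blast
    have "frechet_derivative \<phi> (at z) h = h \<bullet> p z" for h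
    proof -
      have "frechet_derivative \<phi> (at z) h = frechet_derivative \<phi> (at z) (\<Sum>b\<in>Basis. (h \<bullet> b) *\<^sub>R b)"
        by (simp add: euclidean_representation)
      also have "\<dots> = (\<Sum>b\<in>Basis. (h \<bullet> b) * frechet_derivative \<phi> (at z) b)"
        by (simp add: linear_sum[OF lin] linear_scale[OF lin])
      also have "\<dots> = h \<bullet> p z" using that by (simp add: p_def inner_sum_right dd mult.commute)
      finally show ?thesis .
    qed
    then have "frechet_derivative \<phi> (at z) = (\<lambda>h. h \<bullet> p z)" by (rule ext)
    with d show ?thesis by simp
  qed
  moreover have "norm (p z) \<le> L" for z
  proof (cases "z \<in> N")
    case True
    then show ?thesis using lipschitz_on_nonneg[OF lip] by (simp add: p_def)
  next
    case False
    \<comment> \<open>The Lipschitz bound along the direction \<open>p z\<close> itself: the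
      derivative there is the square of \<open>norm (p z)\<close>.\<close>
    have "\<bar>dir_deriv \<phi> (p z) z\<bar> \<le> L * norm (p z)"
      by (rule tendsto_upperbound[OF tendsto_rabs[OF q[OF False]]]) (auto intro: always_eventually dir_quot_bound[OF lip])
    moreover have "dir_deriv \<phi> (p z) z = p z \<bullet> p z"
      unfolding dd[OF False] frechet_derivative_at[OF deriv[OF False], symmetric] ..
    ultimately have "norm (p z) * norm (p z) \<le> L * norm (p z)" by (simp add: dot_square_norm power2_eq_square)
    then show ?thesis using lipschitz_on_nonneg[OF lip] by (cases "p z = 0") auto
  qed
  moreover have "p z = 0" if "z \<in> U" for z
  proof (cases "z \<in> N")
    case False
    have "((\<lambda>_. 0) has_derivative (\<lambda>h. h \<bullet> p z)) (at z)"
      by (rule has_derivative_transform_within_open[OF deriv[OF False] U(1) that U(2)])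
    moreover have "((\<lambda>_. 0) has_derivative (\<lambda>h. 0)) (at z)" by (rule has_derivative_const)
    ultimately have "(\<lambda>h. h \<bullet> p z) = (\<lambda>h. 0)" by (rule has_derivative_unique)
    then have "p z \<bullet> p z = 0" by meson
    then show ?thesis by simp
  qed (simp add: p_def)
  moreover have "AE z in lborel. (\<phi> has_derivative (\<lambda>h. h \<bullet> p z)) (at z)"
    using AE_not_in[OF N(1)] by eventually_elim (rule deriv)
  ultimately show thesis by (intro that[of p]) auto
qed

text \<open>\<open>\<psi>\<close> vanishes near the initial time, so extension by 0 creates no jump
  and keeps the Lipschitz constant.\<close>

lemma Lip_c_extension:
  fixes \<psi> :: "'a::euclidean_space \<times> real \<Rightarrow> real"
  assumes "Lip_c (UNIV \<times> {0<..}) \<psi>"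
  obtains L R \<tau> where "L-lipschitz_on UNIV (\<lambda>z. if snd z > 0 then \<psi> z else 0)" "R \<ge> 0" "\<tau> > 0"
    "\<forall>z. norm z > R \<or> snd z < \<tau> \<longrightarrow> (if snd z > 0 then \<psi> z else 0) = 0"
proof -
  let ?S = "UNIV \<times> {0<..} :: ('a \<times> real) set"
  let ?e = "\<lambda>z. if snd z > 0 then \<psi> z else 0"
  define K where "K = closure {z \<in> ?S. \<psi> z \<noteq> 0}"
  from assms obtain L where L: "L-lipschitz_on ?S \<psi>" and K: "compact K" "K \<subseteq> ?S"
    unfolding Lip_c_def K_def by blast
  have L0: "L \<ge> 0" by (rule lipschitz_on_nonneg[OF L])
  have eK: "?e z = 0" if "z \<notin> K" for z
    using that closure_subset[of "{z \<in> ?S. \<psi> z \<noteq> 0}"] by (auto simp: K_def mem_Times_iff)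
  \<comment> \<open>The least time on the compact support is positive because the support lies in
    the open half-space; for empty support any positive number will do.\<close>
  have "\<exists>\<tau>>0. \<forall>z\<in>K. \<tau> \<le> snd z"
  proof (cases "K = {}")
    case False
    have "continuous_on K snd" by (intro continuous_intros)
    from continuous_attains_inf[OF K(1) False this] obtain z0 where z0: "z0 \<in> K" "\<forall>z\<in>K. snd z0 \<le> snd z" by blast
    then show ?thesis using K(2) by (intro exI[of _ "snd z0"]) (auto simp: mem_Times_iff)
  qed (auto intro: exI[of _ 1])
  then obtain \<tau> where \<tau>: "\<tau> > 0" "\<forall>z\<in>K. \<tau> \<le> snd z" by blast
  obtain R where R: "\<forall>z\<in>K. norm z \<le> R" using compact_imp_bounded[OF K(1)] unfolding bounded_iff by blast
  have zero: "?e z = 0" if "snd z < \<tau>" for z using eK[of z] \<tau>(2) that by force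
  have half: "\<bar>?e z - ?e z'\<bar> \<le> L * dist z z'" if z: "snd z > 0" for z z'
  proof (cases "snd z' > 0")
    case True
    then show ?thesis using z lipschitz_onD[OF L, of z z'] by (simp add: mem_Times_iff dist_real_def)
  next
    case False
    show ?thesis
    proof (cases "snd z < \<tau>")
      case True
      then show ?thesis using zero[OF True] False L0 by simp
    next
      case zt: False
      \<comment> \<open>Chosen so that \<open>y\<close> is the point of the segment from
        \<open>z\<close> to \<open>z'\<close> at time \<tau> / 2. There the extension already
        vanishes, and \<open>y\<close> is no further from \<open>z\<close> than \<open>z'\<close>
        is.\<close>
      define \<theta> where "\<theta> = (snd z - \<tau> / 2) / (snd z - snd z')"
      define y where "y = z + \<theta> *\<^sub>R (z' - z)"
      have den: "snd z - snd z' > 0" using zt False \<tau>(1) by simp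
      have \<theta>: "0 \<le> \<theta>" "\<theta> \<le> 1" using zt False \<tau>(1) den unfolding \<theta>_def by (auto simp: divide_le_eq)
      have "\<theta> * (snd z - snd z') = snd z - \<tau> / 2" using den by (simp add: \<theta>_def)
      then have "snd y = \<tau> / 2" by (simp add: y_def algebra_simps)
      then have y0: "snd y > 0" "?e y = 0" using \<tau>(1) zero[of y] by auto
      have "\<bar>?e z - ?e z'\<bar> = \<bar>\<psi> z - \<psi> y\<bar>" using z y0 False by simp
      also have "\<dots> \<le> L * dist z y"
        using z y0(1) lipschitz_onD[OF L, of z y] by (simp add: mem_Times_iff dist_real_def)
      also have "dist z y = \<theta> * dist z z'" using \<theta>(1) by (simp add: y_def dist_norm norm_minus_commute)
      also have "L * (\<theta> * dist z z') \<le> L * dist z z'"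
        using \<theta> L0 by (intro mult_left_mono) (auto simp: mult_left_le_one_le)
      finally show ?thesis .
    qed
  qed
  have "L-lipschitz_on UNIV ?e"
  proof (rule lipschitz_onI[OF _ L0])
    fix z z' :: "'a \<times> real"
    consider "snd z > 0" | "snd z' > 0" | "snd z \<le> 0" "snd z' \<le> 0" by linarith
    then show "dist (?e z) (?e z') \<le> L * dist z z'"
    proof cases
      case 1 then show ?thesis using half[of z z'] by (simp only: dist_real_def)
    next
      case 2 then show ?thesis using half[of z' z] by (simp only: dist_real_def abs_minus_commute dist_commute)
    next
      case 3 then show ?thesis using L0 by simp
    qed
  qed
  moreover have "\<forall>z. norm z > max R 0 \<or> snd z < \<tau> \<longrightarrow> ?e z = 0"
  proof (intro allI impI)
    fix z :: "'a \<times> real" assume "norm z > max R 0 \<or> snd z < \<tau>"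
    then have "z \<notin> K" using R \<tau>(2) by force
    then show "?e z = 0" by (rule eK)
  qed
  ultimately show thesis using \<tau>(1) by (intro that[of L "max R 0" \<tau>]) auto
qed

theorem lemma5p2:
  fixes f :: "'a::euclidean_space \<Rightarrow> real \<Rightarrow> 'a"
    and u u' :: "'a \<times> real \<Rightarrow> real"
    and u0 u0' :: "'a \<Rightarrow> real"
    and \<psi> :: "'a \<times> real \<Rightarrow> real"
  assumes "flux_assumption f"
    and "L_infinity UNIV u0" and "L_infinity UNIV u0'"
    and "L_infinity (UNIV \<times> {0<..}) u" and "L_infinity (UNIV \<times> {0<..}) u'"
    and "entropy_solution f {0<..} u0 u"
    and "entropy_solution f {0<..} u0' u'"
    and "Lip_c (UNIV \<times> {0<..}) \<psi>"
    and "\<And>x t. t > 0 \<Longrightarrow> \<psi> (x, t) \<ge> 0"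
  shows "(LINT t:{0<..}|lebesgue. LINT x|lebesgue.
            deriv (\<lambda>s. \<psi> (x, s)) t * kruzkov_entropy (u (x, t)) (u' (x, t))
            + gradient (\<lambda>y. \<psi> (y, t)) x \<bullet> kruzkov_flux f x (u (x, t)) (u' (x, t))) \<ge> 0"
proof -
  obtain D N where flux: "flux f D N" using flux_assumption_imp_flux[OF assms(1)] by blast
  interpret flux f D N by (rule flux)
  obtain v C where v: "v \<in> borel_measurable borel" "\<forall>z. \<bar>v z\<bar> \<le> C" "AE z in lborel. snd z > 0 \<longrightarrow> u z = v z"
    using L_infinity_borel_representative[OF assms(4)] by blast
  obtain v' C' where v': "v' \<in> borel_measurable borel" "\<forall>z. \<bar>v' z\<bar> \<le> C'" "AE z in lborel. snd z > 0 \<longrightarrow> u' z = v' z"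
    using L_infinity_borel_representative[OF assms(5)] by blast
  have kv: "kruzkov v" by (rule entropy_solution_imp_kruzkov[OF assms(6) v(1) _ v(3)]) (use v(2) in blast)
  have kv': "kruzkov v'" by (rule entropy_solution_imp_kruzkov[OF assms(7) v'(1) _ v'(3)]) (use v'(2) in blast)
  \<comment> \<open>The values of \<open>\<psi>\<close> at nonpositive times are arbitrary and are
    replaced by 0.\<close>
  define \<psi>e where "\<psi>e z = (if snd z > 0 then \<psi> z else 0)" for z
  from Lip_c_extension[OF assms(8)] obtain L R \<tau> where \<psi>e: "L-lipschitz_on UNIV \<psi>e" "R \<ge> 0" "\<tau> > 0"
    "\<forall>z. norm z > R \<or> snd z < \<tau> \<longrightarrow> \<psi>e z = 0" unfolding \<psi>e_def[abs_def] by blast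
  let ?U = "{z :: 'a \<times> real. norm z > R} \<union> {z. snd z < \<tau>}"
  have "open ?U" by (intro open_Un open_Collect_less continuous_intros)
  from lipschitz_gradient_representative[OF \<psi>e(1) this] \<psi>e(4) obtain p where p: "p \<in> borel_measurable borel"
    "\<forall>z. norm (p z) \<le> L" "\<forall>z\<in>?U. p z = 0" "AE z in lborel. (\<psi>e has_derivative (\<lambda>h. h \<bullet> p z)) (at z)" by auto
  interpret doubling f D N v v' \<psi>e p "max C C'" R \<tau> L L
  proof
    show "\<bar>v z\<bar> \<le> max C C'" "\<bar>v' z\<bar> \<le> max C C'" for z
      using v(2)[THEN spec, of z] v'(2)[THEN spec, of z] by auto
    show "0 \<le> \<psi>e z" for z using assms(9)[of "snd z" "fst z"] by (simp add: \<psi>e_def)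
    show "\<psi>e z = 0 \<and> p z = 0" if "norm z > R \<or> snd z < \<tau>" for z
      using \<psi>e(4)[THEN spec, of z] p(3)[THEN bspec, of z] that by simp
    show "norm (p z) \<le> L" for z using p(2) by blast
  qed (fact v(1) v'(1) kv kv' \<psi>e(1-3) p(1) p(4))+
  let ?h = "\<lambda>z. deriv (\<lambda>s. \<psi> (fst z, s)) (snd z) * kruzkov_entropy (u z) (u' z)
            + gradient (\<lambda>y. \<psi> (y, snd z)) (fst z) \<bullet> kruzkov_flux f (fst z) (u z) (u' z)"
  have "(LINT t:{0<..}|lebesgue. LINT x|lebesgue. ?h (x, t)) = (\<integral>z. kruzkov_integrand z \<partial>lborel)"
  proof (rule iterated_lebesgue_integral[OF doubled_limit_integral(1)])
    show "AE z in lborel. snd z > 0 \<longrightarrow> ?h z = kruzkov_integrand z"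
      using v(3) v'(3) p(4)
    proof eventually_elim
      case (elim z)
      show ?case
      proof
        assume t: "snd z > 0"
        \<comment> \<open>On the open set of positive times \<open>\<psi>\<close> agrees with its
          extension, so they have the same derivatives there.\<close>
        have "open {z :: 'a \<times> real. 0 < snd z}" by (intro open_Collect_less continuous_intros)
        then have "(\<psi> has_derivative (\<lambda>h. h \<bullet> p z)) (at (fst z, snd z))"
          unfolding prod.collapse
          by (rule has_derivative_transform_within_open[OF elim(3)]) (use t in \<open>auto simp: \<psi>e_def\<close>)
        note part = partial_derivatives[OF this]
        show "?h z = kruzkov_integrand z"
          unfolding part kruzkov_integrand_def kruzkov_entropy_def kruzkov_flux_def
          using elim(1,2) t by simp
      qed
    qed
    show "kruzkov_integrand z = 0" if "snd z \<le> 0" for z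
      using zero[of z] \<tau> that by (simp add: kruzkov_integrand_def)
  qed
  then show ?thesis using kruzkov_integrand_integral_nonneg by simp
qed

end
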